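(* There is an absolute constant $c>0$ such that for all integers $k\ge 1$, all $n\le m$ and every $X\in[n]^m$, $\mathsf{OPT}(X)\le c\,\log k\cdot \mathsf{F}^{k}(X)$.
   Context: $\log(x)$ denotes $\log_2(\max\{2,x\})$. Dynamic BST model: a BST on keys $[n]$ is maintained; to serve access $x_t$ a single pointer starts at the root and the algorithm performs pointer moves (to parent or child) and rotations, the pointer visiting the node holding $x_t$; cost of an access is the number of elementary operations plus one; $\mathsf{OPT}(X)$ is the minimum total cost over all offline BST algorithms with arbitrary initial tree. $k$-finger cost: for a static BST $T$ on $[n]$ (not modified), let $d_T(a,b)$ be the number of edges on the path between $a$ and $b$ in $T$. A $k$-finger strategy is an initial vector $\vec\ell\in[n]^k$ (initial finger positions) and a sequence $\vec f\in[k]^m$, finger $f_t$ serving access $x_t$; its cost is $\sum_{t=1}^m\big(1+d_T(x_t,p_t)\big)$, where $p_t$ is the position of finger $f_t$ before time $t$ (i.e. $x_s$ for the last $s<t$ with $f_s=f_t$, or $\ell_{f_t}$ if none). $\mathsf{F}^k_T(X)$ is the minimum cost over all $k$-finger strategies, and $\mathsf{F}^k(X)=\min_T\mathsf{F}^k_T(X)$ over all BSTs $T$ on $[n]$. *)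

theory Defs
  imports Complex_Main "HOL-Library.Tree"
begin

definition lg :: "real \<Rightarrow> real" where
  "lg x = log 2 (max 2 x)"

text \<open>Keys in a BST are distinct, so a node is identified by its key.
  The pointer is represented by the key of the node it points to.\<close>

fun node_at :: "'a tree \<Rightarrow> 'a \<Rightarrow> 'a tree" where
  "node_at Leaf p = Leaf"
| "node_at (Node l a r) p =
     (if a = p then Node l a r
      else if node_at l p \<noteq> Leaf then node_at l p else node_at r p)"

fun parent_key :: "'a tree \<Rightarrow> 'a \<Rightarrow> 'a option" where
  "parent_key Leaf p = None"
| "parent_key (Node l a r) p =
     (if (l \<noteq> Leaf \<and> value l = p) \<or> (r \<noteq> Leaf \<and> value r = p) then Some a
      else (case parent_key l p of Some b \<Rightarrow> Some b | None \<Rightarrow> parent_key r p))"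

fun rot_up :: "'a tree \<Rightarrow> 'a \<Rightarrow> 'a tree" where
  "rot_up Leaf p = Leaf"
| "rot_up (Node l a r) p =
     (case l of
        Node ll b lr \<Rightarrow> if b = p then Node ll b (Node lr a r)
          else (case r of
                  Node rl c rr \<Rightarrow> if c = p then Node (Node l a rl) c rr
                                  else Node (rot_up l p) a (rot_up r p)
                | Leaf \<Rightarrow> Node (rot_up l p) a (rot_up r p))
      | Leaf \<Rightarrow> (case r of
                  Node rl c rr \<Rightarrow> if c = p then Node (Node l a rl) c rr
                                  else Node (rot_up l p) a (rot_up r p)
                | Leaf \<Rightarrow> Node (rot_up l p) a (rot_up r p)))"

definition bst_step :: "('a tree \<times> 'a) \<Rightarrow> ('a tree \<times> 'a) \<Rightarrow> bool" where
  "bst_step s s' \<longleftrightarrow>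
     (let t = fst s; p = snd s; t' = fst s'; p' = snd s' in
        (t' = t \<and> parent_key t p = Some p')
      \<or> (t' = t \<and> node_at t p \<noteq> Leaf \<and> left (node_at t p) \<noteq> Leaf
               \<and> p' = value (left (node_at t p)))
      \<or> (t' = t \<and> node_at t p \<noteq> Leaf \<and> right (node_at t p) \<noteq> Leaf
               \<and> p' = value (right (node_at t p)))
      \<or> (parent_key t p \<noteq> None \<and> t' = rot_up t p \<and> p' = p))"

text \<open>Serving access x on tree t with cost c, resulting in tree t':
  a sequence of states starting with the pointer at the root, each obtained
  from the previous by one elementary operation, visiting the node x;
  cost = number of elementary operations + 1 = length of the state list.\<close>
definition serve :: "'a tree \<Rightarrow> 'a \<Rightarrow> nat \<Rightarrow> 'a tree \<Rightarrow> bool" where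
  "serve t x c t' \<longleftrightarrow> t \<noteq> Leaf \<and>
     (\<exists>ss. ss \<noteq> [] \<and> hd ss = (t, value t)
        \<and> (\<forall>i. Suc i < length ss \<longrightarrow> bst_step (ss ! i) (ss ! Suc i))
        \<and> (\<exists>s\<in>set ss. snd s = x)
        \<and> fst (last ss) = t'
        \<and> c = length ss)"

definition OPT :: "nat \<Rightarrow> nat list \<Rightarrow> nat" where
  "OPT n X = Inf {(\<Sum>i<length X. c i) | (ts :: nat \<Rightarrow> nat tree) (c :: nat \<Rightarrow> nat).
      bst (ts 0) \<and> set_tree (ts 0) = {1..n} \<and>
      (\<forall>i<length X. serve (ts i) (X ! i) (c i) (ts (Suc i)))}"

fun tdepth :: "'a tree \<Rightarrow> 'a \<Rightarrow> nat" where
  "tdepth Leaf a = 0"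
| "tdepth (Node l v r) a =
     (if a = v then 0 else if a \<in> set_tree l then Suc (tdepth l a) else Suc (tdepth r a))"

fun tdist :: "'a tree \<Rightarrow> 'a \<Rightarrow> 'a \<Rightarrow> nat" where
  "tdist Leaf a b = 0"
| "tdist (Node l v r) a b =
     (if a \<in> set_tree l \<and> b \<in> set_tree l then tdist l a b
      else if a \<in> set_tree r \<and> b \<in> set_tree r then tdist r a b
      else tdepth (Node l v r) a + tdepth (Node l v r) b)"

text \<open>Position of finger f t before time t (0-based times, fingers 0..k-1).\<close>
definition finger_pos :: "nat list \<Rightarrow> (nat \<Rightarrow> nat) \<Rightarrow> (nat \<Rightarrow> nat) \<Rightarrow> nat \<Rightarrow> nat" where
  "finger_pos X ell f t =
     (if \<exists>s<t. f s = f t then X ! (GREATEST s. s < t \<and> f s = f t) else ell (f t))"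

definition finger_cost :: "nat tree \<Rightarrow> nat list \<Rightarrow> (nat \<Rightarrow> nat) \<Rightarrow> (nat \<Rightarrow> nat) \<Rightarrow> nat" where
  "finger_cost T X ell f = (\<Sum>t<length X. 1 + tdist T (X ! t) (finger_pos X ell f t))"

definition FkT :: "nat \<Rightarrow> nat \<Rightarrow> nat tree \<Rightarrow> nat list \<Rightarrow> nat" where
  "FkT k n T X = Inf {finger_cost T X ell f | ell f.
      (\<forall>j<k. ell j \<in> {1..n}) \<and> (\<forall>t<length X. f t < k)}"

definition Fk :: "nat \<Rightarrow> nat \<Rightarrow> nat list \<Rightarrow> nat" where
  "Fk k n X = Inf {FkT k n T X | T. bst T \<and> set_tree T = {1..n}}"

end

theory Submission
  imports Defs
begin

text \<open>The dynamic tree is kept a treap for priorities that change over time. A set \<open>Q\<close> of keys may be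
  touched if every untouched key has smaller priority than the nearest touched key on either side;
  then \<open>Q\<close> is an upper part of the treap and can be rearranged with \<open>O(|Q|)\<close> operations. Touches
  compose, so consecutive accesses of total finger cost about \<open>k\<close> are served in one batch: the at most \<open>k\<close>
  accessed keys are balanced on top, where each access costs \<open>O(log k)\<close>, and it remains to bound the
  touched sets by \<open>O(k)\<close> per batch plus \<open>O(1)\<close> amortized per finger move along an edge.

  In the static tree, the fingers, the root and the branching nodes of the union of the root-to-finger paths
  are joined by paths, the tendons. The interior of a tendon is a deque: moving fingers push and pop
  nodes at its two ends. It is stored as two stacks meeting in a pivot node which is touched in every batch,
  together with all the nodes bounding the subtrees of marked nodes. When a finger reaches the pivot,
  one of the stacks is empty; the other one is touched completely and split at a new pivot in the middle.
  The imbalance of the two stacks, summed over all tendons, is the potential that pays for this.\<close>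

section \<open>Elementary operations and their behaviour inside subtrees\<close>

section \<open>Pointer machine\<close>

text \<open>Serving each access separately would touch order \<open>k\<close> keys every time,
  because the keys that fix the finger positions must stay on top. Batching spreads this over
  \<open>k\<close> units of finger cost, and the depth of the accessed keys remains as the only
  source of the factor \<open>log k\<close>. The main obstacle is that touchability compares
  neighbours in key order, whereas a tendon is a path in the static tree. Boundary keys reconcile
  the two orders: once the keys bounding the subtree of a node are touched too, neighbours lie both
  inside or both outside that subtree. On one side of the subtree hanging below a tendon, key order
  is monotone in depth, so only keys of one side and one stack are ever compared. Priorities that
  increase away from the pivot keep the ends of the deque above its interior, hence an ordinary push
  or pop touches O(1) keys. The initial potential and the last batch, which may be cheaper than
  \<open>k\<close>, add O(n). This is absorbed by \<open>n \<le> m\<close>.\<close>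

lemma node_at_notin: "p \<notin> set_tree t \<Longrightarrow> node_at t p = Leaf"
  by (induction t) auto

lemma node_at_in_subset: "set_tree (node_at t p) \<subseteq> set_tree t"
  by (induction t) auto

lemma value_in_set_tree: "t \<noteq> Leaf \<Longrightarrow> value t \<in> set_tree t"
  by (cases t) auto

lemma node_at_neq_Leaf: "node_at t p \<noteq> Leaf \<Longrightarrow> p \<in> set_tree t"
  using node_at_notin by metis

lemma parent_key_in: "parent_key t p = Some q \<Longrightarrow> p \<in> set_tree t \<and> q \<in> set_tree t"
  by (induction t) (auto split: if_splits option.splits dest: value_in_set_tree)

lemma parent_key_notin: "p \<notin> set_tree t \<Longrightarrow> parent_key t p = None"
  by (metis parent_key_in option.exhaust)

lemma parent_key_root: "bst (Node l a r) \<Longrightarrow> parent_key (Node l a r) a = None"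
proof -
  assume "bst (Node l a r)"
  then have "a \<notin> set_tree l" "a \<notin> set_tree r" by fastforce+
  moreover from this have "l \<noteq> Leaf \<Longrightarrow> value l \<noteq> a" "r \<noteq> Leaf \<Longrightarrow> value r \<noteq> a"
    using value_in_set_tree by metis+
  ultimately show ?thesis by (auto simp: parent_key_notin)
qed

declare rot_up.simps(2) [simp del]

lemma rot_up_Node:
  "rot_up (Node l a r) p =
     (if l \<noteq> Leaf \<and> value l = p then Node (left l) p (Node (right l) a r)
      else if r \<noteq> Leaf \<and> value r = p then Node (Node l a (left r)) p (right r)
      else Node (rot_up l p) a (rot_up r p))"
  unfolding rot_up.simps(2) by (cases l; cases r) auto

lemma rot_up_notin: "p \<notin> set_tree t \<Longrightarrow> rot_up t p = t"
  by (induction t) (auto simp: rot_up_Node dest: value_in_set_tree)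

lemma inorder_rot_up: "inorder (rot_up t p) = inorder t"
proof (induction t)
  case (Node l a r)
  then show ?case by (cases l; cases r) (simp_all add: rot_up_Node)
qed simp

lemma set_tree_rot_up: "set_tree (rot_up t p) = set_tree t"
  by (metis inorder_rot_up set_inorder)

lemma bst_step_invar:
  assumes "bst_step (t, p) (t', p')"
  shows "p \<in> set_tree t \<and> p' \<in> set_tree t' \<and> inorder t' = inorder t"
proof -
  have L: "left u \<noteq> Leaf \<Longrightarrow> value (left u) \<in> set_tree u"
    and R: "right u \<noteq> Leaf \<Longrightarrow> value (right u) \<in> set_tree u" for u :: "'a tree"
    by (cases u; auto dest: value_in_set_tree)+
  show ?thesis
    using assms node_at_in_subset[of t p] parent_key_in[of t p]
    unfolding bst_step_def Let_def
    by (auto simp: inorder_rot_up set_tree_rot_up dest: node_at_neq_Leaf dest!: L R)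
qed

text \<open>In a context \<open>E\<close>, a step at \<open>p\<close> depends only on the parent of
  \<open>p\<close>, the rotation at \<open>p\<close> and the subtree of \<open>p\<close>. Parent and
  rotation have to agree only where \<open>p\<close> has a parent in \<open>s\<close>: at the root
  of \<open>s\<close> the parent belongs to the context.\<close>

lemma bst_step_embed:
  assumes "bst_step (s, p) (s', p')"
    and "parent_key s p \<noteq> None \<Longrightarrow> parent_key (E s) p = parent_key s p"
    and "parent_key s p \<noteq> None \<Longrightarrow> rot_up (E s) p = E (rot_up s p)"
    and "node_at s p \<noteq> Leaf \<Longrightarrow> node_at (E s) p = node_at s p"
  shows "bst_step (E s, p) (E s', p')"
  using assms(1) unfolding bst_step_def Let_def fst_conv snd_conv
  by (elim disjE conjE) (simp_all add: assms(2-4))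

lemma bst_step_right:
  assumes "bst (Node l a r)" "bst_step (r, p) (r', p')"
  shows "bst_step (Node l a r, p) (Node l a r', p')"
proof -
  have p: "p \<in> set_tree r" using bst_step_invar[OF assms(2)] by simp
  then have pl: "p \<notin> set_tree l" "p \<noteq> a" and r: "r \<noteq> Leaf" using assms(1) by fastforce+
  have nd: "node_at (Node l a r) p = node_at r p" using pl by (simp add: node_at_notin)
  have nv: "parent_key r p \<noteq> None \<Longrightarrow> value r \<noteq> p"
    using assms(1) r by (cases r) (auto simp del: parent_key.simps simp: parent_key_root)
  have lv: "l \<noteq> Leaf \<Longrightarrow> value l \<noteq> p" using pl value_in_set_tree by metis
  have pk: "parent_key (Node l a r) p = parent_key r p" if "parent_key r p \<noteq> None"
    using nv[OF that] lv pl by (auto simp: parent_key_notin split: option.splits)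
  have ru: "rot_up (Node l a r) p = Node l a (rot_up r p)" if "parent_key r p \<noteq> None"
    using nv[OF that] lv r by (auto simp: rot_up_Node rot_up_notin[OF pl(1)])
  show ?thesis by (rule bst_step_embed[where E = "\<lambda>s. Node l a s", OF assms(2)]) (use pk ru nd in blast)+
qed

lemma bst_step_left:
  assumes "bst (Node l a r)" "bst_step (l, p) (l', p')"
  shows "bst_step (Node l a r, p) (Node l' a r, p')"
proof -
  have p: "p \<in> set_tree l" using bst_step_invar[OF assms(2)] by simp
  then have pl: "p \<notin> set_tree r" "p \<noteq> a" and r: "l \<noteq> Leaf" using assms(1) by fastforce+
  have nd: "node_at (Node l a r) p = node_at l p" if "node_at l p \<noteq> Leaf" using pl that by simp
  have nv: "parent_key l p \<noteq> None \<Longrightarrow> value l \<noteq> p"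
    using assms(1) r by (cases l) (auto simp del: parent_key.simps simp: parent_key_root)
  have rv: "r \<noteq> Leaf \<Longrightarrow> value r \<noteq> p" using pl value_in_set_tree by metis
  have pk: "parent_key (Node l a r) p = parent_key l p" if "parent_key l p \<noteq> None"
    using nv[OF that] rv that by (auto split: option.splits)
  have ru: "rot_up (Node l a r) p = Node (rot_up l p) a r" if "parent_key l p \<noteq> None"
    using nv[OF that] rv r by (auto simp: rot_up_Node rot_up_notin[OF pl(1)])
  show ?thesis by (rule bst_step_embed[where E = "\<lambda>s. Node s a r", OF assms(2)]) (use pk ru nd in blast)+
qed

lemma bst_steps_invar:
  assumes "(bst_step ^^ m) (t, p) (t', p')"
  shows "inorder t' = inorder t"
  using assms
proof (induction m arbitrary: t' p')
  case (Suc m)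
  then obtain u q where "(bst_step ^^ m) (t, p) (u, q)" "bst_step (u, q) (t', p')" by auto
  then show ?case using Suc.IH bst_step_invar by metis
qed simp

lemma bst_cong_inorder: "inorder t = inorder t' \<Longrightarrow> bst t = bst t'"
  by (simp add: bst_iff_sorted_wrt_less)

lemma bst_steps_right:
  assumes "bst (Node l a r)" "(bst_step ^^ m) (r, p) (r', p')"
  shows "(bst_step ^^ m) (Node l a r, p) (Node l a r', p')"
  using assms(2)
proof (induction m arbitrary: r' p')
  case (Suc m)
  then obtain u q where u: "(bst_step ^^ m) (r, p) (u, q)" "bst_step (u, q) (r', p')" by auto
  have "inorder u = inorder r" using bst_steps_invar[OF u(1)] .
  then have "bst (Node l a u)" using assms(1) bst_cong_inorder[of "Node l a u" "Node l a r"] by simp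
  then show ?case using relpowp_Suc_I[OF Suc.IH[OF u(1)] bst_step_right[OF _ u(2)]] by blast
qed simp

lemma bst_steps_left:
  assumes "bst (Node l a r)" "(bst_step ^^ m) (l, p) (l', p')"
  shows "(bst_step ^^ m) (Node l a r, p) (Node l' a r, p')"
  using assms(2)
proof (induction m arbitrary: l' p')
  case (Suc m)
  then obtain u q where u: "(bst_step ^^ m) (l, p) (u, q)" "bst_step (u, q) (l', p')" by auto
  have "inorder u = inorder l" using bst_steps_invar[OF u(1)] .
  then have "bst (Node u a r)" using assms(1) bst_cong_inorder[of "Node u a r" "Node l a r"] by simp
  then show ?case using relpowp_Suc_I[OF Suc.IH[OF u(1)] bst_step_left[OF _ u(2)]] by blast
qed simp

lemma bst_step_child:
  assumes "l \<noteq> Leaf"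
  shows "bst_step (Node l a r, a) (Node l a r, value l)"
  unfolding bst_step_def Let_def fst_conv snd_conv
  by (rule disjI2, rule disjI1) (simp add: assms)

lemma bst_step_child':
  assumes "r \<noteq> Leaf"
  shows "bst_step (Node l a r, a) (Node l a r, value r)"
  unfolding bst_step_def Let_def fst_conv snd_conv
  by (rule disjI2, rule disjI2, rule disjI1) (simp add: assms)

lemma bst_step_parent:
  assumes "r \<noteq> Leaf"
  shows "bst_step (Node l a r, value r) (Node l a r, a)"
  unfolding bst_step_def Let_def fst_conv snd_conv
  by (rule disjI1) (simp add: assms)

section \<open>Rearranging an upper part of the tree in linear time\<close>

text \<open>The pointer is at the root before and after, so that reshapings compose and one of them
  can be put in front of an access.\<close>

definition reshape :: "nat \<Rightarrow> 'a tree \<Rightarrow> 'a tree \<Rightarrow> bool" where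
  "reshape c t t' \<longleftrightarrow> t \<noteq> Leaf \<and> t' \<noteq> Leaf \<and>
     (\<exists>m\<le>c. (bst_step ^^ m) (t, value t) (t', value t'))"

lemma reshape_refl: "t \<noteq> Leaf \<Longrightarrow> reshape 0 t t"
  by (simp add: reshape_def)

lemma reshape_trans:
  assumes "reshape c t u" "reshape d u v"
  shows "reshape (c + d) t v"
proof -
  obtain i j where i: "i \<le> c" "(bst_step ^^ i) (t, value t) (u, value u)"
    and j: "j \<le> d" "(bst_step ^^ j) (u, value u) (v, value v)"
    using assms unfolding reshape_def by auto
  have "(bst_step ^^ (i + j)) (t, value t) (v, value v)"
    using i(2) j(2) by (auto simp: relpowp_add)
  then show ?thesis using i(1) j(1) assms unfolding reshape_def by (meson add_mono)
qed

lemma reshape_mono: "reshape c t u \<Longrightarrow> c \<le> d \<Longrightarrow> reshape d t u"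
  unfolding reshape_def by (meson le_trans)

lemma reshape_inorder: "reshape c t u \<Longrightarrow> inorder u = inorder t"
  unfolding reshape_def by (elim conjE exE) (rule bst_steps_invar)

text \<open>The two extra operations are the descent to the right child and the return to the root.
  Turning a tree into a right vine recurses only into right subtrees.\<close>

lemma reshape_right:
  assumes "bst (Node l a r)" "reshape c r r'"
  shows "reshape (c + 2) (Node l a r) (Node l a r')"
proof -
  obtain i where i: "i \<le> c" "(bst_step ^^ i) (r, value r) (r', value r')" "r \<noteq> Leaf" "r' \<noteq> Leaf"
    using assms unfolding reshape_def by auto
  have "(bst_step ^^ i) (Node l a r, value r) (Node l a r', value r')"
    using bst_steps_right[OF assms(1) i(2)] .
  moreover have "(bst_step ^^ 1) (Node l a r, a) (Node l a r, value r)"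
    using bst_step_child'[OF i(3)] unfolding relpowp_1 .
  moreover have "(bst_step ^^ 1) (Node l a r', value r') (Node l a r', a)"
    using bst_step_parent[OF i(4)] unfolding relpowp_1 .
  ultimately have "(bst_step ^^ (1 + i + 1)) (Node l a r, a) (Node l a r', a)"
    unfolding relpowp_add by blast
  then have "\<exists>m\<le>c + 2. (bst_step ^^ m) (Node l a r, a) (Node l a r', a)"
    using i(1) by (intro exI[of _ "1 + i + 1"] conjI) (arith, assumption)
  then show ?thesis unfolding reshape_def by simp
qed

lemma reshape_rotate_right:
  "reshape 2 (Node (Node A b B) a C) (Node A b (Node B a C))"
proof -
  let ?t = "Node (Node A b B) a C"
  have "bst_step (?t, a) (?t, b)" using bst_step_child[of "Node A b B" a C] by simp
  moreover have "bst_step (?t, b) (Node A b (Node B a C), b)"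
    unfolding bst_step_def Let_def fst_conv snd_conv by (intro disjI2) (simp add: rot_up_Node)
  ultimately have "(bst_step ^^ 2) (?t, a) (Node A b (Node B a C), b)"
    by (auto simp: numeral_2_eq_2)
  then show ?thesis unfolding reshape_def by auto
qed

text \<open>Search order ensures that \<open>A\<close> does not have \<open>a\<close> at its root;
  otherwise \<open>rot_up\<close>, which tests the left child before the right one, would rotate the
  wrong node.\<close>

lemma reshape_rotate_left:
  assumes "bst (Node A b (Node B a C))"
  shows "reshape 2 (Node A b (Node B a C)) (Node (Node A b B) a C)"
proof -
  let ?t = "Node A b (Node B a C)"
  have "bst_step (?t, b) (?t, a)" using bst_step_child'[of "Node B a C" A b] by simp
  moreover have "value A \<noteq> a" if "A \<noteq> Leaf" using assms value_in_set_tree[OF that] by fastforce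
  then have "bst_step (?t, a) (Node (Node A b B) a C, a)"
    unfolding bst_step_def Let_def fst_conv snd_conv by (intro disjI2) (auto simp: rot_up_Node)
  ultimately have "(bst_step ^^ 2) (?t, b) (Node (Node A b B) a C, a)"
    by (auto simp: numeral_2_eq_2)
  then show ?thesis unfolding reshape_def by auto
qed

text \<open>A leaf of the upper tree is identified by the key preceding it in the inorder, and \<open>g\<close> gives
  the subtree hanging there; this indexing is invariant under rotations of the upper tree.\<close>

fun graft :: "'a \<Rightarrow> 'a tree \<Rightarrow> ('a \<Rightarrow> 'a tree) \<Rightarrow> 'a tree" where
  "graft b Leaf g = g b"
| "graft b (Node l a r) g = Node (graft b l g) a (graft a r g)"

fun spine_len :: "'a tree \<Rightarrow> nat" where
  "spine_len Leaf = 0"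
| "spine_len (Node l a r) = Suc (spine_len r)"

lemma spine_len_le: "spine_len t \<le> size t"
  by (induction t) auto

function vine :: "'a tree \<Rightarrow> 'a tree" where
  "vine Leaf = Leaf"
| "vine (Node Leaf a r) = Node Leaf a (vine r)"
| "vine (Node (Node A b B) a C) = vine (Node A b (Node B a C))"
  by pat_completeness auto
termination
  by (relation "measures [size, \<lambda>t. size (left t)]") auto

lemma vine_unique: "inorder t = inorder t' \<Longrightarrow> vine t = vine t'"
proof -
  have "vine t = foldr (\<lambda>a r. Node Leaf a r) (inorder t) Leaf" for t :: "'a tree"
    by (induction t rule: vine.induct) auto
  then show "inorder t = inorder t' \<Longrightarrow> vine t = vine t'" by simp
qed

lemma inorder_graft_rotate:
  "inorder (graft x (Node (Node A b B) a C) g) = inorder (graft x (Node A b (Node B a C)) g)"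
  by simp

text \<open>Each rotation costs 2 operations and lengthens the right spine by one node, which gives
  the first term. Each descent along the spine and return costs 2, which gives the second. Rotations
  can be undone at the same price, hence the bound in both directions.\<close>

lemma reshape_vine:
  assumes "bst (graft x u g)" "u \<noteq> Leaf"
  shows "reshape (2 * (size u - spine_len u) + 2 * size u) (graft x u g) (graft x (vine u) g) \<and>
         reshape (2 * (size u - spine_len u) + 2 * size u) (graft x (vine u) g) (graft x u g)"
  using assms
proof (induction u arbitrary: x rule: vine.induct)
  case (2 a r)
  show ?case
  proof (cases "r = Leaf")
    case True
    then show ?thesis using reshape_refl[of "graft x (Node Leaf a r) g"]
      by (auto intro: reshape_mono)
  next
    case False
    let ?c = "2 * (size r - spine_len r) + 2 * size r"
    have b: "bst (graft a r g)" using 2(2) by simp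
    have IH: "reshape ?c (graft a r g) (graft a (vine r) g)"
      "reshape ?c (graft a (vine r) g) (graft a r g)" using 2(1)[OF b False] by auto
    have b': "bst (Node (g x) a (graft a (vine r) g))"
      using 2(2) reshape_inorder[OF IH(1)] bst_cong_inorder[of "Node (g x) a (graft a (vine r) g)"
        "Node (g x) a (graft a r g)"] by simp
    have "reshape (?c + 2) (graft x (Node Leaf a r) g) (graft x (vine (Node Leaf a r)) g)"
      using reshape_right[OF _ IH(1)] 2(2) by simp
    moreover have "reshape (?c + 2) (graft x (vine (Node Leaf a r)) g) (graft x (Node Leaf a r) g)"
      using reshape_right[OF _ IH(2)] b' by simp
    ultimately show ?thesis by (simp add: add.commute)
  qed
next
  case (3 A b B a C)
  let ?t = "Node (Node A b B) a C" and ?u = "Node A b (Node B a C)"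
  let ?c = "2 * (size ?u - spine_len ?u) + 2 * size ?u"
  have bu: "bst (graft x ?u g)"
    using 3(2) bst_cong_inorder[OF inorder_graft_rotate] by blast
  have IH: "reshape ?c (graft x ?u g) (graft x (vine ?u) g)"
    "reshape ?c (graft x (vine ?u) g) (graft x ?u g)" using 3(1)[OF bu] by auto
  have r: "reshape 2 (graft x ?t g) (graft x ?u g)" using reshape_rotate_right by simp
  have l: "reshape 2 (graft x ?u g) (graft x ?t g)" using reshape_rotate_left bu by simp
  have c: "?c + 2 = 2 * (size ?t - spine_len ?t) + 2 * size ?t"
    using spine_len_le[of C] by simp
  show ?case
    using reshape_trans[OF r IH(1)] reshape_trans[OF IH(2) l]
    unfolding c[symmetric] vine.simps(3) add.commute[of 2 ?c] by blast
qed simp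

text \<open>The right vine is a normal form shared by both shapes: at most \<open>4 * size u\<close>
  operations lead to it and as many lead away. The hanging subtrees are carried along and do not
  enter the count.\<close>

lemma reshape_graft:
  assumes "bst (graft x u g)" "u \<noteq> Leaf" "inorder u = inorder u'"
  shows "reshape (8 * size u) (graft x u g) (graft x u' g)"
proof -
  have u': "u' \<noteq> Leaf" using assms(2,3) by (metis inorder.simps(1) tree.exhaust append_is_Nil_conv inorder.simps(2) list.distinct(1))
  have sz: "size u' = size u" using assms(3) by (metis length_inorder)
  have v: "vine u = vine u'" using vine_unique[OF assms(3)] .
  have 1: "reshape (4 * size u) (graft x u g) (graft x (vine u) g)"
    using reshape_vine[OF assms(1,2)] by (auto intro: reshape_mono)
  have io: "inorder (graft y t g) = inorder (graft y (vine t) g)" for y :: 'a and t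
    by (induction t arbitrary: y rule: vine.induct) auto
  have b': "bst (graft x u' g)"
    using assms(1) io[of x u] io[of x u'] v bst_cong_inorder by metis
  have 2: "reshape (4 * size u) (graft x (vine u') g) (graft x u' g)"
    using reshape_vine[OF b' u'] sz by (auto intro: reshape_mono)
  show ?thesis using reshape_trans[OF 1[unfolded v] 2] by simp
qed

section \<open>From reshapings to accesses and access sequences\<close>

lemma steps_to_key:
  assumes "bst t" "x \<in> set_tree t"
  shows "(bst_step ^^ tdepth t x) (t, value t) (t, x)"
  using assms
proof (induction t)
  case (Node l a r)
  consider "x = a" | "x \<in> set_tree l" "x \<noteq> a" | "x \<in> set_tree r" "x \<notin> set_tree l" "x \<noteq> a"
    using Node.prems by auto
  then show ?case
  proof cases
    case 2
    then have "(bst_step ^^ tdepth l x) (Node l a r, value l) (Node l a r, x)"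
      using Node bst_steps_left[OF Node.prems(1)] by auto
    moreover have "(bst_step ^^ 1) (Node l a r, a) (Node l a r, value l)"
      using bst_step_child[of l] 2 unfolding relpowp_1 by (cases l) auto
    ultimately have "(bst_step ^^ (1 + tdepth l x)) (Node l a r, a) (Node l a r, x)"
      unfolding relpowp_add by blast
    then show ?thesis using 2 by simp
  next
    case 3
    then have "(bst_step ^^ tdepth r x) (Node l a r, value r) (Node l a r, x)"
      using Node bst_steps_right[OF Node.prems(1)] by auto
    moreover have "(bst_step ^^ 1) (Node l a r, a) (Node l a r, value r)"
      using bst_step_child'[of r] 3 unfolding relpowp_1 by (cases r) auto
    ultimately have "(bst_step ^^ (1 + tdepth r x)) (Node l a r, a) (Node l a r, x)"
      unfolding relpowp_add by blast
    then show ?thesis using 3 by simp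
  qed simp
qed simp

text \<open>A rearrangement can be made part of an access, since it leaves the pointer at the root
  and the walk to \<open>x\<close> then costs its depth. The final \<open>1\<close> is the unit
  charged for each access.\<close>

lemma serve_if_reshape:
  assumes "reshape c t u" "bst u" "x \<in> set_tree u"
  shows "\<exists>d. d \<le> c + tdepth u x + 1 \<and> serve t x d u"
proof -
  obtain i where i: "i \<le> c" "(bst_step ^^ i) (t, value t) (u, value u)" "t \<noteq> Leaf"
    using assms unfolding reshape_def by auto
  define m where "m = i + tdepth u x"
  have "(bst_step ^^ m) (t, value t) (u, x)"
    unfolding m_def relpowp_add using i(2) steps_to_key[OF assms(2,3)] by blast
  then obtain f where f: "f 0 = (t, value t)" "f m = (u, x)"
    "\<And>j. j < m \<Longrightarrow> bst_step (f j) (f (Suc j))"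
    unfolding relpowp_fun_conv by auto
  let ?ss = "map f [0..<Suc m]"
  have n: "?ss \<noteq> []" by simp
  have l: "last ?ss = (u, x)" using f(2) by (simp add: last_map)
  have h: "hd ?ss = (t, value t)" using f(1) by (simp add: hd_map del: upt_Suc)
  have s: "\<forall>j. Suc j < length ?ss \<longrightarrow> bst_step (?ss ! j) (?ss ! Suc j)"
    using f(3) by (auto simp del: upt_Suc)
  have v: "\<exists>s\<in>set ?ss. snd s = x" using l n last_in_set by (metis snd_conv)
  have "serve t x (Suc m) u"
    unfolding serve_def using i(3) n l h s v
    by (intro conjI exI[of _ ?ss]) (auto simp del: upt_Suc)
  then show ?thesis using i(1) m_def by (intro exI[of _ "Suc m"]) auto
qed

inductive serves :: "nat tree \<Rightarrow> nat list \<Rightarrow> nat \<Rightarrow> nat tree \<Rightarrow> bool" where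
  serves_Nil: "serves t [] 0 t"
| serves_Cons: "serve t x d u \<Longrightarrow> serves u xs c v \<Longrightarrow> serves t (x # xs) (d + c) v"

lemma serves_append:
  "serves t xs c u \<Longrightarrow> serves u ys d v \<Longrightarrow> serves t (xs @ ys) (c + d) v"
proof (induction rule: serves.induct)
  case (serves_Cons t x d' u' xs c v')
  then show ?case using serves.serves_Cons[of t x d' u' "xs @ ys" "c + d" v] by (simp add: add.assoc)
qed simp

lemma serves_trace:
  assumes "serves t xs c v"
  shows "\<exists>ts d. ts 0 = t \<and> (\<forall>i<length xs. serve (ts i) (xs ! i) (d i) (ts (Suc i))) \<and>
           c = (\<Sum>i<length xs. d i)"
  using assms
proof (induction rule: serves.induct)
  case (serves_Nil t)
  show ?case by (intro exI[of _ "\<lambda>_. t"] exI[of _ "\<lambda>_. 0"]) simp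
next
  case (serves_Cons t x d u xs c v)
  then obtain ts e where e: "ts 0 = u" "\<forall>i<length xs. serve (ts i) (xs ! i) (e i) (ts (Suc i))"
    "c = (\<Sum>i<length xs. e i)" by auto
  let ?ts = "\<lambda>i. case i of 0 \<Rightarrow> t | Suc j \<Rightarrow> ts j"
  let ?e = "\<lambda>i. case i of 0 \<Rightarrow> d | Suc j \<Rightarrow> e j"
  have "\<forall>i<length (x # xs). serve (?ts i) ((x # xs) ! i) (?e i) (?ts (Suc i))"
    using e serves_Cons(1) by (auto simp: less_Suc_eq_0_disj)
  moreover have "d + c = (\<Sum>i<length (x # xs). ?e i)"
    using e(3) by (simp add: sum.lessThan_Suc_shift del: sum.lessThan_Suc)
  ultimately show ?case by (intro exI[of _ ?ts] exI[of _ ?e]) simp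
qed

lemma OPT_le:
  assumes "serves t X c v" "bst t" "set_tree t = {1..n}"
  shows "OPT n X \<le> c"
proof -
  obtain ts d where "ts 0 = t" "\<forall>i<length X. serve (ts i) (X ! i) (d i) (ts (Suc i))"
    "c = (\<Sum>i<length X. d i)" using serves_trace[OF assms(1)] by auto
  then show ?thesis unfolding OPT_def using assms(2,3)
    by (intro wellorder_Inf_le1) blast
qed

section \<open>Treaps with changing priorities and their upper parts\<close>

section \<open>Offline treaps\<close>

fun heap :: "('a \<Rightarrow> nat) \<Rightarrow> 'a tree \<Rightarrow> bool" where
  "heap pr Leaf \<longleftrightarrow> True"
| "heap pr (Node l a r) \<longleftrightarrow>
     (\<forall>x\<in>set_tree l \<union> set_tree r. pr x \<le> pr a) \<and> heap pr l \<and> heap pr r"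

lemma heap_cong: "(\<And>x. x \<in> set_tree t \<Longrightarrow> pr x = pr' x) \<Longrightarrow> heap pr t = heap pr' t"
  by (induction t) auto

text \<open>A key outside \<open>Q\<close> is compared only with its nearest keys of
  \<open>Q\<close> on either side. The condition is thus local in key order, yet in a heap-ordered
  search tree it forces \<open>Q\<close> to be an upper part.\<close>

definition top_closed :: "nat set \<Rightarrow> (nat \<Rightarrow> nat) \<Rightarrow> nat set \<Rightarrow> bool" where
  "top_closed N pr Q \<longleftrightarrow>
     (\<forall>y\<in>Q. \<forall>x\<in>N - Q. (\<forall>z\<in>Q. \<not> (x < z \<and> z < y) \<and> \<not> (y < z \<and> z < x)) \<longrightarrow> pr x < pr y)"

text \<open>Afterwards \<open>Q\<close> is above all other keys, so the subtrees hanging below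
  \<open>Q\<close> remain correctly placed whatever the order within \<open>Q\<close>
  becomes.\<close>

definition touch :: "nat set \<Rightarrow> nat set \<Rightarrow> (nat \<Rightarrow> nat) \<Rightarrow> (nat \<Rightarrow> nat) \<Rightarrow> bool" where
  "touch N Q pr pr' \<longleftrightarrow> Q \<subseteq> N \<and> top_closed N pr Q \<and> (\<forall>x. x \<notin> Q \<longrightarrow> pr' x = pr x) \<and>
     (\<forall>y\<in>Q. \<forall>x\<in>N - Q. pr' x < pr' y)"

text \<open>A key of \<open>Q' - Q\<close> and a key outside both sets keep their priorities during
  the first touch. A comparison guaranteed at the start of the second touch therefore held before
  the first one already. In this way a whole batch becomes a single touch.\<close>

lemma touch_trans:
  assumes 1: "touch N Q pr pr'" and 2: "touch N Q' pr' pr''"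
  shows "touch N (Q \<union> Q') pr pr''"
proof -
  have "pr x < pr y" if y: "y \<in> Q \<union> Q'" and x: "x \<in> N - (Q \<union> Q')"
    and z: "\<forall>z\<in>Q \<union> Q'. \<not> (x < z \<and> z < y) \<and> \<not> (y < z \<and> z < x)" for x y
  proof (cases "y \<in> Q")
    case True
    then show ?thesis using 1 x z unfolding touch_def top_closed_def by blast
  next
    case False
    then have "pr' x < pr' y" using y x z 2 unfolding touch_def top_closed_def by blast
    moreover have "pr' x = pr x" "pr' y = pr y" using 1 False x unfolding touch_def by blast+
    ultimately show ?thesis by simp
  qed
  then have "top_closed N pr (Q \<union> Q')" unfolding top_closed_def by blast
  moreover have "pr'' x < pr'' y" if "y \<in> Q \<union> Q'" "x \<in> N - (Q \<union> Q')" for x y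
    using 1 2 that unfolding touch_def by (cases "y \<in> Q'") (force, fastforce)
  moreover have "pr'' x = pr x" if "x \<notin> Q \<union> Q'" for x
    using 1 2 that unfolding touch_def by simp
  ultimately show ?thesis using 1 2 unfolding touch_def by blast
qed

lemma graft_cong:
  "(\<And>x. x \<in> insert b (set_tree u) \<Longrightarrow> g x = g' x) \<Longrightarrow> graft b u g = graft b u g'"
  by (induction u arbitrary: b) auto

lemma set_tree_graft:
  "set_tree (graft b u g) = set_tree u \<union> (\<Union>x\<in>insert b (set_tree u). set_tree (g x))"
  by (induction u arbitrary: b) auto

lemma bst_graft: "bst (graft b u g) \<Longrightarrow> bst u"
  by (induction u arbitrary: b) (auto simp: set_tree_graft)

lemma bst_graft_disjoint:
  "bst (graft b u g) \<Longrightarrow> x \<in> insert b (set_tree u) \<Longrightarrow> set_tree (g x) \<inter> set_tree u = {}"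
proof (induction u arbitrary: b)
  case (Node l a r)
  have l: "\<forall>y\<in>set_tree (graft b l g). y < a" and r: "\<forall>y\<in>set_tree (graft a r g). a < y"
    and bl: "bst (graft b l g)" and br: "bst (graft a r g)"
    using Node.prems(1) by auto
  have lr: "set_tree l \<subseteq> set_tree (graft b l g)" "set_tree r \<subseteq> set_tree (graft a r g)"
    by (auto simp: set_tree_graft)
  consider "x \<in> insert b (set_tree l)" | "x \<in> insert a (set_tree r)" using Node.prems(2) by auto
  then show ?case
  proof cases
    case 1
    then have "set_tree (g x) \<subseteq> set_tree (graft b l g)" by (auto simp: set_tree_graft)
    then have "\<forall>y\<in>set_tree (g x). y < a" using l by blast
    moreover have "\<forall>y\<in>insert a (set_tree r). a \<le> y" using r lr by fastforce
    ultimately show ?thesis using Node.IH(1)[OF bl 1] by force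
  next
    case 2
    then have "set_tree (g x) \<subseteq> set_tree (graft a r g)" by (auto simp: set_tree_graft)
    then have "\<forall>y\<in>set_tree (g x). a < y" using r by blast
    moreover have "\<forall>y\<in>insert a (set_tree l). y \<le> a" using l lr by fastforce
    ultimately show ?thesis using Node.IH(2)[OF br 2] by force
  qed
qed simp

lemma tdepth_graft: "bst (graft b u g) \<Longrightarrow> x \<in> set_tree u \<Longrightarrow> tdepth (graft b u g) x = tdepth u x"
proof (induction u arbitrary: b)
  case (Node l a r)
  have l: "\<forall>y\<in>set_tree (graft b l g). y < a" and r: "\<forall>y\<in>set_tree (graft a r g). a < y"
    using Node.prems(1) by auto
  have lr: "set_tree l \<subseteq> set_tree (graft b l g)" "set_tree r \<subseteq> set_tree (graft a r g)"
    by (auto simp: set_tree_graft)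
  show ?case
  proof (cases "x \<in> set_tree l")
    case True
    then show ?thesis using Node lr by auto
  next
    case False
    moreover have "x \<notin> set_tree (graft b l g)" if "x \<noteq> a"
      using that False Node.prems(2) l r lr by fastforce
    ultimately show ?thesis using Node by auto
  qed
qed simp

lemma heap_graft_hanging:
  "heap pr (graft b u g) \<Longrightarrow> x \<in> insert b (set_tree u) \<Longrightarrow> heap pr (g x)"
  by (induction u arbitrary: b) auto

lemma heap_graft:
  assumes "heap pr u" "\<And>x. x \<in> insert b (set_tree u) \<Longrightarrow> heap pr (g x)"
    and "\<And>x y z. x \<in> insert b (set_tree u) \<Longrightarrow> y \<in> set_tree (g x) \<Longrightarrow> z \<in> set_tree u \<Longrightarrow> pr y \<le> pr z"
  shows "heap pr (graft b u g)"
  using assms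
proof (induction u arbitrary: b)
  case (Node l a r)
  have "heap pr (graft b l g)" "heap pr (graft a r g)"
    using Node.prems by (intro Node.IH; auto)+
  moreover have "pr x \<le> pr a" if "x \<in> set_tree (graft b l g) \<union> set_tree (graft a r g)" for x
    using that Node.prems(1) Node.prems(3)[of _ x a] by (auto simp: set_tree_graft)
  ultimately show ?case by auto
qed simp

text \<open>If \<open>Q\<close> meets the tree but misses its root, the key of \<open>Q\<close>
  nearest to the root must have larger priority than the root, against the heap order. A root in
  \<open>Q\<close> separates the two sides, so both subtrees inherit the condition.\<close>

lemma top_closed_graft:
  assumes "bst t" "heap pr t" "top_closed (set_tree t) pr (Q \<inter> set_tree t)" "\<forall>x\<in>set_tree t. b < x"
  shows "\<exists>u g. t = graft b u g \<and> set_tree u = Q \<inter> set_tree t"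
  using assms
proof (induction t arbitrary: b)
  case Leaf
  show ?case by (intro exI[of _ Leaf] exI[of _ "\<lambda>_. Leaf"]) simp
next
  case (Node l a r)
  let ?t = "Node l a r"
  note cl = Node.prems(3)[unfolded top_closed_def]
  show ?case
  proof (cases "Q \<inter> set_tree ?t = {}")
    case True
    then show ?thesis by (intro exI[of _ Leaf] exI[of _ "\<lambda>_. ?t"]) simp
  next
    case False
    have a: "a \<in> Q"
    proof (rule ccontr)
      assume na: "a \<notin> Q"
      \<comment> \<open>Distance to the root: a key of \<open>Q\<close> that minimises it has no
        other key of \<open>Q\<close> strictly between itself and \<open>a\<close>.\<close>
      define d where "d y = (if y < a then a - y else y - a)" for y
      obtain y where y: "y \<in> Q \<inter> set_tree ?t" "\<And>z. z \<in> Q \<inter> set_tree ?t \<Longrightarrow> d y \<le> d z"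
        using False ex_has_least_nat[of "\<lambda>y. y \<in> Q \<inter> set_tree ?t" _ d] by blast
      have "pr a < pr y"
      proof (rule cl[rule_format])
        show "y \<in> Q \<inter> set_tree ?t" "a \<in> set_tree ?t - Q \<inter> set_tree ?t" using y na by auto
        show "\<not> (a < z \<and> z < y) \<and> \<not> (y < z \<and> z < a)" if "z \<in> Q \<inter> set_tree ?t" for z
          using y(2)[OF that] by (auto simp: d_def split: if_splits)
      qed
      moreover have "pr y \<le> pr a" using y(1) na Node.prems(2) by auto
      ultimately show False by simp
    qed
    have l: "top_closed (set_tree l) pr (Q \<inter> set_tree l)"
      unfolding top_closed_def
    proof (intro ballI impI)
      fix x y assume y: "y \<in> Q \<inter> set_tree l" and x: "x \<in> set_tree l - Q \<inter> set_tree l"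
        and z: "\<forall>z\<in>Q \<inter> set_tree l. \<not> (x < z \<and> z < y) \<and> \<not> (y < z \<and> z < x)"
      show "pr x < pr y"
      proof (rule cl[rule_format])
        show "y \<in> Q \<inter> set_tree ?t" "x \<in> set_tree ?t - Q \<inter> set_tree ?t" using x y by auto
        have lt: "x < a" "y < a" using x y Node.prems(1) by auto
        show "\<not> (x < w \<and> w < y) \<and> \<not> (y < w \<and> w < x)" if "w \<in> Q \<inter> set_tree ?t" for w
        proof (cases "w \<in> set_tree l")
          case False
          then have "a \<le> w" using that Node.prems(1) by auto
          then show ?thesis using lt by auto
        qed (use z that in blast)
      qed
    qed
    have r: "top_closed (set_tree r) pr (Q \<inter> set_tree r)"
      unfolding top_closed_def
    proof (intro ballI impI)
      fix x y assume y: "y \<in> Q \<inter> set_tree r" and x: "x \<in> set_tree r - Q \<inter> set_tree r"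
        and z: "\<forall>z\<in>Q \<inter> set_tree r. \<not> (x < z \<and> z < y) \<and> \<not> (y < z \<and> z < x)"
      show "pr x < pr y"
      proof (rule cl[rule_format])
        show "y \<in> Q \<inter> set_tree ?t" "x \<in> set_tree ?t - Q \<inter> set_tree ?t" using x y by auto
        have lt: "a < x" "a < y" using x y Node.prems(1) by auto
        show "\<not> (x < w \<and> w < y) \<and> \<not> (y < w \<and> w < x)" if "w \<in> Q \<inter> set_tree ?t" for w
        proof (cases "w \<in> set_tree r")
          case False
          then have "w \<le> a" using that Node.prems(1) by auto
          then show ?thesis using lt by auto
        qed (use z that in blast)
      qed
    qed
    obtain ul gl where ul: "l = graft b ul gl" "set_tree ul = Q \<inter> set_tree l"
      using Node.IH(1)[of b] Node.prems l by auto
    obtain ur gr where ur: "r = graft a ur gr" "set_tree ur = Q \<inter> set_tree r"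
      using Node.IH(2)[of a] Node.prems r by auto
    \<comment> \<open>A leaf is labelled by the key before it. Labels on the left are below
      \<open>a\<close> and labels on the right start with \<open>a\<close> itself, so the two
      families do not clash.\<close>
    define g where "g x = (if x < a then gl x else gr x)" for x
    have "b < a" using Node.prems(4) by simp
    have "graft b ul g = graft b ul gl"
      using \<open>b < a\<close> ul(2) Node.prems(1) by (intro graft_cong) (auto simp: g_def)
    moreover have "graft a ur g = graft a ur gr"
      using ur(2) Node.prems(1) by (intro graft_cong) (auto simp: g_def)
    ultimately have "?t = graft b (Node ul a ur) g" using ul ur by simp
    moreover have "set_tree (Node ul a ur) = Q \<inter> set_tree ?t" using ul ur a by auto
    ultimately show ?thesis by blast
  qed
qed

lemma ex_treap: "finite Q \<Longrightarrow> \<exists>u. bst u \<and> set_tree u = Q \<and> heap pr u" for Q :: "'a::linorder set"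
proof (induction Q rule: finite_psubset_induct)
  case (psubset Q)
  show ?case
  proof (cases "Q = {}")
    case True
    then show ?thesis by (intro exI[of _ Leaf]) simp
  next
    case False
    then have "Max (pr ` Q) \<in> pr ` Q" using psubset(1) by (intro Max_in) auto
    then obtain a where "a \<in> Q" "pr a = Max (pr ` Q)" by auto
    then have a: "a \<in> Q" "\<And>x. x \<in> Q \<Longrightarrow> pr x \<le> pr a" using psubset(1) by auto
    obtain l where "bst l" "set_tree l = {x\<in>Q. x < a}" "heap pr l"
      using psubset(2)[of "{x\<in>Q. x < a}"] a by blast
    moreover obtain r where "bst r" "set_tree r = {x\<in>Q. a < x}" "heap pr r"
      using psubset(2)[of "{x\<in>Q. a < x}"] a by blast
    moreover note False
    ultimately show ?thesis using a by (intro exI[of _ "Node l a r"]) auto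
  qed
qed

text \<open>The root is a median of \<open>V\<close> alone; the other keys of \<open>Q\<close> just
  follow and may be deep. This matters because a touched set can be much larger than the set of
  accessed keys.\<close>

lemma ex_bst_shallow:
  fixes Q :: "'a::linorder set"
  assumes "finite Q" "V \<subseteq> Q" "card V < 2 ^ h"
  shows "\<exists>u. bst u \<and> set_tree u = Q \<and> (\<forall>x\<in>V. tdepth u x < h)"
  using assms
proof (induction h arbitrary: Q V)
  case 0
  then have "V = {}" using finite_subset by fastforce
  then show ?case using ex_treap[OF 0(1), of "\<lambda>_. 0"] by blast
next
  case (Suc h)
  have fV: "finite V" using Suc.prems(1,2) by (rule rev_finite_subset)
  show ?case
  proof (cases "V = {}")
    case True
    then show ?thesis using ex_treap[OF Suc.prems(1), of "\<lambda>_. 0"] by blast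
  next
    case False
    define vs where "vs = sorted_list_of_set V"
    define i where "i = card V div 2"
    have len: "length vs = card V" and dv: "distinct vs" and sv: "set vs = V" and ss: "sorted vs"
      using fV by (auto simp: vs_def)
    have il: "i < length vs" using False fV len unfolding i_def by (simp add: card_gt_0_iff)
    define v where "v = vs ! i"
    have A: "{x\<in>V. x < v} \<subseteq> (!) vs ` {..<i}"
    proof
      fix x assume "x \<in> {x\<in>V. x < v}"
      then obtain j where "j < length vs" "vs ! j = x" "x < v" using sv by (auto simp: in_set_conv_nth)
      then have "j < i" using ss v_def il by (meson leD leI sorted_nth_mono)
      then show "x \<in> (!) vs ` {..<i}" using \<open>vs ! j = x\<close> by blast
    qed
    have B: "{x\<in>V. v < x} \<subseteq> (!) vs ` {i<..<length vs}"
    proof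
      fix x assume "x \<in> {x\<in>V. v < x}"
      then obtain j where "j < length vs" "vs ! j = x" "v < x" using sv by (auto simp: in_set_conv_nth)
      then have "i < j" using ss v_def il by (meson leD leI sorted_nth_mono)
      then show "x \<in> (!) vs ` {i<..<length vs}" using \<open>vs ! j = x\<close> \<open>j < length vs\<close> by auto
    qed
    have "card {x\<in>V. x < v} \<le> i" using surj_card_le[OF _ A] by simp
    then have cA: "card {x\<in>V. x < v} < 2 ^ h" using Suc.prems(3) unfolding i_def by simp
    have "card {x\<in>V. v < x} \<le> length vs - Suc i" using surj_card_le[OF _ B] by simp
    then have cB: "card {x\<in>V. v < x} < 2 ^ h" using Suc.prems(3) len il unfolding i_def by simp
    have v: "v \<in> V" using il sv v_def by auto
    obtain l where l: "bst l" "set_tree l = {x\<in>Q. x < v}" "\<forall>x\<in>{x\<in>V. x < v}. tdepth l x < h"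
      using Suc.IH[OF _ _ cA, of "{x\<in>Q. x < v}"] Suc.prems by auto
    obtain r where r: "bst r" "set_tree r = {x\<in>Q. v < x}" "\<forall>x\<in>{x\<in>V. v < x}. tdepth r x < h"
      using Suc.IH[OF _ _ cB, of "{x\<in>Q. v < x}"] Suc.prems by auto
    have "tdepth (Node l v r) x < Suc h" if "x \<in> V" for x
      using that l r Suc.prems(2) by (cases x v rule: linorder_cases) auto
    moreover have "bst (Node l v r)" "set_tree (Node l v r) = Q"
      using l r v Suc.prems(2) by auto
    ultimately show ?thesis by blast
  qed
qed

lemma inorder_eq_if_bst:
  assumes "bst u" "bst u'" "set_tree u = set_tree u'"
  shows "inorder u = inorder u'"
  using assms by (simp add: bst_iff_sorted_wrt_less strict_sorted_equal)

lemma size_bst: "bst u \<Longrightarrow> size u = card (set_tree u)"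
  by (metis bst_iff_sorted_wrt_less distinct_card length_inorder set_inorder strict_sorted_iff)

text \<open>The pending reshaping is performed by the first access; afterwards the tree stays fixed
  and each access costs at most \<open>h\<close>.\<close>

lemma serves_static:
  assumes "bst t" "\<forall>x\<in>set xs. x \<in> set_tree t \<and> tdepth t x < h" "reshape c t0 t" "xs \<noteq> []"
  shows "\<exists>d. d \<le> c + length xs * h \<and> serves t0 xs d t"
  using assms(2,3,4)
proof (induction xs arbitrary: c t0)
  case (Cons x xs)
  have t: "t \<noteq> Leaf" using Cons.prems(1) by auto
  have x: "x \<in> set_tree t" "tdepth t x < h" using Cons.prems(1) by auto
  obtain d where "d \<le> c + tdepth t x + 1" "serve t0 x d t"
    using serve_if_reshape[OF Cons.prems(2) assms(1) x(1)] by blast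
  then have d: "d \<le> c + h" "serve t0 x d t" using x(2) by auto
  show ?case
  proof (cases "xs = []")
    case True
    then show ?thesis using d serves_Cons[OF d(2) serves_Nil] by (intro exI[of _ "d + 0"]) auto
  next
    case False
    then obtain e where "e \<le> length xs * h" "serves t xs e t"
      using Cons.IH[OF _ reshape_refl[OF t] False] Cons.prems(1) by auto
    then show ?thesis using d serves_Cons[OF d(2)] by (intro exI[of _ "d + e"]) auto
  qed
qed simp

text \<open>The upper part goes through three shapes: the old treap, a shape with shallow accessed
  keys, and the new treap. The last reshaping stays pending, since an access ends with the pointer
  away from the root; the next access performs it before its own search.\<close>

lemma serves_batch:
  assumes t: "bst t" "set_tree t = N" "heap pr t" and N: "0 \<notin> N"
    and touch: "touch N Q pr pr'" and xs: "set xs \<subseteq> Q" "xs \<noteq> []" "card (set xs) < 2 ^ h"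
    and t0: "reshape c t0 t"
  shows "\<exists>d tm t'. d \<le> c + 8 * card Q + length xs * h \<and> serves t0 xs d tm \<and>
           reshape (8 * card Q) tm t' \<and> bst t' \<and> set_tree t' = N \<and> heap pr' t'"
proof -
  have fN: "finite N" using t(2) by auto
  have QN: "Q \<subseteq> N" using touch unfolding touch_def by blast
  then have fQ: "finite Q" using fN finite_subset by blast
  have pos: "\<forall>x\<in>set_tree t. 0 < x" using N t(2) by (metis gr0I)
  have "Q \<inter> set_tree t = Q" using QN t(2) by blast
  then obtain u g where u: "t = graft 0 u g" "set_tree u = Q"
    using top_closed_graft[OF t(1,3) _ pos, of Q] touch t(2) unfolding touch_def by auto
  have bu: "bst u" using bst_graft t(1) u(1) by blast
  have uL: "u \<noteq> Leaf" using u(2) xs(1,2) by (cases xs) auto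
  have sz: "size u = card Q" using size_bst[OF bu] u(2) by simp
  obtain ub where ub: "bst ub" "set_tree ub = Q" "\<forall>x\<in>set xs. tdepth ub x < h"
    using ex_bst_shallow[OF fQ xs(1,3)] by blast
  obtain u' where u': "bst u'" "set_tree u' = Q" "heap pr' u'" using ex_treap[OF fQ] by blast
  let ?tm = "graft 0 ub g" and ?t' = "graft 0 u' g"
  have r1: "reshape (8 * card Q) t ?tm"
    using reshape_graft[of 0 u g ub] t(1) u uL ub inorder_eq_if_bst[OF bu ub(1)] sz by simp
  have itm: "inorder ?tm = inorder t" using reshape_inorder[OF r1] .
  have btm: "bst ?tm" using itm t(1) bst_cong_inorder by blast
  have ubL: "ub \<noteq> Leaf" using ub(2) u(2) uL by (cases u) auto
  have r2: "reshape (8 * card Q) ?tm ?t'"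
    using reshape_graft[of 0 ub g u'] btm ubL inorder_eq_if_bst[OF ub(1) u'(1)] ub u' size_bst[OF ub(1)]
    by simp
  have it': "inorder ?t' = inorder t" using reshape_inorder[OF r2] itm by simp
  have xm: "\<forall>x\<in>set xs. x \<in> set_tree ?tm \<and> tdepth ?tm x < h"
    using xs(1) ub tdepth_graft[OF btm] by (auto simp: set_tree_graft)
  obtain d where d: "d \<le> c + 8 * card Q + length xs * h" "serves t0 xs d ?tm"
    using serves_static[OF btm xm reshape_trans[OF t0 r1] xs(2)] by blast
  \<comment> \<open>Hanging subtrees contain only untouched keys, whose priorities are unchanged and
    lie below those of all touched keys. Both parts of the new heap order follow from this.\<close>
  have hang: "set_tree (g x) \<subseteq> N - Q" if "x \<in> insert 0 Q" for x
    using bst_graft_disjoint[of 0 u g x] t(1) u that t(2) set_tree_graft[of 0 u g] by auto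
  have "heap pr' ?t'"
  proof (rule heap_graft[OF u'(3)])
    fix x assume x: "x \<in> insert 0 (set_tree u')"
    then have "heap pr (g x)" using heap_graft_hanging t(3) u u'(2) by metis
    moreover have "pr y = pr' y" if "y \<in> set_tree (g x)" for y
      using that hang[of x] x u'(2) touch unfolding touch_def by auto
    ultimately show "heap pr' (g x)" using heap_cong by metis
  next
    fix x y z assume "x \<in> insert 0 (set_tree u')" "y \<in> set_tree (g x)" "z \<in> set_tree u'"
    then show "pr' y \<le> pr' z" using hang[of x] u'(2) touch unfolding touch_def
      by (meson less_imp_le subset_eq)
  qed
  moreover have "bst ?t'" "set_tree ?t' = N"
    using it' t(1,2) bst_cong_inorder apply blast using it' t(2) by (metis set_inorder)
  ultimately show ?thesis using d r2 by blast
qed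

section \<open>Amortized cost of batches\<close>

text \<open>Keys of \<open>M\<close> are touched free of charge: a batch pays for the marked set
  once, at its beginning. Only keys beyond it are charged to the weight \<open>w\<close> and to the
  drop of the potential.\<close>

definition advance :: "nat set \<Rightarrow> nat \<Rightarrow> (nat \<Rightarrow> nat) \<Rightarrow> nat set \<Rightarrow> nat \<Rightarrow> nat set \<Rightarrow> nat \<Rightarrow>
    (nat \<Rightarrow> nat) \<Rightarrow> nat set \<Rightarrow> nat \<Rightarrow> bool" where
  "advance N C pr M \<Phi> Q w pr' M' \<Phi>' \<longleftrightarrow>
     touch N Q pr pr' \<and> M \<subseteq> Q \<and> M' \<subseteq> Q \<and> card (Q - M) + \<Phi>' \<le> \<Phi> + C * w"

text \<open>The keys that the second step touches for free lie in \<open>M'\<close>, hence in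
  \<open>Q\<close>, where the first step has already accounted for them.\<close>

lemma advance_trans:
  assumes N: "finite N" and 1: "advance N C pr M \<Phi> Q w pr' M' \<Phi>'"
    and 2: "advance N C pr' M' \<Phi>' Q' w' pr'' M'' \<Phi>''"
  shows "advance N C pr M \<Phi> (Q \<union> Q') (w + w') pr'' M'' \<Phi>''"
proof -
  have f: "finite Q" "finite Q'" using 1 2 N finite_subset unfolding advance_def touch_def by blast+
  have "Q \<union> Q' - M \<subseteq> (Q - M) \<union> (Q' - M')" using 1 unfolding advance_def by blast
  then have "card (Q \<union> Q' - M) \<le> card ((Q - M) \<union> (Q' - M'))" using f by (intro card_mono) auto
  also have "\<dots> \<le> card (Q - M) + card (Q' - M')" by (rule card_Un_le)
  finally have "card (Q \<union> Q' - M) + \<Phi>'' \<le> \<Phi> + C * (w + w')"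
    using 1 2 unfolding advance_def by (simp add: algebra_simps)
  then show ?thesis using touch_trans 1 2 unfolding advance_def by blast
qed

lemma advance_range:
  assumes N: "finite N"
    and adv: "\<And>i. i < m \<Longrightarrow> advance N C (pr i) (M i) (\<Phi> i) (Q i) (w i) (pr (Suc i)) (M (Suc i)) (\<Phi> (Suc i))"
    and "i < e" "e \<le> m"
  shows "advance N C (pr i) (M i) (\<Phi> i) (\<Union>j\<in>{i..<e}. Q j) (\<Sum>j=i..<e. w j) (pr e) (M e) (\<Phi> e)"
  using assms(3,4)
proof (induction e)
  case (Suc e)
  show ?case
  proof (cases "i = e")
    case True
    then show ?thesis using adv[of e] Suc.prems by simp
  next
    case False
    then have "advance N C (pr i) (M i) (\<Phi> i) (\<Union>j\<in>{i..<e}. Q j) (\<Sum>j=i..<e. w j) (pr e) (M e) (\<Phi> e)"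
      using Suc by simp
    from advance_trans[OF N this adv[of e]] show ?thesis
      using Suc.prems False by (simp add: atLeastLessThanSuc Un_commute add.commute)
  qed
qed simp

text \<open>A batch ends as soon as its weight reaches \<open>k\<close>. Its initial marked set of
  at most \<open>B * k\<close> keys is then covered by \<open>B\<close> times the weight; in the
  last batch \<open>card N\<close> covers it instead. The factor 16 adds up the two reshapings of a
  batch, each with 8 operations per touched key.\<close>

lemma serves_advances:
  assumes N: "finite N" "0 \<notin> N"
    and adv: "\<And>i. i < length X \<Longrightarrow>
      advance N C (pr i) (M i) (\<Phi> i) (Q i) (w i) (pr (Suc i)) (M (Suc i)) (\<Phi> (Suc i))"
    and X: "\<And>i. i < length X \<Longrightarrow> X ! i \<in> Q i" and w: "\<And>i. i < length X \<Longrightarrow> 1 \<le> w i"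
    and M: "\<And>i. i < length X \<Longrightarrow> card (M i) \<le> B * k" and k: "1 \<le> k" "k < 2 ^ h"
    and t: "reshape c t0 t" "bst t" "set_tree t = N" "heap (pr i) t" and i: "i \<le> length X"
  shows "\<exists>d v. serves t0 (drop i X) d v \<and>
    d \<le> c + 16 * (C + B) * (\<Sum>j=i..<length X. w j) + 16 * \<Phi> i + 16 * card N + h * (length X - i)"
  using t i
proof (induction "length X - i" arbitrary: i c t0 t rule: less_induct)
  case less
  let ?m = "length X"
  show ?case
  proof (cases "i = ?m")
    case True
    then show ?thesis using serves_Nil[of t0] by (intro exI[of _ 0] exI[of _ t0]) simp
  next
    case False
    then have im: "i < ?m" using less.prems by simp
    \<comment> \<open>The alternative \<open>e = ?m\<close> makes a least end exist even if the
      remaining weight is below \<open>k\<close>.\<close>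
    define full where "full e \<longleftrightarrow> i < e \<and> (e = ?m \<or> k \<le> (\<Sum>j=i..<e. w j))" for e
    define e where "e = (LEAST e. full e)"
    have fm: "full ?m" using im by (simp add: full_def)
    then have fe: "full e" and em: "e \<le> ?m" unfolding e_def by (auto intro: LeastI Least_le)
    have ie: "i < e" using fe by (simp add: full_def)
    \<comment> \<open>Without its last access the batch has weight below \<open>k\<close>, and every
      access has weight at least 1.\<close>
    have ek: "e - i \<le> k"
    proof (cases "e = Suc i")
      case False
      then have ie': "i < e - 1" using ie by simp
      have "\<not> full (e - 1)" using not_less_Least[of "e - 1" full] ie unfolding e_def[symmetric] by simp
      then have "(\<Sum>j=i..<e - 1. w j) < k" using ie' by (simp add: full_def)
      moreover have "(\<Sum>j=i..<e - 1. 1) \<le> (\<Sum>j=i..<e - 1. w j)"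
        using w em by (intro sum_mono) auto
      ultimately show ?thesis by simp
    qed (use k in simp)
    define Qb where "Qb = (\<Union>j\<in>{i..<e}. Q j)"
    define W where "W = (\<Sum>j=i..<e. w j)"
    have ab: "advance N C (pr i) (M i) (\<Phi> i) Qb W (pr e) (M e) (\<Phi> e)"
      unfolding Qb_def W_def using advance_range[where pr = pr and M = M and \<Phi> = \<Phi> and Q = Q and w = w, OF N(1) adv ie em] by blast
    define xs where "xs = take (e - i) (drop i X)"
    have lx: "length xs = e - i" using em by (simp add: xs_def)
    have sx: "set xs \<subseteq> Qb"
    proof
      fix x assume "x \<in> set xs"
      then obtain j where "j < e - i" "x = X ! (i + j)" using lx em
        by (auto simp: in_set_conv_nth xs_def)
      then show "x \<in> Qb" using X[of "i + j"] em unfolding Qb_def by (intro UN_I[of "i + j"]) auto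
    qed
    have "card (set xs) < 2 ^ h" using card_length[of xs] lx ek k by linarith
    moreover have "xs \<noteq> []" using lx ie by auto
    ultimately obtain d tm t' where d: "d \<le> c + 8 * card Qb + length xs * h" "serves t0 xs d tm"
      "reshape (8 * card Qb) tm t'" "bst t'" "set_tree t' = N" "heap (pr e) t'"
      using serves_batch[OF less.prems(2-4) N(2) _ sx] ab less.prems(1) unfolding advance_def by blast
    have dr: "drop i X = xs @ drop e X" using ie unfolding xs_def
      by (metis append_take_drop_id drop_drop le_add_diff_inverse2 less_imp_le)
    have "Qb \<subseteq> N" using ab unfolding advance_def touch_def by blast
    then have fQ: "finite Qb" using N finite_subset by blast
    then have fM: "finite (M i)" "M i \<subseteq> N" using ab \<open>Qb \<subseteq> N\<close> finite_subset unfolding advance_def by blast+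
    have "card Qb \<le> card (M i) + card (Qb - M i)"
      using card_Un_le[of "M i" "Qb - M i"] ab unfolding advance_def by (simp add: Un_absorb1)
    then have cQ: "card Qb + \<Phi> e \<le> card (M i) + \<Phi> i + C * W"
      using ab unfolding advance_def by linarith
    have Wsum: "(\<Sum>j=i..<?m. w j) = W + (\<Sum>j=e..<?m. w j)"
      unfolding W_def using sum.atLeastLessThan_concat[of i e ?m w] ie em by simp
    have hs: "h * (?m - i) = length xs * h + h * (?m - e)"
      using lx ie em by (simp add: algebra_simps flip: add_mult_distrib2)
    show ?thesis
    proof (cases "e = ?m")
      case True
      have "card (M i) \<le> card N" using fM N card_mono by blast
      then have "d \<le> c + 16 * (C + B) * W + 16 * \<Phi> i + 16 * card N + h * (?m - i)"
        using d(1) cQ hs True by (simp add: algebra_simps)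
      then show ?thesis using d(2) dr True Wsum by auto
    next
      case False
      then have "k \<le> W" using fe unfolding full_def W_def by simp
      then have "card (M i) \<le> B * W" using M[OF im] mult_le_mono2[of k W B] by linarith
      then have q: "card Qb + \<Phi> e \<le> \<Phi> i + (C + B) * W" using cQ by (simp add: algebra_simps)
      obtain d' v where d': "serves tm (drop e X) d' v"
        "d' \<le> 8 * card Qb + 16 * (C + B) * (\<Sum>j=e..<?m. w j) + 16 * \<Phi> e + 16 * card N + h * (?m - e)"
        using less.hyps[OF _ d(3-6) em] ie im by (metis diff_less_mono2)
      have "d + d' \<le> c + 16 * (C + B) * (\<Sum>j=i..<?m. w j) + 16 * \<Phi> i + 16 * card N + h * (?m - i)"
        using d(1) d'(2) q hs unfolding Wsum by (simp add: algebra_simps)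
      then show ?thesis using serves_append[OF d(2) d'(1)] dr by auto
    qed
  qed
qed

section \<open>Ancestors in a tree given by its key intervals\<close>

section \<open>Search trees as interval families\<close>

text \<open>Parenthood is read off from the bounds: a child shares one bound with its parent and has
  the parent as the other. With the bound functions as parameters, subtrees of a datatype tree can
  be treated in the same way.\<close>

definition tree_child :: "('a::linorder \<Rightarrow> 'a) \<Rightarrow> ('a \<Rightarrow> 'a) \<Rightarrow> 'a \<Rightarrow> 'a \<Rightarrow> bool" where
  "tree_child lo hi v c \<longleftrightarrow>
     lo v < c \<and> c < v \<and> lo c = lo v \<and> hi c = v \<or> v < c \<and> c < hi v \<and> lo c = v \<and> hi c = hi v"

text \<open>The subtree of \<open>v\<close> holds the keys strictly between \<open>lo v\<close> and \<open>hi v\<close>. These bounds are the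
  nearest ancestors on either side, or the sentinels \<open>0\<close> and \<open>n + 1\<close>.\<close>

locale interval_tree =
  fixes n root :: nat and lo hi :: "nat \<Rightarrow> nat"
  assumes root: "root \<in> {1..n}" "lo root = 0" "hi root = n + 1"
    and bounds: "v \<in> {1..n} \<Longrightarrow> lo v < v \<and> v < hi v \<and> hi v \<le> n + 1"
    and left_nested: "v \<in> {1..n} \<Longrightarrow> w \<in> {1..n} \<Longrightarrow> lo v < w \<Longrightarrow> w < v \<Longrightarrow> lo v \<le> lo w \<and> hi w \<le> v"
    and right_nested: "v \<in> {1..n} \<Longrightarrow> w \<in> {1..n} \<Longrightarrow> v < w \<Longrightarrow> w < hi v \<Longrightarrow> v \<le> lo w \<and> hi w \<le> hi v"
    and lo_spans: "v \<in> {1..n} \<Longrightarrow> lo v \<noteq> 0 \<Longrightarrow> v < hi (lo v)"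
    and hi_spans: "v \<in> {1..n} \<Longrightarrow> hi v \<noteq> n + 1 \<Longrightarrow> lo (hi v) < v"
    and ex_parent: "c \<in> {1..n} \<Longrightarrow> c \<noteq> root \<Longrightarrow> \<exists>v\<in>{1..n}. tree_child lo hi v c"
begin

abbreviation N :: "nat set" where "N \<equiv> {1..n}"

abbreviation child :: "nat \<Rightarrow> nat \<Rightarrow> bool" where "child \<equiv> tree_child lo hi"

lemmas child_def = tree_child_def

definition anc :: "nat \<Rightarrow> nat \<Rightarrow> bool" where
  "anc a x \<longleftrightarrow> a \<in> N \<and> x \<in> N \<and> lo a < x \<and> x < hi a"

lemma ancD: "anc a x \<Longrightarrow> a \<in> N \<and> x \<in> N \<and> lo a < x \<and> x < hi a"
  by (simp add: anc_def)

lemma anc_refl: "a \<in> N \<Longrightarrow> anc a a"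
  using bounds by (simp add: anc_def)

lemma anc_root: "x \<in> N \<Longrightarrow> anc root x"
  using root by (simp add: anc_def)

lemma anc_mono: "anc a b \<Longrightarrow> lo a \<le> lo b \<and> hi b \<le> hi a"
  using left_nested[of a b] right_nested[of a b] bounds[of a]
  by (cases a b rule: linorder_cases) (auto simp: anc_def)

lemma anc_trans: "anc a b \<Longrightarrow> anc b c \<Longrightarrow> anc a c"
  using anc_mono[of a b] by (auto simp: anc_def)

lemma anc_left: "anc a b \<Longrightarrow> b < a \<Longrightarrow> hi b \<le> a"
  using left_nested[of a b] by (auto simp: anc_def)

lemma anc_right: "anc a b \<Longrightarrow> a < b \<Longrightarrow> a \<le> lo b"
  using right_nested[of a b] by (auto simp: anc_def)

lemma anc_antisym: "anc a b \<Longrightarrow> anc b a \<Longrightarrow> a = b"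
  using anc_left[of a b] anc_right[of a b]
  by (cases a b rule: linorder_cases) (auto simp: anc_def)

lemma lo_N: "v \<in> N \<Longrightarrow> lo v \<noteq> 0 \<Longrightarrow> lo v \<in> N"
  using bounds[of v] by auto

lemma hi_N: "v \<in> N \<Longrightarrow> hi v \<noteq> n + 1 \<Longrightarrow> hi v \<in> N"
  using bounds[of v] by auto

lemma anc_lo: "v \<in> N \<Longrightarrow> lo v \<in> N \<Longrightarrow> anc (lo v) v"
  using bounds[of v] lo_spans[of v] bounds[of "lo v"] by (auto simp: anc_def)

lemma anc_hi: "v \<in> N \<Longrightarrow> hi v \<in> N \<Longrightarrow> anc (hi v) v"
  using bounds[of v] hi_spans[of v] bounds[of "hi v"] by (auto simp: anc_def)

lemma child_anc:
  assumes "child v c" "v \<in> N" "c \<in> N"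
  shows "anc v c \<and> v \<noteq> c"
proof -
  have "lo v < c \<and> c < hi v \<and> v \<noteq> c"
    using assms(1) bounds[OF assms(2)] unfolding child_def by linarith
  then show ?thesis using assms by (simp add: anc_def)
qed

lemma child_bounds: "child v c \<Longrightarrow> lo c \<in> {v, lo v} \<and> hi c \<in> {v, hi v} \<and> (lo c = v \<or> hi c = v)"
  unfolding child_def by blast

text \<open>The delicate case is an ancestor \<open>z\<close> beyond the bound that \<open>a\<close>
  shares with its parent, say \<open>z \<le> lo v\<close>. Then \<open>lo v\<close> is itself a node
  whose interval reaches past \<open>v\<close>, and nestedness pushes the upper bound of
  \<open>z\<close> at least as far.\<close>

lemma anc_parent:
  assumes "child v a" "v \<in> N" "anc z a" "z \<noteq> a"
  shows "anc z v"
proof (cases "z = v")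
  case False
  have N: "z \<in> N" "a \<in> N" using assms(3) by (auto simp: anc_def)
  have za: "lo z < a" "a < hi z" using assms(3) by (auto simp: anc_def)
  have nz: "\<not> (lo a < z \<and> z < hi a)" using assms(3,4) anc_antisym[of z a] N by (auto simp: anc_def)
  from assms(1) consider (l) "lo v < a" "a < v" "lo a = lo v" "hi a = v"
    | (r) "v < a" "a < hi v" "lo a = v" "hi a = hi v" unfolding child_def by blast
  then show ?thesis
  proof cases
    case l
    show ?thesis
    proof (cases "v < z")
      case True
      then show ?thesis using l za N assms(2) bounds[of z] by (auto simp: anc_def)
    next
      case F: False
      then have zl: "z \<le> lo v" using nz l False by auto
      then have u: "lo v \<in> N" using N assms(2) bounds[OF assms(2)] by auto
      have uv: "v < hi (lo v)" using lo_spans[OF assms(2)] u by auto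
      have "hi (lo v) \<le> hi z"
        using right_nested[OF N(1) u] zl za l by (cases "z = lo v") auto
      then show ?thesis using uv zl assms(2) N bounds[of z] bounds[of v] by (auto simp: anc_def)
    qed
  next
    case r
    show ?thesis
    proof (cases "z < v")
      case True
      then show ?thesis using r za N assms(2) bounds[of z] by (auto simp: anc_def)
    next
      case F: False
      then have zl: "hi v \<le> z" using nz r False by auto
      then have u: "hi v \<in> N" using N bounds[OF assms(2)] by auto
      have uv: "lo (hi v) < v" using hi_spans[OF assms(2)] u by auto
      have "lo z \<le> lo (hi v)"
        using left_nested[OF N(1) u] zl za r by (cases "z = hi v") auto
      then show ?thesis using uv zl assms(2) N bounds[of z] bounds[of v] by (auto simp: anc_def)
    qed
  qed
qed (use assms anc_refl in auto)

definition dep :: "nat \<Rightarrow> nat" where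
  "dep x = card {a. anc a x}"

lemma finite_anc: "finite {a. anc a x}"
  by (rule finite_subset[of _ N]) (auto simp: anc_def)

lemma dep_le: "dep x \<le> n"
proof -
  have "{a. anc a x} \<subseteq> N" by (auto simp: anc_def)
  then show ?thesis unfolding dep_def using card_mono[of N "{a. anc a x}"] by simp
qed

lemma dep_less: "anc a b \<Longrightarrow> a \<noteq> b \<Longrightarrow> dep a < dep b"
  unfolding dep_def
proof (rule psubset_card_mono[OF finite_anc])
  assume "anc a b" "a \<noteq> b"
  then show "{x. anc x a} \<subset> {x. anc x b}"
    using anc_trans anc_antisym anc_refl[of b] ancD[of a b] by blast
qed

lemma ex_child_towards: "anc z a \<Longrightarrow> z \<noteq> a \<Longrightarrow> \<exists>c\<in>N. child z c \<and> anc c a"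
proof (induction "dep a" arbitrary: a rule: less_induct)
  case less
  have a: "a \<in> N" using less.prems by (auto simp: anc_def)
  have "a \<noteq> root" using less.prems anc_root[of z] anc_antisym ancD[of z a] by blast
  then obtain v where v: "v \<in> N" "child v a" using ex_parent[OF a] by blast
  show ?case
  proof (cases "z = v")
    case True
    then show ?thesis using v a anc_refl by blast
  next
    case False
    have "anc z v" using anc_parent[OF v(2,1) less.prems] .
    moreover have va: "anc v a" "v \<noteq> a" using child_anc[OF v(2,1) a] by auto
    ultimately show ?thesis using less.hyps[OF dep_less[OF va]] False anc_trans[OF _ va(1)] by blast
  qed
qed

text \<open>For a deepest common ancestor outside the range of the two keys, both keys would lie on
  one side of it, and its child on that side would be a deeper one.\<close>

lemma ex_lca:
  assumes "a \<in> N" "b \<in> N"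
  shows "\<exists>z. anc z a \<and> anc z b \<and> min a b \<le> z \<and> z \<le> max a b"
proof -
  \<comment> \<open>Minimising \<open>n - dep z\<close> maximises the depth, because depths are at
    most \<open>n\<close>.\<close>
  obtain z where z: "anc z a \<and> anc z b" "\<And>y. anc y a \<and> anc y b \<Longrightarrow> n - dep z \<le> n - dep y"
    using ex_has_least_nat[of "\<lambda>z. anc z a \<and> anc z b" root "\<lambda>z. n - dep z"] anc_root assms by blast
  have False if "\<not> (min a b \<le> z \<and> z \<le> max a b)"
  proof -
    have ne: "z \<noteq> a" using that by auto
    obtain c where c: "c \<in> N" "child z c" "anc c a" using ex_child_towards z(1) ne by blast
    have "anc c b" using c z(1) that assms unfolding anc_def child_def by auto
    moreover have "dep z < dep c" using dep_less child_anc[OF c(2) _ c(1)] z(1) ancD by blast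
    ultimately show False using z(2)[of c] c(3) dep_le[of c] by auto
  qed
  then show ?thesis using z(1) by blast
qed

text \<open>A common ancestor strictly between \<open>a\<close> and \<open>b\<close> would separate
  their intervals, but both contain \<open>x\<close>.\<close>

lemma anc_linear: "anc a x \<Longrightarrow> anc b x \<Longrightarrow> anc a b \<or> anc b a"
proof -
  assume ab: "anc a x" "anc b x"
  then obtain z where z: "anc z a" "anc z b" "min a b \<le> z" "z \<le> max a b"
    using ex_lca[of a b] ancD by blast
  have "z = a \<or> z = b"
  proof (rule ccontr)
    assume "\<not> (z = a \<or> z = b)"
    then have "(a < z \<and> z < b) \<or> (b < z \<and> z < a)" using z(3,4) by auto
    then show False
      using anc_left[of z a] anc_right[of z b] anc_left[of z b] anc_right[of z a] z(1,2) ab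
      by (auto simp: anc_def)
  qed
  then show ?thesis using z by blast
qed

text \<open>A bounding key is inherited along the whole path from it down to \<open>c\<close>.
  Consequently, if a bound of \<open>c\<close> lies above a pivot or a member of the hand that is an
  ancestor of \<open>c\<close>, it bounds that node as well and is marked. This argument recurs in
  all changes of the hand.\<close>

lemma lo_below:
  assumes "anc (lo c) p" "anc p c" "lo c \<noteq> p"
  shows "lo p = lo c"
proof -
  have c: "lo c < c" using bounds[of c] ancD[OF assms(2)] by blast
  have "\<not> p < lo c" using anc_left[OF assms(1)] c ancD[OF assms(2)] by auto
  then have "lo c < p" using assms(3) by simp
  then show ?thesis using anc_right[OF assms(1)] anc_mono[OF assms(2)] by simp
qed

lemma hi_below:
  assumes "anc (hi c) p" "anc p c" "hi c \<noteq> p"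
  shows "hi p = hi c"
proof -
  have c: "c < hi c" using bounds[of c] ancD[OF assms(2)] by blast
  have "\<not> hi c < p" using anc_right[OF assms(1)] c ancD[OF assms(2)] by auto
  then have "p < hi c" using assms(3) by simp
  then show ?thesis using anc_left[OF assms(1)] anc_mono[OF assms(2)] by simp
qed

lemma anc_same_side:
  assumes "anc x c" "anc c v" "x \<noteq> c"
  shows "x < c \<longleftrightarrow> x < v"
proof -
  have "lo c < v" "v < hi c" using assms(2) by (auto simp: anc_def)
  then show ?thesis using anc_left[OF assms(1)] anc_right[OF assms(1)] assms(3)
    by (cases x c rule: linorder_cases) auto
qed

section \<open>Tendons and the priority invariant\<close>

section \<open>Hands\<close>

text \<open>Two root paths to members of \<open>S\<close> part at \<open>a\<close> when members lie
  on both sides of \<open>a\<close> inside its interval. With all such \<open>a\<close> included,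
  the union of the root paths falls apart into unbranched pieces.\<close>

definition branch_closed :: "nat set \<Rightarrow> bool" where
  "branch_closed S \<longleftrightarrow> S \<subseteq> N \<and> root \<in> S \<and>
     (\<forall>a\<in>N. (\<exists>s\<in>S. lo a < s \<and> s < a) \<and> (\<exists>s\<in>S. a < s \<and> s < hi a) \<longrightarrow> a \<in> S)"

definition cover :: "nat set \<Rightarrow> nat set" where
  "cover S = {a. \<exists>s\<in>S. anc a s}"

text \<open>A tendon is named after its lower end \<open>v\<close> and contains neither end. Since
  every key is its own ancestor, the last clause also excludes the members of \<open>S\<close>
  themselves.\<close>

definition tendon :: "nat set \<Rightarrow> nat \<Rightarrow> nat set" where
  "tendon S v = {x. anc x v \<and> x \<noteq> v \<and> (\<forall>s\<in>S. anc x s \<longrightarrow> anc s v \<longrightarrow> s = v)}"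

lemma cover_N: "cover S \<subseteq> N"
  by (auto simp: cover_def anc_def)

lemma cover_up: "x \<in> cover S \<Longrightarrow> anc a x \<Longrightarrow> a \<in> cover S"
  unfolding cover_def using anc_trans by blast

lemma subset_cover: "branch_closed S \<Longrightarrow> S \<subseteq> cover S"
  unfolding branch_closed_def cover_def using anc_refl by blast

lemma tendon_notin: "x \<in> tendon S v \<Longrightarrow> x \<notin> S"
  unfolding tendon_def using anc_refl ancD by blast

lemma tendon_cover: "v \<in> S \<Longrightarrow> tendon S v \<subseteq> cover S"
  unfolding tendon_def cover_def by blast

lemma tendon_N: "tendon S v \<subseteq> N"
  unfolding tendon_def anc_def by auto

lemma finite_tendon: "finite (tendon S v)"
  using finite_subset[OF tendon_N] by simp

lemma tendon_convex: "x \<in> tendon S v \<Longrightarrow> anc x y \<Longrightarrow> anc y v \<Longrightarrow> y \<noteq> v \<Longrightarrow> y \<in> tendon S v"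
  unfolding tendon_def using anc_trans by blast

lemma tendon_linear: "x \<in> tendon S v \<Longrightarrow> y \<in> tendon S v \<Longrightarrow> anc x y \<or> anc y x"
  unfolding tendon_def using anc_linear by blast

text \<open>No path to a member leaves a tendon in its interior: the common ancestor of
  \<open>v\<close> and \<open>s\<close> is in \<open>S\<close> by closure and lies below
  \<open>x\<close>, so it can only be the lower end \<open>v\<close>.\<close>

lemma tendon_anc:
  assumes S: "branch_closed S" and x: "x \<in> tendon S v" and v: "v \<in> S" and s: "s \<in> S" "anc x s"
  shows "anc v s"
proof -
  have xv: "anc x v" "x \<noteq> v" using x by (auto simp: tendon_def)
  have N: "v \<in> N" "s \<in> N" "x \<in> N" using xv s by (auto simp: anc_def)
  obtain z where z: "anc z v" "anc z s" "min v s \<le> z" "z \<le> max v s" using ex_lca[OF N(1,2)] by blast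
  have zS: "z \<in> S"
  proof (cases "z = v \<or> z = s")
    case False
    then have "(v < z \<and> z < s) \<or> (s < z \<and> z < v)" using z(3,4) by auto
    then show ?thesis using S v s(1) z(1,2) unfolding branch_closed_def anc_def by blast
  qed (use v s in auto)
  have "anc x z"
  proof (rule ccontr)
    assume nz: "\<not> anc x z"
    then have zx: "anc z x" "z \<noteq> x" using anc_linear[OF xv(1) z(1)] anc_refl N by blast+
    have "x \<notin> S" using tendon_notin[OF x] .
    then show False using zx anc_left[OF zx(1)] anc_right[OF zx(1)] xv(1) s(2) z(3,4) unfolding anc_def
      by (cases z x rule: linorder_cases) auto
  qed
  then have "z = v" using x zS z(1) unfolding tendon_def by blast
  then show ?thesis using z(2) by simp
qed

lemma tendon_disjoint:
  assumes "branch_closed S" "x \<in> tendon S v" "x \<in> tendon S w" "v \<in> S" "w \<in> S"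
  shows "v = w"
  using tendon_anc[OF assms(1,2,4,5)] tendon_anc[OF assms(1,3,5,4)] assms(2,3) anc_antisym
  unfolding tendon_def by blast

lemma ex_tendon:
  assumes "x \<in> cover S" "x \<notin> S"
  shows "\<exists>v\<in>S. x \<in> tendon S v"
proof -
  obtain v where v: "v \<in> S \<and> anc x v" "\<And>s. s \<in> S \<and> anc x s \<Longrightarrow> dep v \<le> dep s"
    using ex_has_least_nat[of "\<lambda>v. v \<in> S \<and> anc x v" _ dep] assms(1) unfolding cover_def by blast
  have "s = v" if "s \<in> S" "anc x s" "anc s v" for s
    using v(2)[of s] dep_less[OF that(3)] that by fastforce
  then show ?thesis using v(1) assms(2) unfolding tendon_def by blast
qed

text \<open>The value \<open>p s\<close> is meaningless for an empty tendon and must not be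
  marked.\<close>

definition pivots :: "nat set \<Rightarrow> (nat \<Rightarrow> nat) \<Rightarrow> nat set" where
  "pivots S p = p ` {s\<in>S. tendon S s \<noteq> {}}"

text \<open>The restriction to \<open>N\<close> discards the sentinels \<open>0\<close> and
  \<open>n + 1\<close>, which may occur as bounds.\<close>

definition spread :: "nat set \<Rightarrow> nat set" where
  "spread A = {x\<in>N. x \<in> A \<or> x \<in> lo ` A \<or> x \<in> hi ` A}"

definition marked :: "nat set \<Rightarrow> (nat \<Rightarrow> nat) \<Rightarrow> nat set" where
  "marked S p = spread (S \<union> pivots S p)"

text \<open>Along a tendon the priorities of the unmarked keys increase away from the pivot, but only
  among keys on the same side of the subtree hanging below the tendon.\<close>

definition hand :: "nat set \<Rightarrow> (nat \<Rightarrow> nat) \<Rightarrow> (nat \<Rightarrow> nat) \<Rightarrow> bool" where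
  "hand S p pr \<longleftrightarrow> branch_closed S \<and> (\<forall>s\<in>S. tendon S s \<noteq> {} \<longrightarrow> p s \<in> tendon S s) \<and>
     (\<forall>x\<in>N - marked S p. \<forall>y\<in>marked S p. pr x < pr y) \<and>
     (\<forall>c\<in>N - cover S. (lo c \<noteq> 0 \<longrightarrow> pr c < pr (lo c)) \<and> (hi c \<noteq> n + 1 \<longrightarrow> pr c < pr (hi c))) \<and>
     (\<forall>s\<in>S. \<forall>x\<in>tendon S s - marked S p. \<forall>y\<in>tendon S s - marked S p.
        x \<noteq> y \<longrightarrow> anc x y \<longrightarrow> (x < s \<longleftrightarrow> y < s) \<longrightarrow>
        (anc (p s) x \<longrightarrow> pr x < pr y) \<and> (anc y (p s) \<longrightarrow> pr y < pr x))"

lemma spread_mono: "A \<subseteq> B \<Longrightarrow> spread A \<subseteq> spread B"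
  unfolding spread_def by blast

lemma spread_N: "spread A \<subseteq> N"
  unfolding spread_def by blast

lemma spread_Un: "spread (A \<union> B) = spread A \<union> spread B"
  unfolding spread_def by blast

lemma subset_spread: "A \<subseteq> N \<Longrightarrow> A \<subseteq> spread A"
  unfolding spread_def by blast

lemma lo_spread: "a \<in> A \<Longrightarrow> lo a \<in> N \<Longrightarrow> lo a \<in> spread A"
  unfolding spread_def by blast

lemma hi_spread: "a \<in> A \<Longrightarrow> hi a \<in> N \<Longrightarrow> hi a \<in> spread A"
  unfolding spread_def by blast

lemma spread_cover:
  assumes "A \<subseteq> cover S"
  shows "spread A \<subseteq> cover S"
proof
  fix x assume "x \<in> spread A"
  then obtain a where "a \<in> A" "x \<in> N" "x = a \<or> x = lo a \<or> x = hi a" unfolding spread_def by blast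
  then show "x \<in> cover S" using assms cover_up[of a S x] anc_lo[of a] anc_hi[of a] cover_N by blast
qed

lemma card_spread_le: "finite A \<Longrightarrow> card (spread A) \<le> 3 * card A"
proof -
  assume A: "finite A"
  have "card (spread A) \<le> card (A \<union> (lo ` A \<union> hi ` A))"
    using A by (intro card_mono) (auto simp: spread_def)
  also have "\<dots> \<le> card A + (card (lo ` A) + card (hi ` A))"
    by (meson add_left_mono card_Un_le le_trans)
  also have "\<dots> \<le> 3 * card A" using card_image_le[OF A, of lo] card_image_le[OF A, of hi] by simp
  finally show ?thesis .
qed

context
  fixes S p pr
  assumes hand: "hand S p pr"
begin

lemma hand_closed: "branch_closed S"
  and hand_pivot: "s \<in> S \<Longrightarrow> tendon S s \<noteq> {} \<Longrightarrow> p s \<in> tendon S s"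
  and hand_marked: "x \<in> N \<Longrightarrow> x \<notin> marked S p \<Longrightarrow> y \<in> marked S p \<Longrightarrow> pr x < pr y"
  and hand_lo: "c \<in> N \<Longrightarrow> c \<notin> cover S \<Longrightarrow> lo c \<noteq> 0 \<Longrightarrow> pr c < pr (lo c)"
  and hand_hi: "c \<in> N \<Longrightarrow> c \<notin> cover S \<Longrightarrow> hi c \<noteq> n + 1 \<Longrightarrow> pr c < pr (hi c)"
  using hand unfolding hand_def by blast+

lemma hand_below:
  assumes "s \<in> S" "x \<in> tendon S s" "y \<in> tendon S s" "x \<notin> marked S p" "y \<notin> marked S p" "x \<noteq> y"
    "anc x y" "x < s \<longleftrightarrow> y < s" "anc (p s) x"
  shows "pr x < pr y"
  using hand assms unfolding hand_def by (meson DiffI)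

lemma hand_above:
  assumes "s \<in> S" "x \<in> tendon S s" "y \<in> tendon S s" "x \<notin> marked S p" "y \<notin> marked S p" "x \<noteq> y"
    "anc x y" "x < s \<longleftrightarrow> y < s" "anc y (p s)"
  shows "pr y < pr x"
  using hand assms unfolding hand_def by (meson DiffI)

lemma S_N: "S \<subseteq> N"
  using hand_closed unfolding branch_closed_def by blast

lemma root_S: "root \<in> S"
  using hand_closed unfolding branch_closed_def by blast

lemma pivots_cover: "pivots S p \<subseteq> cover S"
  unfolding pivots_def using hand_pivot tendon_cover by blast

lemma marked_cover: "marked S p \<subseteq> cover S"
  unfolding marked_def using spread_cover[of "S \<union> pivots S p"] pivots_cover subset_cover[OF hand_closed] by simp

lemma S_marked: "S \<subseteq> marked S p"
  unfolding marked_def using S_N subset_spread[of S] by (auto simp: spread_Un)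

lemma pivot_marked: "s \<in> S \<Longrightarrow> tendon S s \<noteq> {} \<Longrightarrow> p s \<in> marked S p"
  using hand_pivot[of s] tendon_N unfolding marked_def spread_def pivots_def by blast

lemma lo_marked: "a \<in> S \<or> a \<in> pivots S p \<Longrightarrow> lo a \<in> N \<Longrightarrow> lo a \<in> marked S p"
  unfolding marked_def by (rule lo_spread) auto

lemma hi_marked: "a \<in> S \<or> a \<in> pivots S p \<Longrightarrow> hi a \<in> N \<Longrightarrow> hi a \<in> marked S p"
  unfolding marked_def by (rule hi_spread) auto

text \<open>Keys outside the cover are called fresh. All keys below a fresh key are fresh, and the
  parent of a key is one of its two bounds; so the priorities fall at each step downwards.\<close>

lemma fresh_descendant: "y \<in> N \<Longrightarrow> y \<notin> cover S \<Longrightarrow> anc y x \<Longrightarrow> x \<noteq> y \<Longrightarrow> pr x < pr y"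
proof (induction "dep x" arbitrary: x rule: less_induct)
  case less
  have x: "x \<in> N" using less.prems by (auto simp: anc_def)
  have "x \<noteq> root" using less.prems anc_root[of y] anc_antisym by blast
  then obtain v where v: "v \<in> N" "child v x" using ex_parent[OF x] by blast
  have vx: "anc v x" "v \<noteq> x" using child_anc[OF v(2,1) x] by auto
  have yv: "anc y v" using anc_parent[OF v(2,1)] less.prems by blast
  have xH: "x \<notin> cover S" using less.prems cover_up by blast
  have "v \<noteq> 0" "v \<noteq> n + 1" using v(1) by auto
  then have "pr x < pr v" using hand_lo[OF x xH] hand_hi[OF x xH] child_bounds[OF v(2)] by metis
  then show ?case using less.hyps[OF dep_less[OF vx] less.prems(1,2) yv] by (cases "v = y") auto
qed

text \<open>The witness is the highest fresh ancestor. Its parent is covered, and so are its bounds,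
  each being the parent, a bound of the parent, or a sentinel.\<close>

lemma fresh_top:
  "x \<in> N \<Longrightarrow> x \<notin> cover S \<Longrightarrow> \<exists>c\<in>N - cover S. anc c x \<and> pr x \<le> pr c \<and>
     (lo c = 0 \<or> lo c \<in> cover S) \<and> (hi c = n + 1 \<or> hi c \<in> cover S)"
proof (induction "dep x" arbitrary: x rule: less_induct)
  case less
  have "x \<noteq> root" using less.prems root_S subset_cover[OF hand_closed] by blast
  then obtain v where v: "v \<in> N" "child v x" using ex_parent less.prems by blast
  have vx: "anc v x" "v \<noteq> x" using child_anc[OF v(2,1)] less.prems by auto
  show ?case
  proof (cases "v \<in> cover S")
    case True
    have "lo v = 0 \<or> lo v \<in> cover S" using lo_N[OF v(1)] anc_lo[OF v(1)] cover_up[OF True] by blast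
    moreover have "hi v = n + 1 \<or> hi v \<in> cover S"
      using hi_N[OF v(1)] anc_hi[OF v(1)] cover_up[OF True] by blast
    ultimately have "(lo x = 0 \<or> lo x \<in> cover S) \<and> (hi x = n + 1 \<or> hi x \<in> cover S)"
      using child_bounds[OF v(2)] True by (metis insertE singletonD)
    then show ?thesis using less.prems anc_refl by blast
  next
    case False
    have "v \<noteq> 0" "v \<noteq> n + 1" using v(1) by auto
    then have "pr x < pr v"
      using hand_lo[OF less.prems] hand_hi[OF less.prems] child_bounds[OF v(2)] by metis
    then show ?thesis using less.hyps[OF dep_less[OF vx] v(1) False] anc_trans[OF _ vx(1)]
      by (meson le_trans less_imp_le)
  qed
qed

text \<open>The bounds of the subtree of \<open>m\<close> are marked, so they stand between a key
  inside and a key outside that is not itself a bound. This turns adjacency in key order into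
  membership in the same subtrees.\<close>

lemma separated:
  assumes "m \<in> S \<or> m \<in> pivots S p" "anc m b" "\<not> anc m a" "a \<in> N" "a \<noteq> lo m" "a \<noteq> hi m"
  shows "\<exists>r\<in>marked S p. (a < r \<and> r < b) \<or> (b < r \<and> r < a)"
proof -
  have m: "m \<in> N" "lo m < b" "b < hi m" using assms(2) by (auto simp: anc_def)
  then consider "a < lo m" | "hi m < a" using assms(3-6) by (auto simp: anc_def)
  then show ?thesis
  proof cases
    case 1
    then have "lo m \<in> N" using lo_N[OF m(1)] by simp
    then show ?thesis using lo_marked[OF assms(1)] 1 m by blast
  next
    case 2
    then have "hi m \<in> N" using hi_N[OF m(1)] assms(4) by auto
    then show ?thesis using hi_marked[OF assms(1)] 2 m by blast
  qed
qed

text \<open>Only one kind of comparison has to be supplied, that of touched unmarked tendon keys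
  with untouched keys of the same tendon, side and stack. Other covered keys are separated by marked
  ones, and fresh keys are dominated by their bounds.\<close>

lemma top_closed_hand:
  assumes Q: "marked S p \<subseteq> Q" "Q \<subseteq> N"
    and H: "\<And>y. y \<in> Q \<Longrightarrow> y \<in> cover S \<Longrightarrow> y \<notin> marked S p \<Longrightarrow>
      \<exists>s\<in>S. y \<in> tendon S s \<and> (\<forall>x\<in>tendon S s - Q. (x < s \<longleftrightarrow> y < s) \<longrightarrow>
        anc (p s) x \<and> anc (p s) y \<or> anc x (p s) \<and> anc y (p s) \<longrightarrow> pr x < pr y)"
    and F: "\<And>y. y \<in> Q \<Longrightarrow> y \<notin> cover S \<Longrightarrow> (lo y = 0 \<or> lo y \<in> Q) \<and> (hi y = n + 1 \<or> hi y \<in> Q)"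
  shows "top_closed N pr Q"
proof -
  \<comment> \<open>For two covered keys with no touched key between them, comparability, a common
    tendon, a common side and a common stack are derived in turn. Each failure would put a marked
    key into the gap or contradict the disjointness of tendons.\<close>
  have inner: "pr x < pr y"
    if y: "y \<in> Q" "y \<in> cover S" "y \<notin> marked S p" and x: "x \<in> cover S" "x \<notin> Q"
      and gap: "\<And>z. z \<in> Q \<Longrightarrow> \<not> (x < z \<and> z < y) \<and> \<not> (y < z \<and> z < x)" for x y
  proof -
    have N: "x \<in> N" "y \<in> N" using x y cover_N by blast+
    obtain s where s: "s \<in> S" "y \<in> tendon S s" "\<forall>x\<in>tendon S s - Q. (x < s \<longleftrightarrow> y < s) \<longrightarrow>
        anc (p s) x \<and> anc (p s) y \<or> anc x (p s) \<and> anc y (p s) \<longrightarrow> pr x < pr y"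
      using H[OF y] by blast
    have xS: "x \<notin> S" using x Q S_marked by blast
    then obtain v where v: "v \<in> S" "x \<in> tendon S v" using ex_tendon x by blast
    have nx: "x \<noteq> lo m" "x \<noteq> hi m" and ny: "y \<noteq> lo m" "y \<noteq> hi m" if "m \<in> S \<or> m \<in> pivots S p" for m
      using lo_marked[OF that] hi_marked[OF that] N x(2) y(3) Q(1) by auto
    have gapM: "\<not> ((x < r \<and> r < y) \<or> (y < r \<and> r < x))" if "r \<in> marked S p" for r
      using gap[of r] that Q(1) by blast
    have sep: False if "m \<in> S \<or> m \<in> pivots S p" "anc m x \<noteq> anc m y" for m
      using separated[OF that(1), of x y] separated[OF that(1), of y x] nx[OF that(1)] ny[OF that(1)] N
        gapM that(2) by blast
    have sy: "anc y s" "y \<noteq> s" and vx: "anc x v" "x \<noteq> v" using s(2) v(2) by (auto simp: tendon_def)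
    have "anc x y \<or> anc y x"
    proof -
      obtain z where z: "anc z x" "anc z y" "min x y \<le> z" "z \<le> max x y" using ex_lca[OF N] by blast
      have "z = x \<or> z = y"
      proof (rule ccontr)
        assume "\<not> (z = x \<or> z = y)"
        then have b: "(x < z \<and> z < y) \<or> (y < z \<and> z < x)" using z(3,4) by auto
        have "anc z v" "anc z s" using z vx sy anc_trans by blast+
        moreover have "(v < z \<and> z < s) \<or> (s < z \<and> z < v)"
          using b anc_left[OF z(1)] anc_right[OF z(1)] anc_left[OF z(2)] anc_right[OF z(2)] ancD[OF vx(1)] ancD[OF sy(1)]
          by linarith
        ultimately have "z \<in> S" using hand_closed v(1) s(1) unfolding branch_closed_def anc_def by blast
        then show False using gapM[of z] b S_marked by blast
      qed
      then show ?thesis using z by blast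
    qed
    moreover have "v = s" if xy: "anc x y"
    proof -
      have "anc v s" using tendon_anc[OF hand_closed v(2,1) s(1)] anc_trans[OF xy sy(1)] by blast
      then consider "anc v y" | "anc y v" using anc_linear sy by blast
      then show ?thesis
      proof cases
        case 1
        moreover have "\<not> anc v x" using vx anc_antisym by blast
        ultimately show ?thesis using sep[of v] v(1) by blast
      next
        case 2
        have "y \<noteq> v" using y(3) v(1) S_marked by blast
        then have "y \<in> tendon S v" using tendon_convex[OF v(2) xy 2] by blast
        then show ?thesis using tendon_disjoint[OF hand_closed _ s(2) v(1) s(1)] by blast
      qed
    qed
    moreover have "v = s" if xy: "anc y x"
    proof -
      have "anc s v" using tendon_anc[OF hand_closed s(2,1) v(1)] anc_trans[OF xy vx(1)] by blast
      then consider "anc s x" | "anc x s" using anc_linear vx by blast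
      then show ?thesis
      proof cases
        case 1
        moreover have "\<not> anc s y" using sy anc_antisym by blast
        ultimately show ?thesis using sep[of s] s(1) by blast
      next
        case 2
        have "x \<noteq> s" using xS s(1) by blast
        then have "x \<in> tendon S s" using tendon_convex[OF s(2) xy 2] by blast
        then show ?thesis using tendon_disjoint[OF hand_closed _ v(2) s(1) v(1)] by blast
      qed
    qed
    ultimately have vs: "v = s" by blast
    have xs: "x \<in> tendon S s - Q" using v(2) vs x(2) by simp
    have side: "x < s \<longleftrightarrow> y < s"
      using gapM[of s] s(1) S_marked sy(2) vx(2) vs by (metis linorder_neqE_nat subsetD)
    have p: "p s \<in> tendon S s" "p s \<in> pivots S p" "p s \<in> marked S p"
      using hand_pivot s(1,2) pivot_marked unfolding pivots_def by blast+
    have "anc (p s) x \<and> anc (p s) y \<or> anc x (p s) \<and> anc y (p s)"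
      using sep[of "p s"] p tendon_linear[OF p(1), of x] tendon_linear[OF p(1), of y] xs s(2) by blast
    then show ?thesis using s(3) xs side by blast
  qed
  show ?thesis
    unfolding top_closed_def
  proof (intro ballI impI)
    fix x y assume y: "y \<in> Q" and x: "x \<in> N - Q"
      and gap: "\<forall>z\<in>Q. \<not> (x < z \<and> z < y) \<and> \<not> (y < z \<and> z < x)"
    have yN: "y \<in> N" using y Q(2) by blast
    consider "y \<in> marked S p" | "y \<notin> cover S" | "y \<in> cover S" "y \<notin> marked S p" by blast
    then show "pr x < pr y"
    proof cases
      case 1
      then show ?thesis using hand_marked x Q(1) by blast
    next
      case 2
      note F = F[OF y 2]
      \<comment> \<open>The bounds of a fresh touched key are touched or sentinels, so an untouched
        key not separated from \<open>y\<close> lies in its subtree.\<close>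
      have "lo y < x"
      proof (rule ccontr)
        assume "\<not> lo y < x"
        moreover have "lo y \<noteq> x" "lo y = 0 \<Longrightarrow> lo y < x" using F x by auto
        ultimately show False using F gap bounds[OF yN] by auto
      qed
      moreover have "x < hi y"
      proof (rule ccontr)
        assume "\<not> x < hi y"
        moreover have "hi y \<noteq> x" "hi y = n + 1 \<Longrightarrow> x < hi y" using F x by auto
        ultimately show False using F gap bounds[OF yN] by auto
      qed
      ultimately have "anc y x" using x yN by (simp add: anc_def)
      then show ?thesis using fresh_descendant[OF yN 2] x y by blast
    next
      case 3
      show ?thesis
      proof (cases "x \<in> cover S")
        case True
        then show ?thesis using inner[OF y 3 True] x gap by blast
      next
        case False
        \<comment> \<open>A fresh \<open>x\<close> is replaced by a bound of its highest fresh
          ancestor, on the side of \<open>y\<close>. This bound is covered, has larger priority than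
          \<open>x\<close>, and either is \<open>y\<close> or lies between \<open>x\<close> and
          \<open>y\<close>.\<close>
        then obtain c where c: "c \<in> N" "c \<notin> cover S" "anc c x" "pr x \<le> pr c"
          "lo c = 0 \<or> lo c \<in> cover S" "hi c = n + 1 \<or> hi c \<in> cover S" using fresh_top x by blast
        have "\<not> anc c y" using c(2) cover_up[OF 3(1)] by blast
        then consider "y \<le> lo c" | "hi c \<le> y" using c(1) yN by (auto simp: anc_def)
        then show ?thesis
        proof cases
          case 1
          then have l: "lo c \<noteq> 0" "lo c \<in> cover S" using c(5) yN by auto
          have "pr x < pr (lo c)" using hand_lo[OF c(1,2) l(1)] c(4) by simp
          moreover have "pr (lo c) < pr y" if "lo c \<noteq> y"
          proof (rule inner[OF y 3 l(2)])
            have "y < lo c" "lo c < x" using 1 that c(3) by (auto simp: anc_def)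
            then show "lo c \<notin> Q" using gap by blast
            fix z assume "z \<in> Q"
            then show "\<not> (lo c < z \<and> z < y) \<and> \<not> (y < z \<and> z < lo c)"
              using gap \<open>y < lo c\<close> \<open>lo c < x\<close> by auto
          qed
          ultimately show ?thesis by fastforce
        next
          case 2
          then have l: "hi c \<noteq> n + 1" "hi c \<in> cover S" using c(6) yN by auto
          have "pr x < pr (hi c)" using hand_hi[OF c(1,2) l(1)] c(4) by simp
          moreover have "pr (hi c) < pr y" if "hi c \<noteq> y"
          proof (rule inner[OF y 3 l(2)])
            have "hi c < y" "x < hi c" using 2 that c(3) by (auto simp: anc_def)
            then show "hi c \<notin> Q" using gap by blast
            fix z assume "z \<in> Q"
            then show "\<not> (hi c < z \<and> z < y) \<and> \<not> (y < z \<and> z < hi c)"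
              using gap \<open>hi c < y\<close> \<open>x < hi c\<close> by auto
          qed
          ultimately show ?thesis by fastforce
        qed
      qed
    qed
  qed
qed

end

end

section \<open>Balance of the two stacks of a tendon\<close>

section \<open>Moving the hand\<close>

context interval_tree
begin

text \<open>The two truncated differences add up to the absolute difference of the sizes of the two
  stacks.\<close>

definition imbalance :: "nat set \<Rightarrow> nat \<Rightarrow> nat" where
  "imbalance R q = (let a = card {x\<in>R. anc x q \<and> x \<noteq> q}; b = card {x\<in>R. anc q x \<and> x \<noteq> q}
     in (a - b) + (b - a))"

definition potential :: "nat set \<Rightarrow> (nat \<Rightarrow> nat) \<Rightarrow> nat" where
  "potential S p = (\<Sum>s\<in>S. imbalance (tendon S s) (p s))"

definition chain :: "nat set \<Rightarrow> bool" where
  "chain R \<longleftrightarrow> finite R \<and> (\<forall>x\<in>R. \<forall>y\<in>R. anc x y \<or> anc y x)"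

lemma chain_subset: "chain R \<Longrightarrow> R' \<subseteq> R \<Longrightarrow> chain R'"
  unfolding chain_def using finite_subset by blast

lemma chain_tendon: "chain (tendon S v)"
  unfolding chain_def using tendon_linear finite_tendon by blast

lemma imbalance_empty [simp]: "imbalance {} q = 0"
  by (simp add: imbalance_def)

lemma chain_partition:
  assumes "chain R" "q \<in> R"
  shows "card R = Suc (card {x\<in>R. anc x q \<and> x \<noteq> q} + card {x\<in>R. anc q x \<and> x \<noteq> q})"
proof -
  let ?A = "{x\<in>R. anc x q \<and> x \<noteq> q}" and ?B = "{x\<in>R. anc q x \<and> x \<noteq> q}"
  have f: "finite R" and l: "\<And>x. x \<in> R \<Longrightarrow> anc x q \<or> anc q x" using assms unfolding chain_def by blast+
  have "R = insert q (?A \<union> ?B)" using l assms(2) by blast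
  moreover have "?A \<inter> ?B = {}" using anc_antisym by blast
  moreover have "q \<notin> ?A \<union> ?B" by blast
  ultimately show ?thesis using f by (metis (no_types, lifting) card_Un_disjoint card_insert_disjoint finite_Un finite_insert)
qed

text \<open>Counting the proper ancestors within the chain is injective with values below
  \<open>card R\<close>, hence takes all these values; the pivot is the key whose count is half of
  the remaining keys.\<close>

lemma ex_middle:
  assumes R: "chain R" "R \<noteq> {}"
  shows "\<exists>q\<in>R. imbalance R q \<le> 1"
proof -
  define f where "f q = card {x\<in>R. anc x q \<and> x \<noteq> q}" for q
  have fin: "finite R" using R unfolding chain_def by blast
  have less: "f a < f b" if "a \<in> R" "b \<in> R" "anc a b" "a \<noteq> b" for a b
    unfolding f_def
  proof (rule psubset_card_mono)
    show "{x\<in>R. anc x a \<and> x \<noteq> a} \<subset> {x\<in>R. anc x b \<and> x \<noteq> b}"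
      using that anc_trans anc_antisym by blast
  qed (use fin in simp)
  have inj: "inj_on f R"
    using less R(1) unfolding chain_def inj_on_def by (metis nat_less_le)
  have sub: "f ` R \<subseteq> {..<card R}"
    using chain_partition[OF R(1)] unfolding f_def by auto
  have "f ` R = {..<card R}"
    using card_subset_eq[OF _ sub] card_image[OF inj] by simp
  moreover have "card R > 0" using R(2) fin by (simp add: card_gt_0_iff)
  ultimately have "(card R - 1) div 2 \<in> f ` R" by auto
  then obtain q where q: "q \<in> R" "f q = (card R - 1) div 2" by auto
  have "card R = Suc (f q + card {x\<in>R. anc q x \<and> x \<noteq> q})"
    using chain_partition[OF R(1) q(1)] unfolding f_def by simp
  then show ?thesis using q unfolding imbalance_def Let_def f_def by (intro bexI[of _ q]) linarith+
qed

lemma card_Diff1_bounds: "finite A \<Longrightarrow> card A \<le> Suc (card (A - {c})) \<and> card (A - {c}) \<le> card A"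
  by (simp add: card_Diff_singleton_if) arith

lemma dist_Suc_le:
  fixes a b a' b' :: nat
  assumes "a \<le> Suc a'" "a' \<le> a" "b \<le> Suc b'" "b' \<le> b"
  shows "(a' - b') + (b' - a') \<le> Suc ((a - b) + (b - a))" "(a - b) + (b - a) \<le> Suc ((a' - b') + (b' - a'))"
  using assms by arith+

lemma imbalance_remove:
  assumes "finite R"
  shows "imbalance (R - {c}) q \<le> Suc (imbalance R q)"
proof -
  let ?A = "{x\<in>R. anc x q \<and> x \<noteq> q}" and ?B = "{x\<in>R. anc q x \<and> x \<noteq> q}"
  have "{x\<in>R - {c}. anc x q \<and> x \<noteq> q} = ?A - {c}" "{x\<in>R - {c}. anc q x \<and> x \<noteq> q} = ?B - {c}" by auto
  then show ?thesis
    using dist_Suc_le(1)[of "card ?A" "card (?A - {c})" "card ?B" "card (?B - {c})"]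
      card_Diff1_bounds[of ?A c] card_Diff1_bounds[of ?B c] assms
    unfolding imbalance_def Let_def by simp
qed

lemma imbalance_insert:
  assumes "finite R"
  shows "imbalance (insert c R) q \<le> Suc (imbalance R q)"
proof (cases "c \<in> R")
  case True
  then show ?thesis by (simp add: insert_absorb)
next
  case False
  let ?A = "{x\<in>insert c R. anc x q \<and> x \<noteq> q}" and ?B = "{x\<in>insert c R. anc q x \<and> x \<noteq> q}"
  have "{x\<in>R. anc x q \<and> x \<noteq> q} = ?A - {c}" "{x\<in>R. anc q x \<and> x \<noteq> q} = ?B - {c}" using False by auto
  then show ?thesis
    using dist_Suc_le(2)[of "card ?A" "card (?A - {c})" "card ?B" "card (?B - {c})"]
      card_Diff1_bounds[of ?A c] card_Diff1_bounds[of ?B c] assms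
    unfolding imbalance_def Let_def by simp
qed

text \<open>With \<open>q\<close> at one end one stack is empty, and the imbalance is the size of
  the other. This is the potential released when the whole tendon has to be touched.\<close>

lemma imbalance_extreme:
  assumes "(\<forall>x\<in>R. anc q x) \<or> (\<forall>x\<in>R. anc x q)"
  shows "imbalance R q = card (R - {q})"
  using assms
proof
  assume a: "\<forall>x\<in>R. anc q x"
  then have "{x\<in>R. anc q x \<and> x \<noteq> q} = R - {q}" by auto
  moreover have "{x\<in>R. anc x q \<and> x \<noteq> q} = {}" using a anc_antisym by blast
  ultimately show ?thesis unfolding imbalance_def Let_def by (simp only: card.empty)
next
  assume a: "\<forall>x\<in>R. anc x q"
  then have "{x\<in>R. anc x q \<and> x \<noteq> q} = R - {q}" by auto
  moreover have "{x\<in>R. anc q x \<and> x \<noteq> q} = {}" using a anc_antisym by blast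
  ultimately show ?thesis unfolding imbalance_def Let_def by (simp only: card.empty)
qed

section \<open>Elementary changes of the hand at constant amortized cost\<close>

text \<open>\<open>T\<close> is to exceed all old priorities. Keys of a rebuilt tendon
  \<open>R\<close> are ranked by their distance from the new pivot \<open>q\<close>; depths are at
  most \<open>n\<close>, so they stay below the marked keys at \<open>T + n + 1\<close>.\<close>

definition raise :: "(nat \<Rightarrow> nat) \<Rightarrow> nat \<Rightarrow> nat set \<Rightarrow> nat set \<Rightarrow> nat \<Rightarrow> nat \<Rightarrow> nat" where
  "raise pr T M R q x = (if x \<in> M then T + n + 1
     else if x \<in> R then T + (dep x - dep q) + (dep q - dep x) else pr x)"

lemma raise_less_top: "pr x < T \<Longrightarrow> x \<notin> M \<Longrightarrow> raise pr T M R q x < T + n + 1"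
  using dep_le[of x] dep_le[of q] by (auto simp: raise_def)

lemma raise_ge: "pr x < T \<Longrightarrow> pr x \<le> raise pr T M R q x"
  by (auto simp: raise_def)

lemma raise_idle: "x \<notin> M \<Longrightarrow> x \<notin> R \<Longrightarrow> raise pr T M R q x = pr x"
  by (simp add: raise_def)

text \<open>The allowance 4 pays for three touched keys, a node and its two bounds, and for one unit
  of potential.\<close>

definition step :: "nat set \<Rightarrow> (nat \<Rightarrow> nat) \<Rightarrow> (nat \<Rightarrow> nat) \<Rightarrow> nat set \<Rightarrow> nat set \<Rightarrow>
    (nat \<Rightarrow> nat) \<Rightarrow> (nat \<Rightarrow> nat) \<Rightarrow> bool" where
  "step S p pr Q S' p' pr' \<longleftrightarrow> hand S' p' pr' \<and>
     advance N 4 pr (marked S p) (potential S p) Q 1 pr' (marked S' p') (potential S' p')"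

text \<open>Common frame of all changes of the hand. A key leaving the cover becomes fresh and has
  to be below its bounds, which is automatic once these are marked; this is the purpose of
  \<open>lost\<close>. Touchability refers to the old priorities, the order along tendons to the new
  ones.\<close>

lemma step_raise:
  assumes hand: "hand S p pr" and S': "branch_closed S'"
    and piv: "\<And>s. s \<in> S' \<Longrightarrow> tendon S' s \<noteq> {} \<Longrightarrow> p' s \<in> tendon S' s"
    and R: "R \<subseteq> cover S'" and T: "\<And>x. x \<in> N \<Longrightarrow> pr x < T"
    and lost: "\<And>x. x \<in> cover S \<Longrightarrow> x \<notin> cover S' \<Longrightarrow>
      (lo x = 0 \<or> lo x \<in> marked S' p') \<and> (hi x = n + 1 \<or> hi x \<in> marked S' p')"
    and grad: "\<And>s x y. s \<in> S' \<Longrightarrow> x \<in> tendon S' s \<Longrightarrow> y \<in> tendon S' s \<Longrightarrow> x \<notin> marked S' p' \<Longrightarrow>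
      y \<notin> marked S' p' \<Longrightarrow> x \<noteq> y \<Longrightarrow> anc x y \<Longrightarrow> (x < s \<longleftrightarrow> y < s) \<Longrightarrow>
      (anc (p' s) x \<longrightarrow> raise pr T (marked S' p') R q x < raise pr T (marked S' p') R q y) \<and>
      (anc y (p' s) \<longrightarrow> raise pr T (marked S' p') R q y < raise pr T (marked S' p') R q x)"
    and closed: "top_closed N pr (marked S p \<union> marked S' p' \<union> R)"
    and cost: "card (marked S p \<union> marked S' p' \<union> R - marked S p) + potential S' p' \<le> potential S p + 4"
  shows "\<exists>Q p' pr'. step S p pr Q S' p' pr'"
proof -
  let ?M = "marked S p" and ?M' = "marked S' p'"
  let ?pr = "raise pr T ?M' R q"
  let ?Q = "?M \<union> ?M' \<union> R"
  have piv': "pivots S' p' \<subseteq> cover S'" using piv tendon_cover unfolding pivots_def by blast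
  have M'c: "?M' \<subseteq> cover S'"
    unfolding marked_def using spread_cover[of "S' \<union> pivots S' p'"] piv' subset_cover[OF S'] by simp
  have QN: "?Q \<subseteq> N" using R cover_N spread_N unfolding marked_def by blast
  have "hand S' p' ?pr"
    unfolding hand_def
  proof (intro conjI ballI impI)
    fix x y assume "x \<in> N - ?M'" "y \<in> ?M'"
    then show "?pr x < ?pr y" using raise_less_top[of pr x T ?M' R q] T[of x] by (simp add: raise_def)
  next
    fix c assume c: "c \<in> N - cover S'" "lo c \<noteq> 0"
    then have i: "?pr c = pr c" using M'c R by (intro raise_idle) auto
    have l: "lo c \<in> N" using lo_N[of c] c by blast
    show "?pr c < ?pr (lo c)"
    proof (cases "c \<in> cover S")
      case True
      then have "lo c \<in> ?M'" using lost[OF True] c by blast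
      then have "?pr (lo c) = T + n + 1" by (simp add: raise_def)
      then show ?thesis using i T[of c] c by simp
    next
      case False
      then have "pr c < pr (lo c)" using hand_lo[OF hand, of c] c False by blast
      then show ?thesis using raise_ge[of pr "lo c" T] T[OF l] i by (metis less_le_trans)
    qed
  next
    fix c assume c: "c \<in> N - cover S'" "hi c \<noteq> n + 1"
    then have i: "?pr c = pr c" using M'c R by (intro raise_idle) auto
    have l: "hi c \<in> N" using hi_N[of c] c by blast
    show "?pr c < ?pr (hi c)"
    proof (cases "c \<in> cover S")
      case True
      then have "hi c \<in> ?M'" using lost[OF True] c by blast
      then have "?pr (hi c) = T + n + 1" by (simp add: raise_def)
      then show ?thesis using i T[of c] c by simp
    next
      case False
      then have "pr c < pr (hi c)" using hand_hi[OF hand, of c] c False by blast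
      then show ?thesis using raise_ge[of pr "hi c" T] T[OF l] i by (metis less_le_trans)
    qed
  next
    show "branch_closed S'" using S' .
  next
    fix s assume "s \<in> S'" "tendon S' s \<noteq> {}"
    then show "p' s \<in> tendon S' s" using piv by blast
  qed (use grad in blast)+
  moreover have "touch N ?Q pr ?pr"
    unfolding touch_def
  proof (intro conjI allI impI ballI)
    fix x y assume y: "y \<in> ?Q" and x: "x \<in> N - ?Q"
    have i: "?pr x = pr x" using x by (intro raise_idle) auto
    show "?pr x < ?pr y"
    proof (cases "y \<in> ?M' \<union> R")
      case True
      then have "T \<le> ?pr y" by (auto simp: raise_def)
      then show ?thesis using T[of x] x i by simp
    next
      case False
      then have "?pr y = pr y" "y \<in> ?M" using y by (auto intro: raise_idle)
      then show ?thesis using hand_marked[OF hand, of x y] x i by simp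
    qed
  qed (use QN closed in \<open>auto simp: raise_def\<close>)
  ultimately show ?thesis unfolding step_def advance_def using cost by (auto intro!: exI[of _ ?Q])
qed

lemma ex_bound: "\<exists>T. \<forall>x\<in>N. (pr :: nat \<Rightarrow> nat) x < T"
  by (rule exI[of _ "Suc (Max (pr ` N))"]) (auto simp: less_Suc_eq_le)

text \<open>No new branching arises: whenever an ancestor of \<open>c\<close> is not in
  \<open>S\<close>, the side of it that contains \<open>c\<close> has been reached by
  \<open>S\<close> before.\<close>

lemma branch_closed_insert:
  assumes "branch_closed S" "c \<in> N"
    and "\<And>a. anc a c \<Longrightarrow> a \<noteq> c \<Longrightarrow> a \<notin> S \<Longrightarrow> \<exists>s\<in>S. anc a s \<and> (s < a \<longleftrightarrow> c < a)"
  shows "branch_closed (insert c S)"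
proof -
  have "a \<in> insert c S"
    if a: "a \<in> N" and l: "l \<in> insert c S" "lo a < l" "l < a" and r: "r \<in> insert c S" "a < r" "r < hi a" for a l r
  proof (rule ccontr)
    assume n: "a \<notin> insert c S"
    have cl: "\<And>l r. l \<in> S \<Longrightarrow> lo a < l \<Longrightarrow> l < a \<Longrightarrow> r \<in> S \<Longrightarrow> a < r \<Longrightarrow> r < hi a \<Longrightarrow> a \<in> S"
      using assms(1) a unfolding branch_closed_def by blast
    have s: "\<exists>s\<in>S. lo a < s \<and> s < hi a \<and> (s < a \<longleftrightarrow> c < a) \<and> s \<noteq> a" if "lo a < c" "c < hi a"
    proof -
      have "anc a c" using that a assms(2) by (simp add: anc_def)
      then obtain s where "s \<in> S" "anc a s" "s < a \<longleftrightarrow> c < a" using assms(3)[of a] n by blast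
      then show ?thesis using n by (intro bexI[of _ s]) (auto simp: anc_def)
    qed
    have b: "a < hi a" "lo a < a" using bounds[OF a] by auto
    have "\<exists>l\<in>S. lo a < l \<and> l < a"
    proof (cases "l = c")
      case True
      then show ?thesis using s l b by auto
    qed (use l in blast)
    moreover have "\<exists>r\<in>S. a < r \<and> r < hi a"
    proof (cases "r = c")
      case True
      then obtain u where "u \<in> S" "u < hi a" "u < a \<longleftrightarrow> c < a" "u \<noteq> a" using s r b by auto
      then show ?thesis using True r(2) by (intro bexI[of _ u]) auto
    qed (use r in blast)
    ultimately show False using cl n by blast
  qed
  then show ?thesis using assms(1,2) unfolding branch_closed_def by blast
qed

text \<open>Each bound of \<open>c\<close> is \<open>v\<close> or a bound of \<open>v\<close>, hence
  marked or a sentinel. So \<open>c\<close> is the only key touched anew, and no tendon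
  changes.\<close>

lemma step_insert_fresh:
  assumes hand: "hand S p pr" and v: "v \<in> S" "child v c" and c: "c \<in> N" "c \<notin> cover S"
  shows "\<exists>Q p' pr'. step S p pr Q (insert c S) p' pr'"
proof -
  let ?S = "insert c S" and ?M = "marked S p"
  note cl = hand_closed[OF hand]
  have vN: "v \<in> N" using v S_N[OF hand] by blast
  have vc: "anc v c" "v \<noteq> c" using child_anc[OF v(2) vN c(1)] by auto
  have cS: "c \<notin> S" using c subset_cover[OF cl] by blast
  have S': "branch_closed ?S"
  proof (rule branch_closed_insert[OF cl c(1)])
    fix a assume a: "anc a c" "a \<noteq> c" "a \<notin> S"
    then have av: "anc a v" "a \<noteq> v" using anc_parent[OF v(2) vN] v by auto
    then show "\<exists>s\<in>S. anc a s \<and> (s < a \<longleftrightarrow> c < a)"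
      using anc_same_side[OF av(1) vc(1) av(2)] a(2) v(1) by (metis linorder_neqE_nat order_less_asym)
  qed
  have t: "tendon ?S s = tendon S s" if "s \<in> S" for s
    using c(2) that unfolding tendon_def cover_def by blast
  have tc: "tendon ?S c = {}"
    using anc_parent[OF v(2) vN] v vc unfolding tendon_def by blast
  have piv: "pivots ?S p = pivots S p" unfolding pivots_def using t tc by auto
  have M': "marked ?S p = ?M \<union> spread {c}"
    unfolding marked_def piv using spread_Un[of "{c}" "S \<union> pivots S p"] by auto
  have bd: "lo c = 0 \<or> lo c \<in> ?M" "hi c = n + 1 \<or> hi c \<in> ?M"
    using child_bounds[OF v(2)] lo_marked[OF hand, of v] hi_marked[OF hand, of v] v(1) S_marked[OF hand]
      lo_N[OF c(1)] hi_N[OF c(1)] by (metis insertE singletonD subsetD)+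
  have sc: "spread {c} \<subseteq> insert c ?M"
    using bd unfolding spread_def by auto
  have Q: "?M \<union> marked ?S p \<union> {} = insert c ?M" using sc M' subset_spread[of "{c}"] c by auto
  obtain T where T: "\<forall>x\<in>N. pr x < T" using ex_bound by blast
  have closed: "top_closed N pr (insert c ?M)"
  proof (rule top_closed_hand[OF hand])
    show "insert c ?M \<subseteq> N" using c spread_N unfolding marked_def by blast
  qed (use bd c marked_cover[OF hand] in auto)
  have fS: "finite S" using S_N[OF hand] finite_subset by blast
  have pot: "potential ?S p = potential S p"
    unfolding potential_def using fS cS t tc by simp
  have card: "card (insert c ?M - ?M) \<le> 1"
    using card_mono[of "{c}" "insert c ?M - ?M"] by auto
  show ?thesis
  proof (rule step_raise[OF hand S', where T = T and R = "{}" and p' = p and q = 0])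
    fix s assume "s \<in> ?S" "tendon ?S s \<noteq> {}"
    then have "s \<in> S" "tendon S s \<noteq> {}" using t tc by auto
    then show "p s \<in> tendon ?S s" using t hand_pivot[OF hand] by simp
  next
    fix x assume "x \<in> cover S" "x \<notin> cover ?S"
    then show "(lo x = 0 \<or> lo x \<in> marked ?S p) \<and> (hi x = n + 1 \<or> hi x \<in> marked ?S p)"
      unfolding cover_def by blast
  next
    fix s x y
    assume a: "s \<in> ?S" "x \<in> tendon ?S s" "y \<in> tendon ?S s" "x \<notin> marked ?S p" "y \<notin> marked ?S p"
      "x \<noteq> y" "anc x y" "x < s \<longleftrightarrow> y < s"
    then have s: "s \<in> S" using tc by auto
    have "x \<notin> ?M" "y \<notin> ?M" using a M' by auto
    then show "(anc (p s) x \<longrightarrow> raise pr T (marked ?S p) {} 0 x < raise pr T (marked ?S p) {} 0 y) \<and>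
      (anc y (p s) \<longrightarrow> raise pr T (marked ?S p) {} 0 y < raise pr T (marked ?S p) {} 0 x)"
      using hand_below[OF hand s] hand_above[OF hand s] a t[OF s] raise_idle by auto
  qed (use T closed pot card in \<open>auto simp only: Q\<close>)
qed

lemma pivots_insert_tendon:
  assumes w: "w \<in> S" and c: "c \<notin> S" and h: "h = c \<or> h = w" "k = c \<or> k = w" "h \<noteq> k"
    and t: "\<And>s. s \<in> S \<Longrightarrow> s \<noteq> w \<Longrightarrow> tendon (insert c S) s = tendon S s"
    and k: "tendon (insert c S) k = {}"
  shows "pivots (insert c S) (p(h := q)) =
    p ` {s\<in>S. tendon S s \<noteq> {} \<and> s \<noteq> w} \<union> (if tendon (insert c S) h = {} then {} else {q})"
proof -
  have A: "{s\<in>insert c S. tendon (insert c S) s \<noteq> {}} =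
    {s\<in>S. tendon S s \<noteq> {} \<and> s \<noteq> w} \<union> (if tendon (insert c S) h = {} then {} else {h})"
    using t k w c h by (cases "tendon (insert c S) h = {}"; simp; blast)
  have B: "h \<notin> {s\<in>S. tendon S s \<noteq> {} \<and> s \<noteq> w}" using h c by auto
  have C: "p(h := q) ` {s\<in>S. tendon S s \<noteq> {} \<and> s \<noteq> w} = p ` {s\<in>S. tendon S s \<noteq> {} \<and> s \<noteq> w}"
    using B by (intro image_cong) auto
  show ?thesis unfolding pivots_def A image_Un C by simp
qed

text \<open>Only the tendon of \<open>w\<close> is affected: its remaining keys belong to
  \<open>h\<close>, while \<open>k\<close> gets an empty tendon. The balance is stated additively to
  avoid truncated subtraction.\<close>

lemma potential_insert_tendon:
  assumes w: "w \<in> S" "finite S" and c: "c \<notin> S" and h: "h = c \<or> h = w" "k = c \<or> k = w" "h \<noteq> k"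
    and t: "\<And>s. s \<in> S \<Longrightarrow> s \<noteq> w \<Longrightarrow> tendon (insert c S) s = tendon S s"
    and k: "tendon (insert c S) k = {}"
  shows "potential (insert c S) (p(h := q)) + imbalance (tendon S w) (p w) =
    potential S p + imbalance (tendon (insert c S) h) q"
proof -
  let ?f = "\<lambda>s. imbalance (tendon S s) (p s)"
  let ?g = "\<lambda>s. imbalance (tendon (insert c S) s) ((p(h := q)) s)"
  have i: "insert c S = insert h (insert k (S - {w}))" using w h by auto
  have n: "h \<notin> insert k (S - {w})" "k \<notin> S - {w}" using h c by auto
  have "sum ?g (insert c S) = sum ?g (insert h (insert k (S - {w})))" using i by simp
  also have "\<dots> = ?g h + (?g k + sum ?g (S - {w}))" using n w(2) by simp
  also have "sum ?g (S - {w}) = sum ?f (S - {w})"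
    using t n by (intro sum.cong) auto
  also have "?g k = 0" using k by simp
  also have "?g h = imbalance (tendon (insert c S) h) q" by simp
  finally have "potential (insert c S) (p(h := q)) = imbalance (tendon (insert c S) h) q + sum ?f (S - {w})"
    unfolding potential_def by simp
  moreover have "potential S p = ?f w + sum ?f (S - {w})"
    unfolding potential_def using sum.remove[OF w(2,1)] by blast
  ultimately show ?thesis by simp
qed

text \<open>By \<open>ends\<close>, \<open>c\<close> is the lowest or the highest key of the tendon,
  so the rest \<open>R\<close> is still one tendon. If \<open>c\<close> is not the pivot, this is a
  pop that touches at most three new keys; otherwise the surviving stack is rebuilt around a middle
  key.\<close>

lemma step_insert_tendon:
  assumes hand: "hand S p pr" and w: "w \<in> S" and c: "c \<in> tendon S w"
    and ends: "child c w \<or> (\<exists>v\<in>S. child v c)"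
  shows "\<exists>Q p' pr'. step S p pr Q (insert c S) p' pr'"
proof -
  let ?S = "insert c S" and ?M = "marked S p"
  note cl = hand_closed[OF hand]
  have fS: "finite S" using S_N[OF hand] finite_subset by blast
  have wN: "w \<in> N" using w S_N[OF hand] by blast
  have cw: "anc c w" "c \<noteq> w" using c by (auto simp: tendon_def)
  have cN: "c \<in> N" using c tendon_N by blast
  have cS: "c \<notin> S" using tendon_notin[OF c] .
  have cov: "cover ?S = cover S" using cw(1) w anc_trans unfolding cover_def by blast
  have S': "branch_closed ?S"
  proof (rule branch_closed_insert[OF cl cN])
    fix a assume a: "anc a c" "a \<noteq> c" "a \<notin> S"
    then have "anc a w" using anc_trans cw by blast
    then show "\<exists>s\<in>S. anc a s \<and> (s < a \<longleftrightarrow> c < a)"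
      using anc_same_side[OF a(1) cw(1) a(2)] a(2,3) w by (metis linorder_neqE_nat order_less_asym)
  qed
  have t: "tendon ?S s = tendon S s" if "s \<in> S" "s \<noteq> w" for s
  proof -
    have "anc w s" if "anc c s" using tendon_anc[OF cl c w \<open>s \<in> S\<close> that] .
    then show ?thesis using that w cw anc_trans unfolding tendon_def by blast
  qed
  have tw: "tendon ?S w = {x\<in>tendon S w. \<not> anc x c}"
    using cw unfolding tendon_def by blast
  have tc: "tendon ?S c = {x\<in>tendon S w. anc x c \<and> x \<noteq> c}"
  proof (intro equalityI subsetI)
    fix x assume x: "x \<in> tendon ?S c"
    then have xc: "anc x c" "x \<noteq> c" by (auto simp: tendon_def)
    have "x \<noteq> w" using xc(1) cw anc_antisym by blast
    moreover have "s = w" if s: "s \<in> S" "anc x s" "anc s w" for s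
    proof -
      have "anc c s \<or> anc s c" using anc_linear cw s by blast
      moreover have "\<not> anc s c" using x s cS unfolding tendon_def by blast
      ultimately show ?thesis using c s unfolding tendon_def by blast
    qed
    ultimately show "x \<in> {x\<in>tendon S w. anc x c \<and> x \<noteq> c}"
      using xc anc_trans[OF xc(1) cw(1)] unfolding tendon_def by blast
  next
    fix x assume x: "x \<in> {x\<in>tendon S w. anc x c \<and> x \<noteq> c}"
    have "s = c" if s: "s \<in> ?S" "anc x s" "anc s c" for s
    proof (rule ccontr)
      assume "s \<noteq> c"
      then have "s = w" using x s anc_trans[OF s(3) cw(1)] unfolding tendon_def by blast
      then show False using s(3) cw anc_antisym by blast
    qed
    then show "x \<in> tendon ?S c" using x unfolding tendon_def by blast
  qed
  define R where "R = tendon S w - {c}"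
  have fR: "finite R" using finite_tendon R_def by simp
  have bot: "tendon ?S w = {} \<and> tendon ?S c = R" if "child c w"
  proof -
    have "anc x c" if "x \<in> tendon S w" for x
      using that anc_parent[OF \<open>child c w\<close> cN] unfolding tendon_def by blast
    then show ?thesis using tw tc unfolding R_def by blast
  qed
  have top: "tendon ?S c = {} \<and> tendon ?S w = R" if "v \<in> S" "child v c" for v
  proof -
    have vN: "v \<in> N" using that S_N[OF hand] by blast
    have vc: "anc v c" "v \<noteq> c" using child_anc[OF that(2) vN cN] by auto
    have e: "tendon ?S c = {}"
      using anc_parent[OF that(2) vN] that(1) vc unfolding tendon_def by blast
    then show ?thesis using tw tc anc_refl[OF cN] unfolding R_def by blast
  qed
  \<comment> \<open>After a pop at the bottom, \<open>c\<close> is the lower end of the remaining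
    tendon; after a pop at the top, this is still \<open>w\<close>.\<close>
  define h where "h = (if child c w then c else w)"
  define k where "k = (if child c w then w else c)"
  have hk: "h = c \<or> h = w" "k = c \<or> k = w" "h \<noteq> k" using cw by (auto simp: h_def k_def)
  have th: "tendon ?S h = R" and tk: "tendon ?S k = {}"
    using bot top ends unfolding h_def k_def by auto
  have S'hk: "s = h \<or> s = k \<or> (s \<in> S \<and> s \<noteq> w)" if "s \<in> ?S" for s using that hk by auto
  have side: "(x < h \<longleftrightarrow> x < w)" if "x \<in> R" for x
  proof (cases "child c w")
    case True
    then have "anc x c" "x \<noteq> c" using that bot tc by auto
    then show ?thesis using True anc_same_side[OF _ cw(1)] by (simp add: h_def)
  qed (simp add: h_def)
  have extreme: "(\<forall>x\<in>tendon S w. anc c x) \<or> (\<forall>x\<in>tendon S w. anc x c)"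
  proof (cases "child c w")
    case True
    then show ?thesis using anc_parent[OF True cN] unfolding tendon_def by blast
  next
    case False
    then have "tendon ?S c = {}" using tk by (simp add: k_def)
    then show ?thesis using tc tendon_linear[OF c] anc_refl[OF cN] by blast
  qed
  obtain T where T: "\<forall>x\<in>N. pr x < T" using ex_bound by blast
  have pw: "p w \<in> tendon S w" using hand_pivot[OF hand w] c by blast
  have pwP: "p w \<in> pivots S p" "p w \<in> ?M"
    using w c pivot_marked[OF hand w] unfolding pivots_def by blast+
  have pS: "pivots S p = p ` {s\<in>S. tendon S s \<noteq> {} \<and> s \<noteq> w} \<union> {p w}"
    using w c unfolding pivots_def by blast
  show ?thesis
  proof (cases "c = p w")
    case False
    have pR: "p w \<in> R" using pw False R_def by auto
    define p' where "p' = p(h := p w)"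
    have piv: "pivots ?S p' = pivots S p"
      unfolding p'_def pS using pivots_insert_tendon[OF w cS hk t tk, of p "p w"] pR th by auto
    have M': "marked ?S p' = ?M \<union> spread {c}"
      unfolding marked_def piv using spread_Un[of "{c}" "S \<union> pivots S p"] by auto
    \<comment> \<open>At the top only \<open>c\<close> itself is new, and it is the outermost key of
      its stack. At the bottom \<open>c\<close> bounds \<open>w\<close> and is marked already; what
      may be new are its bounds, each the deepest remaining tendon key on its side.\<close>
    have key: "y \<in> tendon S w \<and> (\<forall>x\<in>tendon S w - (?M \<union> spread {c}). (x < w \<longleftrightarrow> y < w) \<longrightarrow>
        anc (p w) x \<and> anc (p w) y \<or> anc x (p w) \<and> anc y (p w) \<longrightarrow> pr x < pr y)"
      if y: "y \<in> spread {c}" "y \<notin> ?M" for y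
    proof (cases "child c w")
      case False
      then obtain v where v: "v \<in> S" "child v c" using ends by blast
      have yN: "y \<in> N" using y spread_N by blast
      have "lo c \<notin> N \<or> lo c \<in> ?M" "hi c \<notin> N \<or> hi c \<in> ?M"
        using child_bounds[OF v(2)] lo_marked[OF hand, of v] hi_marked[OF hand, of v] v(1) S_marked[OF hand]
        by (metis insertE singletonD subsetD)+
      then have yc: "y = c" using y unfolding spread_def by auto
      have up: "anc c x" if "x \<in> tendon S w" for x
        using tendon_linear[OF c that] top[OF v] tc that anc_refl[OF cN] by blast
      have "pr x < pr c" if x: "x \<in> tendon S w" "x \<notin> ?M \<union> spread {c}" "x < w \<longleftrightarrow> c < w" "anc x (p w)" for x
      proof (rule hand_above[OF hand w c x(1)])
        show "c \<noteq> x" using x(2) subset_spread[of "{c}"] cN by auto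
      qed (use x up y yc in auto)
      moreover have "\<not> anc (p w) c" using up[OF pw] \<open>c \<noteq> p w\<close> anc_antisym by blast
      ultimately show ?thesis using c yc by blast
    next
      case True
      have hc: "tendon ?S c = R" using bot True by blast
      have pc: "anc (p w) c" using pR hc tc by blast
      have "lo w = c \<or> hi w = c" using child_bounds[OF True] by blast
      then have cM: "c \<in> ?M" using lo_marked[OF hand, of w] hi_marked[OF hand, of w] w cN by metis
      have yN: "y \<in> N" using y spread_N by blast
      have ylh: "y = lo c \<or> y = hi c" using y cM unfolding spread_def by auto
      have yc: "anc y c" "y \<noteq> c" using ylh anc_lo[OF cN] anc_hi[OF cN] yN y(2) cM by auto
      have yp: "y \<noteq> p w" using pwP y by blast
      \<comment> \<open>A bound of \<open>c\<close> above the pivot would bound the pivot too and be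
        marked already.\<close>
      have "\<not> anc y (p w)"
      proof
        assume a: "anc y (p w)"
        then have "lo (p w) = y \<or> hi (p w) = y" using ylh lo_below[OF _ pc] hi_below[OF _ pc] yp by blast
        then show False using lo_marked[OF hand, of "p w"] hi_marked[OF hand, of "p w"] pwP yN y(2) by metis
      qed
      then have py: "anc (p w) y" using anc_linear[OF yc(1) pc] by blast
      have yw: "anc y w" "y \<noteq> w" using anc_trans[OF yc(1) cw(1)] y(2) w S_marked[OF hand] by blast+
      have yt: "y \<in> tendon S w" using tendon_convex[OF pw py yw] .
      have "pr x < pr y" if x: "x \<in> tendon S w" "x \<notin> ?M \<union> spread {c}" "x < w \<longleftrightarrow> y < w" "anc (p w) x" for x
      proof -
        have xy: "x \<noteq> y" using x(2) y(1) by blast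
        have xc: "anc x c" "x \<noteq> c" using x(1,2) cM hc tc R_def by auto
        have sd: "x < c \<longleftrightarrow> y < c"
          using anc_same_side[OF xc(1) cw(1) xc(2)] anc_same_side[OF yc(1) cw(1) yc(2)] x(3) by blast
        have "\<not> anc y x"
        proof
          assume a: "anc y x"
          show False
          proof (cases "x < c")
            case True
            then have "y = lo c" using sd ylh bounds[OF cN] by auto
            then have "x < y" using anc_right[OF xc(1) True] xy by simp
            then show False using anc_left[OF a] ancD[OF xc(1)] sd True by linarith
          next
            case False
            then have f: "c < x" using xc(2) by simp
            then have "y = hi c" using sd ylh bounds[OF cN] by auto
            then have "y < x" using anc_left[OF xc(1) f] xy by simp
            then show False using anc_right[OF a] ancD[OF xc(1)] sd False by linarith
          qed
        qed
        then have "anc x y" using tendon_linear[OF x(1) yt] by blast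
        then show ?thesis using hand_below[OF hand w x(1) yt] x y xy by blast
      qed
      then show ?thesis using yt \<open>\<not> anc y (p w)\<close> by blast
    qed
    have Q: "?M \<union> marked ?S p' \<union> {} = ?M \<union> spread {c}" using M' by auto
    have closed: "top_closed N pr (?M \<union> spread {c})"
    proof (rule top_closed_hand[OF hand])
      show "?M \<union> spread {c} \<subseteq> N" using spread_N unfolding marked_def by blast
    next
      fix y assume "y \<in> ?M \<union> spread {c}" "y \<notin> cover S"
      moreover have "spread {c} \<subseteq> cover S" using spread_cover[of "{c}" S] tendon_cover[OF w] c by blast
      ultimately show "(lo y = 0 \<or> lo y \<in> ?M \<union> spread {c}) \<and> (hi y = n + 1 \<or> hi y \<in> ?M \<union> spread {c})"
        using marked_cover[OF hand] by blast
    qed (use key w in blast)+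
    have "card (?M \<union> spread {c} - ?M) \<le> card (spread {c})"
      using finite_subset[OF spread_N] by (intro card_mono) auto
    also have "\<dots> \<le> 3" using card_spread_le[of "{c}"] by simp
    finally have card: "card (?M \<union> spread {c} - ?M) \<le> 3" .
    have pot: "potential ?S p' \<le> potential S p + 1"
      using potential_insert_tendon[OF w fS cS hk t tk, of p "p w"]
        imbalance_remove[OF finite_tendon, of S w c "p w"] th unfolding p'_def R_def by simp
    show ?thesis
    proof (rule step_raise[OF hand S', where T = T and R = "{}" and p' = p' and q = 0])
      fix s assume "s \<in> ?S" "tendon ?S s \<noteq> {}"
      then show "p' s \<in> tendon ?S s"
        using S'hk[of s] t[of s] th tk pR hand_pivot[OF hand, of s] cS hk unfolding p'_def by auto
    next
      fix s x y
      assume a: "s \<in> ?S" "x \<in> tendon ?S s" "y \<in> tendon ?S s" "x \<notin> marked ?S p'" "y \<notin> marked ?S p'"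
        "x \<noteq> y" "anc x y" "x < s \<longleftrightarrow> y < s"
      have nM: "x \<notin> ?M" "y \<notin> ?M" using a M' by auto
      have "(anc (p' s) x \<longrightarrow> pr x < pr y) \<and> (anc y (p' s) \<longrightarrow> pr y < pr x)"
      proof (cases "s = h")
        case True
        then have xy: "x \<in> R" "y \<in> R" using a th by auto
        then have "x \<in> tendon S w" "y \<in> tendon S w" "x < w \<longleftrightarrow> y < w"
          using a(8) True side unfolding R_def by auto
        then show ?thesis
          using hand_below[OF hand w] hand_above[OF hand w] a nM True unfolding p'_def by simp
      next
        case False
        then have s: "s \<in> S" "s \<noteq> w" using S'hk[OF a(1)] a(2) tk by auto
        then show ?thesis
          using hand_below[OF hand s(1)] hand_above[OF hand s(1)] a nM t[OF s] False unfolding p'_def by simp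
      qed
      then show "(anc (p' s) x \<longrightarrow> raise pr T (marked ?S p') {} 0 x < raise pr T (marked ?S p') {} 0 y) \<and>
        (anc y (p' s) \<longrightarrow> raise pr T (marked ?S p') {} 0 y < raise pr T (marked ?S p') {} 0 x)"
        using a(4,5) by (simp add: raise_idle)
    qed (use T closed pot card cov in \<open>auto simp only: Q\<close>)
  next
    case True
    \<comment> \<open>For empty \<open>R\<close> any value does: the imbalance is 0 and
      \<open>q\<close> does not become a pivot.\<close>
    obtain q where q: "R \<noteq> {} \<Longrightarrow> q \<in> R" "imbalance R q \<le> 1"
      using ex_middle[of R] chain_subset[OF chain_tendon, of R S w] unfolding R_def
      by (metis Diff_subset imbalance_empty le0 order_trans zero_le_one)
    define p' where "p' = p(h := q)"
    have piv: "pivots ?S p' = p ` {s\<in>S. tendon S s \<noteq> {} \<and> s \<noteq> w} \<union> (if R = {} then {} else {q})"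
      unfolding p'_def using pivots_insert_tendon[OF w cS hk t tk, of p q] th by simp
    have "S \<union> pivots S p \<subseteq> insert c S \<union> pivots ?S p'" unfolding piv pS using True by blast
    then have sub1: "?M \<subseteq> marked ?S p'" unfolding marked_def by (rule spread_mono)
    define X where "X = (if R = {} then {} else {q})"
    have "insert c S \<union> pivots ?S p' \<subseteq> S \<union> pivots S p \<union> X"
      unfolding piv pS X_def using True by auto
    then have "marked ?S p' \<subseteq> spread (S \<union> pivots S p \<union> X)"
      unfolding marked_def by (rule spread_mono)
    also have "\<dots> = ?M \<union> spread X" unfolding marked_def by (rule spread_Un)
    also have "spread X = (if R = {} then {} else spread {q})" by (simp add: X_def spread_def)
    finally have sub2: "marked ?S p' \<subseteq> ?M \<union> (if R = {} then {} else spread {q})" .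
    let ?Q = "?M \<union> marked ?S p' \<union> R"
    have Rt: "R \<subseteq> tendon S w" by (auto simp: R_def)
    have qN: "q \<in> tendon S w" if "R \<noteq> {}" using q(1)[OF that] Rt by blast
    \<comment> \<open>A bound of the new pivot that lies above the tendon would also bound a member
      of \<open>S\<close> in between, and so be marked already.\<close>
    have key: "y \<in> tendon S w" if y: "y \<in> ?Q" "y \<notin> ?M" for y
    proof (cases "y \<in> R")
      case False
      then have ne: "R \<noteq> {}" and ys: "y \<in> spread {q}" using y sub2 by (auto split: if_splits)
      have qt: "q \<in> tendon S w" using qN[OF ne] .
      have qN': "q \<in> N" using qt tendon_N by blast
      have qw: "anc q w" using qt by (auto simp: tendon_def)
      have yN: "y \<in> N" using ys spread_N by blast
      have ylh: "y = lo q \<or> y = hi q" using ys q(1)[OF ne] False unfolding spread_def by auto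
      have yq: "anc y q" using ylh anc_lo[OF qN'] anc_hi[OF qN'] yN by auto
      have yw: "anc y w" "y \<noteq> w" using anc_trans[OF yq qw] y(2) w S_marked[OF hand] by blast+
      have "s = w" if s: "s \<in> S" "anc y s" "anc s w" for s
      proof (rule ccontr)
        assume "s \<noteq> w"
        moreover have "anc q s \<or> anc s q" using anc_linear[OF qw s(3)] .
        ultimately have sq: "anc s q" using qt s unfolding tendon_def by blast
        have "y \<noteq> s" using y(2) s(1) S_marked[OF hand] by blast
        then have "lo s = y \<or> hi s = y" using ylh lo_below[OF _ sq] hi_below[OF _ sq] s(2) by blast
        then show False using lo_marked[OF hand, of s] hi_marked[OF hand, of s] s(1) yN y(2) by metis
      qed
      then show ?thesis using yw unfolding tendon_def by blast
    qed (use Rt in blast)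
    have tQ: "tendon S w - ?Q = {}" using pwP True unfolding R_def by auto
    have Qc: "?Q \<subseteq> cover S" using key tendon_cover[OF w] marked_cover[OF hand] by blast
    have closed: "top_closed N pr ?Q"
    proof (rule top_closed_hand[OF hand])
      fix y assume "y \<in> ?Q" "y \<in> cover S" "y \<notin> ?M"
      then show "\<exists>s\<in>S. y \<in> tendon S s \<and> (\<forall>x\<in>tendon S s - ?Q. (x < s \<longleftrightarrow> y < s) \<longrightarrow>
        anc (p s) x \<and> anc (p s) y \<or> anc x (p s) \<and> anc y (p s) \<longrightarrow> pr x < pr y)"
        using key w tQ by blast
    qed (use Qc cover_N in blast)+
    have "?Q - ?M \<subseteq> R \<union> spread {q}" using sub2 by (auto split: if_splits)
    then have "card (?Q - ?M) \<le> card (R \<union> spread {q})"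
      using fR finite_subset[OF spread_N] by (intro card_mono) auto
    also have "\<dots> \<le> card R + 3"
      using card_Un_le[of R "spread {q}"] card_spread_le[of "{q}"] by simp
    finally have card: "card (?Q - ?M) \<le> card R + 3" .
    \<comment> \<open>The released imbalance pays exactly for touching \<open>R\<close>. The new
      pivot with its bounds and the new imbalance of at most 1 use up the allowance 4.\<close>
    have im: "imbalance (tendon S w) (p w) = card R"
      using imbalance_extreme[OF extreme] True unfolding R_def by simp
    have pot: "potential ?S p' + card R \<le> potential S p + 1"
      using potential_insert_tendon[OF w fS cS hk t tk, of p q] th q(2) im unfolding p'_def by simp
    show ?thesis
    proof (rule step_raise[OF hand S', where T = T and R = R and p' = p' and q = q])
      fix s assume "s \<in> ?S" "tendon ?S s \<noteq> {}"
      then show "p' s \<in> tendon ?S s"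
        using S'hk[of s] t[of s] th tk q(1) hand_pivot[OF hand, of s] cS hk unfolding p'_def by auto
    next
      fix s x y
      assume a: "s \<in> ?S" "x \<in> tendon ?S s" "y \<in> tendon ?S s" "x \<notin> marked ?S p'" "y \<notin> marked ?S p'"
        "x \<noteq> y" "anc x y" "x < s \<longleftrightarrow> y < s"
      have nM: "x \<notin> ?M" "y \<notin> ?M" using a sub1 by auto
      show "(anc (p' s) x \<longrightarrow> raise pr T (marked ?S p') R q x < raise pr T (marked ?S p') R q y) \<and>
        (anc y (p' s) \<longrightarrow> raise pr T (marked ?S p') R q y < raise pr T (marked ?S p') R q x)"
      proof (cases "s = h")
        case True
        then have xy: "x \<in> R" "y \<in> R" using a th by auto
        have p'h: "p' s = q" using True by (simp add: p'_def)
        have d: "dep x < dep y" using dep_less a by blast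
        have "dep q \<le> dep x" if "anc q x" using dep_less[OF that] by (cases "q = x") auto
        moreover have "dep y \<le> dep q" if "anc y q" using dep_less[OF that] by (cases "q = y") auto
        ultimately show ?thesis using xy a(4,5) d p'h unfolding raise_def by auto
      next
        case False
        then have s: "s \<in> S" "s \<noteq> w" using S'hk[OF a(1)] a(2) tk by auto
        have xy: "x \<in> tendon S s" "y \<in> tendon S s" using a t[OF s] by auto
        have "x \<notin> R" "y \<notin> R" using xy Rt tendon_disjoint[OF cl _ _ s(1) w] s(2) by blast+
        then show ?thesis
          using hand_below[OF hand s(1) xy] hand_above[OF hand s(1) xy] a nM False
          unfolding p'_def by (simp add: raise_idle)
      qed
    qed (use T closed pot card cov Rt tendon_cover[OF w] in auto)
  qed
qed

end

context interval_tree
begin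

lemma potential_delete:
  assumes "finite S" "v \<in> S" "w \<in> S" "w \<noteq> v"
    and t: "\<And>s. s \<in> S \<Longrightarrow> s \<noteq> v \<Longrightarrow> s \<noteq> w \<Longrightarrow> tendon (S - {v}) s = tendon S s"
  shows "potential (S - {v}) (p(w := q)) + imbalance (tendon S w) (p w) + imbalance (tendon S v) (p v) =
    potential S p + imbalance (tendon (S - {v}) w) q"
proof -
  let ?f = "\<lambda>s. imbalance (tendon S s) (p s)"
  let ?g = "\<lambda>s. imbalance (tendon (S - {v}) s) ((p(w := q)) s)"
  have "potential S p = ?f v + (?f w + sum ?f (S - {v} - {w}))"
    unfolding potential_def using sum.remove[OF assms(1,2), of ?f] sum.remove[of "S - {v}" w ?f] assms(1,3,4) by simp
  moreover have "potential (S - {v}) (p(w := q)) = ?g w + sum ?g (S - {v} - {w})"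
    unfolding potential_def using sum.remove[of "S - {v}" w ?g] assms(1,3,4) by simp
  moreover have "sum ?g (S - {v} - {w}) = sum ?f (S - {v} - {w})"
    using t by (intro sum.cong) auto
  ultimately show ?thesis by simp
qed

lemma top_closed_marked: "hand S p pr \<Longrightarrow> top_closed N pr (marked S p)"
  using hand_marked unfolding top_closed_def by blast

text \<open>Nothing outside the old marked set is touched. Either \<open>v\<close> is a lowest
  member and leaves the cover, or it is pushed onto the end of a tendon. In the latter case keys
  that lose their mark had larger priority than all unmarked keys, as the outer end of a stack
  requires.\<close>

lemma step_delete:
  assumes hand: "hand S p pr" and v: "v \<in> S" "v \<noteq> root" and c: "c \<in> S" "child v c \<or> child c v"
    and nb: "\<not> ((\<exists>s\<in>S. lo v < s \<and> s < v) \<and> (\<exists>s\<in>S. v < s \<and> s < hi v))"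
  shows "\<exists>Q p' pr'. step S p pr Q (S - {v}) p' pr'"
proof -
  let ?S = "S - {v}" and ?M = "marked S p"
  note cl = hand_closed[OF hand]
  have fS: "finite S" using S_N[OF hand] finite_subset by blast
  have vN: "v \<in> N" and cN: "c \<in> N" using v c S_N[OF hand] by blast+
  have cv: "c \<noteq> v" using c(2) child_anc vN cN by blast
  have cl': "branch_closed ?S"
    using cl nb v(2) unfolding branch_closed_def by (metis DiffD1 DiffI insert_Diff insert_iff subset_insertI2 Diff_subset order_trans singletonD)
  obtain T where T: "\<forall>x\<in>N. pr x < T" using ex_bound by blast
  have vM: "v \<in> ?M" using v S_marked[OF hand] by blast
  show ?thesis
  proof (cases "\<exists>s\<in>?S. anc v s")
    case False
    have cp: "child c v" using c False child_anc[OF _ vN cN] cv by blast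
    have up: "anc x c" if "anc x v" "x \<noteq> v" for x using anc_parent[OF cp cN] that by blast
    have cov: "x = v" if "x \<in> cover S" "x \<notin> cover ?S" for x
    proof (rule ccontr)
      assume "x \<noteq> v"
      moreover have "anc x v" using that unfolding cover_def by blast
      ultimately have "anc x c" using up by blast
      then show False using that(2) c(1) cv unfolding cover_def by blast
    qed
    have t: "tendon ?S s = tendon S s" if "s \<in> ?S" for s
      using False that unfolding tendon_def by blast
    have tv: "tendon S v = {}"
    proof -
      have "c = v" if "x \<in> tendon S v" for x
        using that up child_anc[OF cp cN vN] c(1) unfolding tendon_def by blast
      then show ?thesis using cv by blast
    qed
    have "{s\<in>?S. tendon ?S s \<noteq> {}} = {s\<in>S. tendon S s \<noteq> {}}" using t tv by blast
    then have piv: "pivots ?S p = pivots S p" unfolding pivots_def by simp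
    have M': "?M = marked ?S p \<union> spread {v}"
    proof -
      have "S \<union> pivots S p = (?S \<union> pivots S p) \<union> {v}" using v by blast
      then have "spread (S \<union> pivots S p) = spread ((?S \<union> pivots S p) \<union> {v})" by (rule arg_cong)
      then show ?thesis unfolding marked_def piv spread_Un[of "?S \<union> pivots S p"] .
    qed
    have bd: "(lo v = 0 \<or> lo v \<in> marked ?S p) \<and> (hi v = n + 1 \<or> hi v \<in> marked ?S p)"
    proof -
      have "c \<in> marked ?S p" using c(1) cv cN unfolding marked_def spread_def by blast
      moreover have "lo c \<in> marked ?S p" if "lo c \<in> N"
        unfolding marked_def using c(1) cv that by (intro lo_spread) auto
      moreover have "hi c \<in> marked ?S p" if "hi c \<in> N"
        unfolding marked_def using c(1) cv that by (intro hi_spread) auto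
      ultimately show ?thesis using child_bounds[OF cp] lo_N[OF vN] hi_N[OF vN] by (metis insertE singletonD)
    qed
    then have M'2: "?M = insert v (marked ?S p)"
      using M' vM by (auto simp: spread_def)
    have Q: "?M \<union> marked ?S p \<union> {} = ?M" using M' by blast
    have pot: "potential ?S p \<le> potential S p"
      unfolding potential_def using t fS sum_mono2[OF fS, of ?S "\<lambda>s. imbalance (tendon S s) (p s)"] by simp
    show ?thesis
    proof (rule step_raise[OF hand cl', where T = T and R = "{}" and p' = p and q = 0])
      fix s assume "s \<in> ?S" "tendon ?S s \<noteq> {}"
      then show "p s \<in> tendon ?S s" using t hand_pivot[OF hand] by auto
    next
      fix x assume "x \<in> cover S" "x \<notin> cover ?S"
      then show "(lo x = 0 \<or> lo x \<in> marked ?S p) \<and> (hi x = n + 1 \<or> hi x \<in> marked ?S p)"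
        using cov bd by blast
    next
      fix s x y
      assume a: "s \<in> ?S" "x \<in> tendon ?S s" "y \<in> tendon ?S s" "x \<notin> marked ?S p" "y \<notin> marked ?S p"
        "x \<noteq> y" "anc x y" "x < s \<longleftrightarrow> y < s"
      have xy: "x \<in> tendon S s" "y \<in> tendon S s" and s: "s \<in> S" using a t by auto
      have "x \<noteq> v" "y \<noteq> v" using tendon_notin xy v by blast+
      then have "x \<notin> ?M" "y \<notin> ?M" using a M'2 by auto
      then show "(anc (p s) x \<longrightarrow> raise pr T (marked ?S p) {} 0 x < raise pr T (marked ?S p) {} 0 y) \<and>
        (anc y (p s) \<longrightarrow> raise pr T (marked ?S p) {} 0 y < raise pr T (marked ?S p) {} 0 x)"
        using hand_below[OF hand s xy] hand_above[OF hand s xy] a by (simp add: raise_idle)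
    qed (use T pot top_closed_marked[OF hand] in \<open>auto simp only: Q Diff_cancel card.empty\<close>)
  next
    case True
    then obtain s0 where s0: "s0 \<in> ?S" "anc v s0" by blast
    have vc': "v \<in> cover ?S" using s0 unfolding cover_def by blast
    have cov: "cover S \<subseteq> cover ?S" using s0 anc_trans unfolding cover_def by blast
    obtain w where w: "w \<in> ?S" "v \<in> tendon ?S w" using ex_tendon[OF vc'] by blast
    have wS: "w \<in> S" "w \<noteq> v" using w by auto
    have vw: "anc v w" "v \<noteq> w" using w by (auto simp: tendon_def)
    have tw: "tendon ?S w = insert v (tendon S w \<union> tendon S v)"
    proof (intro equalityI subsetI)
      fix x assume x: "x \<in> tendon ?S w"
      then have xw: "anc x w" "x \<noteq> w" by (auto simp: tendon_def)
      consider "x = v" | "anc x v" "x \<noteq> v" | "anc v x" "x \<noteq> v" using anc_linear[OF xw(1) vw(1)] by blast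
      then show "x \<in> insert v (tendon S w \<union> tendon S v)"
      proof cases
        case 2
        have "s = v" if s: "s \<in> S" "anc x s" "anc s v" for s
        proof (rule ccontr)
          assume "s \<noteq> v"
          then have "s = w" using x s anc_trans[OF s(3) vw(1)] unfolding tendon_def by blast
          then show False using s(3) vw anc_antisym by blast
        qed
        then show ?thesis using 2 unfolding tendon_def by blast
      next
        case 3
        have "s = w" if s: "s \<in> S" "anc x s" "anc s w" for s
        proof -
          have "s \<noteq> v" using 3 s(2) anc_antisym by blast
          then show ?thesis using x s unfolding tendon_def by blast
        qed
        then show ?thesis using xw unfolding tendon_def by blast
      qed simp
    next
      fix x assume "x \<in> insert v (tendon S w \<union> tendon S v)"
      then consider "x = v" | "x \<in> tendon S w" | "x \<in> tendon S v" by blast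
      then show "x \<in> tendon ?S w"
      proof cases
        case 2
        then show ?thesis unfolding tendon_def by blast
      next
        case 3
        then have xv: "anc x v" "x \<noteq> v" by (auto simp: tendon_def)
        have "s = w" if s: "s \<in> ?S" "anc x s" "anc s w" for s
        proof -
          have "\<not> anc s v" using 3 s unfolding tendon_def by blast
          then have "anc v s" using anc_linear[OF vw(1) s(3)] by blast
          then show ?thesis using w(2) s unfolding tendon_def by blast
        qed
        moreover have "x \<noteq> w" using xv(1) vw anc_antisym by blast
        ultimately show ?thesis using anc_trans[OF xv(1) vw(1)] unfolding tendon_def by blast
      qed (use w in simp)
    qed
    have t: "tendon ?S s = tendon S s" if s: "s \<in> S" "s \<noteq> v" "s \<noteq> w" for s
    proof -
      have "\<not> (anc x v \<and> anc v s)" if "x \<in> tendon ?S s" for x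
      proof
        assume a: "anc x v \<and> anc v s"
        have "anc w s" using tendon_anc[OF cl' w(2,1)] s a by blast
        moreover have "anc x w" using a anc_trans vw by blast
        ultimately show False using that w(1) s(3) unfolding tendon_def by blast
      qed
      then show ?thesis unfolding tendon_def by blast
    qed
    have up: "tendon S v = {}" if "child c v"
    proof -
      have "c = v" if "x \<in> tendon S v" for x
        using that anc_parent[OF \<open>child c v\<close> cN, of x] child_anc[OF \<open>child c v\<close> cN vN] c(1)
        unfolding tendon_def by blast
      then show ?thesis using cv by blast
    qed
    have down: "w = c \<and> tendon S w = {}" if ch: "child v c"
    proof -
      have vc: "anc v c" "v \<noteq> c" using child_anc[OF ch vN cN] by auto
      have par: "anc x v" if "anc x c" "x \<noteq> c" for x using anc_parent[OF ch vN] that by blast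
      have "s = c" if "s \<in> ?S" "anc v s" "anc s c" for s
        using par[OF that(3)] that anc_antisym by blast
      then have "v \<in> tendon ?S c" using vc unfolding tendon_def by blast
      then have wc: "w = c" using tendon_disjoint[OF cl' w(2) _ w(1)] c cv by blast
      have "v = c" if "x \<in> tendon S c" for x
        using that par v(1) vc unfolding tendon_def by blast
      then show ?thesis using wc vc by blast
    qed
    define E where "E = tendon S w \<union> tendon S v"
    have fE: "finite E" unfolding E_def using finite_tendon by simp
    \<comment> \<open>Since \<open>v\<close> has a neighbour in the hand, at most one of the two
      tendons meeting at \<open>v\<close> is nonempty. Its pivot is kept; if there is none,
      \<open>v\<close> becomes the pivot.\<close>
    define q where "q = (if tendon S w \<noteq> {} then p w else if tendon S v \<noteq> {} then p v else v)"
    define p' where "p' = p(w := q)"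
    have one: "tendon S w = {} \<or> tendon S v = {}" using up down c(2) by blast
    have pivw: "tendon S w \<noteq> {} \<Longrightarrow> p w \<in> tendon S w" and pivv: "tendon S v \<noteq> {} \<Longrightarrow> p v \<in> tendon S v"
      using hand_pivot[OF hand] wS v by blast+
    have qin: "q \<in> insert v E" using pivw pivv unfolding q_def E_def by auto
    have pvS: "pivots S p = p ` {s\<in>S. tendon S s \<noteq> {} \<and> s \<noteq> v \<and> s \<noteq> w} \<union>
        (if E = {} then {} else {q})"
      using wS(1) v(1) one unfolding pivots_def q_def E_def by auto
    have pv': "pivots ?S p' = p ` {s\<in>S. tendon S s \<noteq> {} \<and> s \<noteq> v \<and> s \<noteq> w} \<union> {q}"
    proof -
      have A: "{s\<in>?S. tendon ?S s \<noteq> {}} = {s\<in>S. tendon S s \<noteq> {} \<and> s \<noteq> v \<and> s \<noteq> w} \<union> {w}"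
        using t tw wS by auto
      have C: "p' ` {s\<in>S. tendon S s \<noteq> {} \<and> s \<noteq> v \<and> s \<noteq> w} = p ` {s\<in>S. tendon S s \<noteq> {} \<and> s \<noteq> v \<and> s \<noteq> w}"
        unfolding p'_def by (intro image_cong) auto
      show ?thesis unfolding pivots_def A image_Un C by (simp add: p'_def)
    qed
    have qE: "q = v" if "E = {}" using that unfolding E_def q_def by auto
    have "?S \<union> pivots ?S p' \<subseteq> S \<union> pivots S p" unfolding pv' pvS using qE v(1) by auto
    then have M1: "marked ?S p' \<subseteq> ?M" unfolding marked_def by (rule spread_mono)
    have "S \<union> pivots S p \<subseteq> (?S \<union> pivots ?S p') \<union> {v}" unfolding pv' pvS by auto
    then have "?M \<subseteq> spread ((?S \<union> pivots ?S p') \<union> {v})" unfolding marked_def by (rule spread_mono)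
    then have M2: "?M \<subseteq> marked ?S p' \<union> spread {v}" unfolding marked_def by (simp only: spread_Un)
    have inM': "a \<in> marked ?S p'" if "a \<in> ?S \<or> a = q" for a
      using that qin pv' cl' tendon_N vN unfolding marked_def spread_def branch_closed_def E_def by blast
    have loM': "lo a \<in> marked ?S p'" if "a \<in> ?S \<or> a = q" "lo a \<in> N" for a
      unfolding marked_def using that pv' by (intro lo_spread) auto
    have hiM': "hi a \<in> marked ?S p'" if "a \<in> ?S \<or> a = q" "hi a \<in> N" for a
      unfolding marked_def using that pv' by (intro hi_spread) auto
    have cM': "c \<in> marked ?S p'" using inM' c cv by blast
    have Q: "?M \<union> marked ?S p' \<union> {} = ?M" using M1 by blast
    \<comment> \<open>If \<open>c\<close> is the parent, \<open>v\<close> is the new top of the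
      tendon and the only key that can lose its mark. If \<open>c\<close> is the child,
      \<open>v\<close> stays marked as a bound of \<open>c\<close>, and only the bounds of
      \<open>v\<close> can lose theirs.\<close>
    have gw: "(anc q x \<longrightarrow> pr x < pr y) \<and> (anc y q \<longrightarrow> pr y < pr x)"
      if a: "x \<in> tendon ?S w" "y \<in> tendon ?S w" "x \<notin> marked ?S p'" "y \<notin> marked ?S p'"
        "x \<noteq> y" "anc x y" "x < w \<longleftrightarrow> y < w" for x y
    proof (cases "child c v")
      case ch: True
      have tv: "tendon S v = {}" using up[OF ch] .
      have "lo v = 0 \<or> lo v \<in> marked ?S p'" "hi v = n + 1 \<or> hi v \<in> marked ?S p'"
        using child_bounds[OF ch] lo_N[OF vN] hi_N[OF vN] cM' loM'[of c] hiM'[of c] c(1) cv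
        by (metis DiffI insertE singletonD)+
      then have sv: "spread {v} \<subseteq> insert v (marked ?S p')" unfolding spread_def by auto
      have xy: "x \<in> insert v (tendon S w)" "y \<in> insert v (tendon S w)" using a(1,2) tw tv by auto
      have vtop: "anc v z" if "z \<in> tendon S w" for z
      proof -
        have z: "anc z w" using that by (auto simp: tendon_def)
        have "\<not> anc z v" using that v(1) vw unfolding tendon_def by blast
        then show ?thesis using anc_linear[OF z vw(1)] by blast
      qed
      have vt: "v \<notin> tendon S w" using tendon_notin v by blast
      have ne: "tendon S w \<noteq> {}" using xy a(5) by auto
      then have q: "q = p w" by (simp add: q_def)
      have yv: "y \<noteq> v"
      proof
        assume "y = v"
        then show False using xy a(5,6) vtop anc_antisym by blast
      qed
      then have y: "y \<in> tendon S w" "y \<notin> ?M" using xy M2 sv a(4) by auto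
      show ?thesis
      proof (cases "x = v")
        case True
        have "\<not> anc q v" using vtop[OF pivw[OF ne]] pivw[OF ne] vt q anc_antisym by metis
        moreover have "pr y < pr v" using hand_marked[OF hand _ y(2) vM] y(1) tendon_N by blast
        ultimately show ?thesis using True by blast
      next
        case False
        then have "x \<in> tendon S w" "x \<notin> ?M" using xy M2 sv a(3) by auto
        then show ?thesis
          using hand_below[OF hand wS(1)] hand_above[OF hand wS(1)] y a(5-7) unfolding q by blast
      qed
    next
      case False
      then have ch: "child v c" using c(2) by blast
      have wc: "w = c" and te: "tendon S w = {}" using down[OF ch] by auto
      have "lo c = v \<or> hi c = v" using child_bounds[OF ch] by blast
      then have vM': "v \<in> marked ?S p'" using loM'[of c] hiM'[of c] c(1) cv vN by blast
      have xy: "x \<in> tendon S v" "y \<in> tendon S v" using a(1-4) tw te vM' by auto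
      have q: "q = p v" using te xy by (auto simp: q_def)
      have pv: "p v \<in> tendon S v" using pivv xy by blast
      have pvv: "anc (p v) v" using pv by (auto simp: tendon_def)
      have xv: "anc x v" "x \<noteq> v" and yv: "anc y v" "y \<noteq> v" using xy by (auto simp: tendon_def)
      have side: "x < v \<longleftrightarrow> y < v"
        using anc_same_side[OF xv(1) vw(1) xv(2)] anc_same_side[OF yv(1) vw(1) yv(2)] a(7) by blast
      \<comment> \<open>A bound of \<open>v\<close> that loses its mark is the deepest key on its
        side. It also lies below the pivot, for otherwise it would bound the pivot and stay
        marked.\<close>
      have low: "anc u z \<and> anc (p v) z" if u: "u \<in> tendon S v" "u < v \<longleftrightarrow> z < v"
        and z: "z \<in> tendon S v" "z \<notin> marked ?S p'" "z \<in> ?M" for u z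
      proof -
        have zv: "anc z v" "z \<noteq> v" and uv: "anc u v" "u \<noteq> v" using z(1) u(1) by (auto simp: tendon_def)
        have zN: "z \<in> N" using zv ancD by blast
        have zlh: "z = lo v \<or> z = hi v" using z M2 zv(2) unfolding spread_def by auto
        have "anc u z"
        proof (cases "u = z")
          case False
          have "\<not> anc z u"
          proof
            assume zu: "anc z u"
            show False
            proof (cases "u < v")
              case True
              then have "z = lo v" using u(2) zlh bounds[OF vN] by auto
              then have "u < z" using anc_right[OF uv(1) True] False by simp
              then show False using anc_left[OF zu] ancD[OF uv(1)] u(2) True by linarith
            next
              case F: False
              then have f: "v < u" using uv(2) by simp
              then have "z = hi v" using u(2) zlh bounds[OF vN] by auto
              then have "z < u" using anc_left[OF uv(1) f] False by simp
              then show False using anc_right[OF zu] ancD[OF uv(1)] u(2) F by linarith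
            qed
          qed
          then show ?thesis using anc_linear[OF uv(1) zv(1)] by blast
        qed (use anc_refl zN in simp)
        moreover have "anc (p v) z"
        proof (rule ccontr)
          assume "\<not> anc (p v) z"
          then have zp: "anc z (p v)" using anc_linear[OF zv(1) pvv] by blast
          have "z \<noteq> p v" using z(2) inM'[of q] q by blast
          then have "lo (p v) = z \<or> hi (p v) = z" using zlh zp lo_below[OF _ pvv] hi_below[OF _ pvv] by blast
          then show False using loM'[of q] hiM'[of q] q zN z(2) by metis
        qed
        ultimately show ?thesis by blast
      qed
      have xM: "x \<notin> ?M"
      proof
        assume "x \<in> ?M"
        then have "anc y x" using low[OF xy(2) _ xy(1) a(3)] side by blast
        then show False using a(5,6) anc_antisym by blast
      qed
      show ?thesis
      proof (cases "y \<in> ?M")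
        case True
        have "pr x < pr y" using hand_marked[OF hand _ xM True] xv(1) ancD by blast
        moreover have "anc (p v) y" using low[OF xy(1) _ xy(2) a(4) True] side by blast
        moreover have "y \<noteq> p v" using a(4) inM'[of q] q by blast
        ultimately show ?thesis using q anc_antisym by blast
      next
        case False
        then show ?thesis
          using hand_below[OF hand v(1) xy xM] hand_above[OF hand v(1) xy xM] a(5,6) side unfolding q by blast
      qed
    qed
    \<comment> \<open>In other tendons no mark is lost: a bound of \<open>v\<close> in the tendon of
      \<open>s\<close> also bounds \<open>s\<close>, which stays in the hand.\<close>
    have out: "x \<notin> ?M" if s: "s \<in> S" "s \<noteq> v" "s \<noteq> w" and x: "x \<in> tendon S s" "x \<notin> marked ?S p'" for s x
    proof
      assume "x \<in> ?M"
      then have "x \<in> spread {v}" using M2 x by blast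
      moreover have "x \<noteq> v" using tendon_notin[OF x(1)] v(1) by blast
      ultimately have xlh: "x = lo v \<or> x = hi v" and xN: "x \<in> N" unfolding spread_def by auto
      then have xv: "anc x v" using anc_lo[OF vN] anc_hi[OF vN] by auto
      have sv: "anc s v" using tendon_anc[OF cl x(1) s(1) v(1) xv] .
      have xs: "anc x s" "x \<noteq> s" using x(1) by (auto simp: tendon_def)
      have "lo s = x \<or> hi s = x" using xlh xs lo_below[OF _ sv] hi_below[OF _ sv] by blast
      then show False using loM'[of s] hiM'[of s] s xN x(2) by blast
    qed
    have pot: "potential ?S p' \<le> potential S p + 1"
    proof -
      have "imbalance (tendon ?S w) q \<le> Suc (imbalance (tendon S w) (p w) + imbalance (tendon S v) (p v))"
        using imbalance_insert[OF fE, of v q] one unfolding tw E_def q_def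
        by (auto simp: imbalance_def split: if_splits)
      then show ?thesis
        using potential_delete[OF fS v(1) wS t, of p q] unfolding p'_def by simp
    qed
    show ?thesis
    proof (rule step_raise[OF hand cl', where T = T and R = "{}" and p' = p' and q = 0])
      fix s assume s: "s \<in> ?S" "tendon ?S s \<noteq> {}"
      show "p' s \<in> tendon ?S s"
      proof (cases "s = w")
        case True
        then show ?thesis using qin tw unfolding E_def p'_def by simp
      next
        case False
        then show ?thesis using s t[of s] hand_pivot[OF hand, of s] unfolding p'_def by simp
      qed
    next
      fix s x y
      assume a: "s \<in> ?S" "x \<in> tendon ?S s" "y \<in> tendon ?S s" "x \<notin> marked ?S p'" "y \<notin> marked ?S p'"
        "x \<noteq> y" "anc x y" "x < s \<longleftrightarrow> y < s"
      have "(anc (p' s) x \<longrightarrow> pr x < pr y) \<and> (anc y (p' s) \<longrightarrow> pr y < pr x)"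
      proof (cases "s = w")
        case True
        then show ?thesis using gw[of x y] a unfolding p'_def by simp
      next
        case False
        then have s: "s \<in> S" "s \<noteq> v" "s \<noteq> w" using a(1) by auto
        have xy: "x \<in> tendon S s" "y \<in> tendon S s" using a t[OF s] by auto
        show ?thesis
          using hand_below[OF hand s(1) xy] hand_above[OF hand s(1) xy] a
            out[OF s xy(1) a(4)] out[OF s xy(2) a(5)] False unfolding p'_def by simp
      qed
      then show "(anc (p' s) x \<longrightarrow> raise pr T (marked ?S p') {} 0 x < raise pr T (marked ?S p') {} 0 y) \<and>
        (anc y (p' s) \<longrightarrow> raise pr T (marked ?S p') {} 0 y < raise pr T (marked ?S p') {} 0 x)"
        using a(4,5) by (simp add: raise_idle)
    qed (use T cov pot top_closed_marked[OF hand] in \<open>auto simp only: Q Diff_cancel card.empty\<close>)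
  qed
qed

end

section \<open>Finger moves as changes of the hand\<close>

context interval_tree
begin

definition branches :: "nat set \<Rightarrow> nat \<Rightarrow> bool" where
  "branches S s \<longleftrightarrow> (\<exists>l\<in>S. lo s < l \<and> l < s) \<and> (\<exists>r\<in>S. s < r \<and> r < hi s)"

definition fingers :: "nat \<Rightarrow> (nat \<Rightarrow> nat) \<Rightarrow> nat set" where
  "fingers k \<phi> = insert root (\<phi> ` {..<k})"

text \<open>The last condition keeps the hand small: a member that is not a finger has to branch,
  which bounds their number by the number of fingers.\<close>

definition serving :: "nat \<Rightarrow> (nat \<Rightarrow> nat) \<Rightarrow> nat set \<Rightarrow> (nat \<Rightarrow> nat) \<Rightarrow> (nat \<Rightarrow> nat) \<Rightarrow> bool" where
  "serving k \<phi> S p pr \<longleftrightarrow> hand S p pr \<and> fingers k \<phi> \<subseteq> S \<and> (\<forall>s\<in>S - fingers k \<phi>. branches S s)"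

definition adjacent :: "nat \<Rightarrow> nat \<Rightarrow> bool" where
  "adjacent a b \<longleftrightarrow> a \<in> N \<and> b \<in> N \<and> (child a b \<or> child b a)"

lemma advance_refl: "hand S p pr \<Longrightarrow>
  advance N C pr (marked S p) (potential S p) (marked S p) w pr (marked S p) (potential S p)"
  using top_closed_marked[of S p pr] hand_marked[of S p pr] spread_N
  unfolding advance_def touch_def marked_def by auto

lemma step_insert:
  assumes hand: "hand S p pr" and v: "v \<in> S" "adjacent v c"
  shows "\<exists>Q p' pr'. step S p pr Q (insert c S) p' pr'"
proof -
  have N: "v \<in> N" "c \<in> N" and ch: "child v c \<or> child c v" using v unfolding adjacent_def by auto
  consider "c \<in> S" | "c \<notin> cover S" | "c \<in> cover S" "c \<notin> S" by blast
  then show ?thesis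
  proof cases
    case 1
    then have "step S p pr (marked S p) (insert c S) p pr"
      using advance_refl[OF hand] hand unfolding step_def by (simp add: insert_absorb)
    then show ?thesis by blast
  next
    case 2
    have "child v c" using ch child_anc[OF _ N(2,1)] v(1) 2 unfolding cover_def by blast
    then show ?thesis using step_insert_fresh[OF hand v(1) _ N(2) 2] by blast
  next
    case 3
    then obtain w where w: "w \<in> S" "c \<in> tendon S w" using ex_tendon by blast
    \<comment> \<open>For a move upwards, the tendon containing \<open>c\<close> must be that of
      \<open>v\<close> itself, and \<open>c\<close> is its lowest key.\<close>
    have "child c w" if cv: "child c v"
    proof -
      have a: "anc c v" "c \<noteq> v" using child_anc[OF cv N(2,1)] by auto
      have wv: "anc w v" using tendon_anc[OF hand_closed[OF hand] w(2,1) v(1) a(1)] .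
      have "w = v"
      proof (rule ccontr)
        assume "w \<noteq> v"
        then have "anc w c" using anc_parent[OF cv N(2) wv] by blast
        then show False using w(2) anc_antisym unfolding tendon_def by blast
      qed
      then show ?thesis using cv by simp
    qed
    then show ?thesis using step_insert_tendon[OF hand w] ch v(1) by blast
  qed
qed

text \<open>The new position enters before the old one leaves, so each change has a neighbour in the
  hand. The old position stays if it is the root, another finger rests there, or it branches. The
  weight 2 counts the two changes.\<close>

lemma move_finger:
  assumes st: "serving k \<phi> S p pr" and f: "f < k" and adj: "adjacent (\<phi> f) c"
  shows "\<exists>Q S' p' pr'. serving k (\<phi>(f := c)) S' p' pr' \<and>
    advance N 4 pr (marked S p) (potential S p) Q 2 pr' (marked S' p') (potential S' p')"
proof -
  define v where "v = \<phi> f"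
  let ?S = "insert c S" and ?G = "fingers k \<phi>" and ?G' = "fingers k (\<phi>(f := c))"
  have hand: "hand S p pr" and GS: "?G \<subseteq> S" and br: "\<forall>s\<in>S - ?G. branches S s"
    using st unfolding serving_def by auto
  have vS: "v \<in> S" using GS f unfolding fingers_def v_def by auto
  have N: "v \<in> N" "c \<in> N" and ch: "child v c \<or> child c v"
    using adj unfolding adjacent_def v_def by auto
  have vc: "v \<noteq> c" using ch child_anc N by blast
  have G1: "?G' \<subseteq> insert c ?G" unfolding fingers_def by auto
  have G2: "?G \<subseteq> insert v ?G'"
  proof
    fix x assume "x \<in> ?G"
    then consider "x = root" | j where "j < k" "x = \<phi> j" unfolding fingers_def by auto
    then show "x \<in> insert v ?G'"
    proof cases
      case 2
      then show ?thesis unfolding fingers_def v_def by (cases "j = f") (auto intro!: rev_image_eqI[of j])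
    qed (simp add: fingers_def)
  qed
  have cG: "c \<in> ?G'" using f unfolding fingers_def by auto
  obtain Q1 p1 pr1 where 1: "step S p pr Q1 ?S p1 pr1"
    using step_insert[OF hand vS] adj unfolding v_def by blast
  then have hand1: "hand ?S p1 pr1" and adv1: "advance N 4 pr (marked S p) (potential S p) Q1 1 pr1
      (marked ?S p1) (potential ?S p1)" unfolding step_def by auto
  have Nf: "finite N" by simp
  show ?thesis
  proof (cases "v \<in> ?G' \<or> branches ?S v")
    case True
    have "branches ?S s" if "s \<in> ?S - ?G'" for s
    proof (cases "s = v")
      case False
      then have "s \<in> S - ?G" using that cG G2 by blast
      then show ?thesis using br unfolding branches_def by blast
    qed (use True that in blast)
    then have "serving k (\<phi>(f := c)) ?S p1 pr1"
      using hand1 G1 GS unfolding serving_def by blast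
    moreover have "advance N 4 pr (marked S p) (potential S p) (Q1 \<union> marked ?S p1) (1 + 1) pr1
      (marked ?S p1) (potential ?S p1)"
      using advance_trans[OF Nf adv1 advance_refl[OF hand1]] .
    ultimately show ?thesis by (metis one_add_one)
  next
    case False
    then have vr: "v \<noteq> root" "v \<notin> ?G'" unfolding fingers_def by auto
    have "c \<in> ?S" "v \<in> ?S" using vS by auto
    then obtain Q2 p2 pr2 where 2: "step ?S p1 pr1 Q2 (?S - {v}) p2 pr2"
      using step_delete[OF hand1 _ vr(1) _ ch] False unfolding branches_def by blast
    then have hand2: "hand (?S - {v}) p2 pr2" and adv2: "advance N 4 pr1 (marked ?S p1) (potential ?S p1)
      Q2 1 pr2 (marked (?S - {v}) p2) (potential (?S - {v}) p2)" unfolding step_def by auto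
    have "branches (?S - {v}) s" if s: "s \<in> ?S - {v} - ?G'" for s
    proof -
      have sS: "s \<in> S" "s \<notin> ?G" "s \<noteq> v" "s \<noteq> c" using s cG G2 by blast+
      have sN: "s \<in> N" using sS S_N[OF hand] by blast
      have b: "branches S s" using br sS by blast
      \<comment> \<open>For a branching member above \<open>v\<close>, the key \<open>c\<close> lies
        on the same side as \<open>v\<close> and replaces it as a witness for branching.\<close>
      have side: "anc s c \<and> (s < c \<longleftrightarrow> s < v)" if "anc s v"
        using ch
      proof
        assume "child v c"
        then have "anc v c" using child_anc N by blast
        then show ?thesis using anc_trans[OF that] anc_same_side[OF that _ sS(3)] sS(3,4) by auto
      next
        assume cv: "child c v"
        have "anc c v" using child_anc[OF cv] N by blast
        moreover have "anc s c" using anc_parent[OF cv N(2) that sS(3)] .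
        ultimately show ?thesis using anc_same_side[of s c v] sS(3,4) by auto
      qed
      have "\<exists>l\<in>?S - {v}. lo s < l \<and> l < s"
      proof -
        obtain l where l: "l \<in> S" "lo s < l" "l < s" using b unfolding branches_def by blast
        show ?thesis
        proof (cases "l = v")
          case True
          then have "anc s v" using l sN N bounds[OF sN] by (auto simp: anc_def)
          then show ?thesis using side l True vc sS(4) by (intro bexI[of _ c]) (auto simp: anc_def)
        qed (use l in blast)
      qed
      moreover have "\<exists>r\<in>?S - {v}. s < r \<and> r < hi s"
      proof -
        obtain r where r: "r \<in> S" "s < r" "r < hi s" using b unfolding branches_def by blast
        show ?thesis
        proof (cases "r = v")
          case True
          then have "anc s v" using r sN N bounds[OF sN] by (auto simp: anc_def)
          then show ?thesis using side r True vc sS(4) by (intro bexI[of _ c]) (auto simp: anc_def)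
        qed (use r in blast)
      qed
      ultimately show ?thesis unfolding branches_def by blast
    qed
    then have "serving k (\<phi>(f := c)) (?S - {v}) p2 pr2"
      using hand2 G1 GS vr(2) unfolding serving_def by blast
    moreover have "advance N 4 pr (marked S p) (potential S p) (Q1 \<union> Q2) (1 + 1) pr2
      (marked (?S - {v}) p2) (potential (?S - {v}) p2)"
      using advance_trans[OF Nf adv1 adv2] .
    ultimately show ?thesis by (metis one_add_one)
  qed
qed

lemma walk_finger:
  assumes "serving k \<phi> S p pr" "f < k" "(adjacent ^^ d) (\<phi> f) x"
  shows "\<exists>Q S' p' pr'. serving k (\<phi>(f := x)) S' p' pr' \<and>
    advance N 4 pr (marked S p) (potential S p) Q (2 * d) pr' (marked S' p') (potential S' p')"
  using assms(3)
proof (induction d arbitrary: x)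
  case 0
  then have "\<phi>(f := x) = \<phi>" by auto
  then show ?case using advance_refl assms(1) unfolding serving_def by fastforce
next
  case (Suc d)
  then obtain y where y: "(adjacent ^^ d) (\<phi> f) y" "adjacent y x" by auto
  obtain Q S' p' pr' where 1: "serving k (\<phi>(f := y)) S' p' pr'"
    "advance N 4 pr (marked S p) (potential S p) Q (2 * d) pr' (marked S' p') (potential S' p')"
    using Suc.IH[OF y(1)] by blast
  obtain Q' S'' p'' pr'' where 2: "serving k (\<phi>(f := y, f := x)) S'' p'' pr''"
    "advance N 4 pr' (marked S' p') (potential S' p') Q' 2 pr'' (marked S'' p'') (potential S'' p'')"
    using move_finger[OF 1(1) assms(2), of x] y(2) by auto
  have "advance N 4 pr (marked S p) (potential S p) (Q \<union> Q') (2 * Suc d) pr'' (marked S'' p'') (potential S'' p'')"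
    using advance_trans[OF _ 1(2) 2(2)] by simp
  moreover have "serving k (\<phi>(f := x)) S'' p'' pr''" using 2(1) by simp
  ultimately show ?case by blast
qed

text \<open>Walking \<open>d\<close> edges takes \<open>2 * d\<close> changes at cost 4, which
  \<open>8 * (1 + d)\<close> covers. Afterwards \<open>x\<close> is a finger position, hence marked
  and touched.\<close>

lemma access_finger:
  assumes "serving k \<phi> S p pr" "f < k" "(adjacent ^^ d) (\<phi> f) x"
  shows "\<exists>Q S' p' pr'. serving k (\<phi>(f := x)) S' p' pr' \<and> x \<in> Q \<and>
    advance N 8 pr (marked S p) (potential S p) Q (1 + d) pr' (marked S' p') (potential S' p')"
proof -
  obtain Q S' p' pr' where 1: "serving k (\<phi>(f := x)) S' p' pr'"
    "advance N 4 pr (marked S p) (potential S p) Q (2 * d) pr' (marked S' p') (potential S' p')"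
    using walk_finger[OF assms] by blast
  have "x \<in> S'" using 1(1) assms(2) unfolding serving_def fingers_def by auto
  then have "x \<in> marked S' p'" using S_marked 1(1) unfolding serving_def by blast
  then have "x \<in> Q" using 1(2) unfolding advance_def by blast
  moreover have "advance N 8 pr (marked S p) (potential S p) Q (1 + d) pr' (marked S' p') (potential S' p')"
    using 1(2) unfolding advance_def by simp
  ultimately show ?thesis using 1(1) by blast
qed

section \<open>Size of the hand and its initial state\<close>

lemma finger_below:
  assumes "\<And>s. s \<in> S - G \<Longrightarrow> branches S s" "S \<subseteq> N" "s \<in> S"
  shows "\<exists>g\<in>G. anc s g"
  using assms(3)
proof (induction "n - dep s" arbitrary: s rule: less_induct)
  case less
  have sN: "s \<in> N" using less.prems assms(2) by blast
  show ?case
  proof (cases "s \<in> G")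
    case False
    then obtain l where l: "l \<in> S" "lo s < l" "l < s" using assms(1) less.prems unfolding branches_def by blast
    then have sl: "anc s l" "s \<noteq> l" using sN assms(2) bounds[OF sN] by (auto simp: anc_def)
    have "n - dep l < n - dep s" using dep_less[OF sl] dep_le[of l] by linarith
    then show ?thesis using less.hyps l(1) anc_trans[OF sl(1)] by blast
  qed (use anc_refl sN in blast)
qed

text \<open>A member witnessing that \<open>s\<close> branches is replaced by a finger below it;
  both lie on the same side of \<open>s\<close>. So branching can be counted with respect to fingers
  only.\<close>

lemma branches_fingers:
  assumes "\<And>s. s \<in> S - G \<Longrightarrow> branches S s" "S \<subseteq> N" "s \<in> N" "branches S s"
  shows "branches G s"
proof -
  have *: "\<exists>g\<in>G. anc s g \<and> (s < l \<longleftrightarrow> s < g) \<and> g \<noteq> s" if l: "l \<in> S" "lo s < l" "l < hi s" "l \<noteq> s" for l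
  proof -
    have sl: "anc s l" using l assms(2,3) by (auto simp: anc_def)
    obtain g where g: "g \<in> G" "anc l g" using finger_below[OF assms(1,2) l(1)] by blast
    have "g \<noteq> s" using sl g(2) l(4) anc_antisym by blast
    then show ?thesis using g anc_trans[OF sl g(2)] anc_same_side[OF sl g(2)] l(4) by blast
  qed
  have b: "lo s < s" "s < hi s" using bounds[OF assms(3)] by auto
  obtain l r where lr: "l \<in> S" "lo s < l" "l < s" "r \<in> S" "s < r" "r < hi s"
    using assms(4) unfolding branches_def by blast
  obtain g where g: "g \<in> G" "anc s g" "s < l \<longleftrightarrow> s < g" "g \<noteq> s" using *[of l] lr b by auto
  obtain g' where g': "g' \<in> G" "anc s g'" "s < r \<longleftrightarrow> s < g'" "g' \<noteq> s" using *[of r] lr b by auto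
  have "lo s < g" "g < s" using g lr by (auto simp: anc_def)
  moreover have "s < g'" "g' < hi s" using g' lr by (auto simp: anc_def)
  ultimately show ?thesis using g(1) g'(1) unfolding branches_def by blast
qed

text \<open>A branching node is determined by the finger preceding it.\<close>

lemma card_branching:
  assumes G: "finite G" and A: "A \<subseteq> N" "A \<inter> G = {}" "\<And>s. s \<in> A \<Longrightarrow> branches G s"
  shows "card A \<le> card G"
proof -
  define m where "m s = Max {g\<in>G. g < s}" for s
  have fin: "finite {g\<in>G. g < s}" for s using G by simp
  have m: "m s \<in> G \<and> lo s < m s \<and> m s < s" if s: "s \<in> A" for s
  proof -
    obtain l where l: "l \<in> G" "lo s < l" "l < s" using A(3)[OF s] unfolding branches_def by blast
    have "m s \<in> {g\<in>G. g < s}" unfolding m_def using l fin by (intro Max_in) auto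
    moreover have "l \<le> m s" unfolding m_def using l fin by (intro Max_ge) auto
    ultimately show ?thesis using l by auto
  qed
  have ne: "m s \<noteq> m s'" if s: "s \<in> A" "s' \<in> A" "s < s'" for s s'
  proof
    assume eq: "m s = m s'"
    obtain r where r: "r \<in> G" "s < r" "r < hi s" using A(3)[OF s(1)] unfolding branches_def by blast
    have "s' < r"
    proof (rule ccontr)
      assume "\<not> s' < r"
      moreover have "r \<noteq> s'" using r(1) s(2) A(2) by blast
      ultimately have "r \<le> m s'" unfolding m_def using r fin by (intro Max_ge) auto
      then show False using eq m[OF s(1)] r(2) by simp
    qed
    moreover have "s \<in> N" "s' \<in> N" using s A(1) by blast+
    ultimately have "s \<le> lo s'" using right_nested[of s s'] s(3) r(3) by linarith
    then show False using m[OF s(1)] m[OF s(2)] eq by simp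
  qed
  have "inj_on m A" using ne unfolding inj_on_def by (metis linorder_neqE_nat)
  then show ?thesis using card_inj_on_le[of m A G] m G by blast
qed

text \<open>With the root there are at most \<open>k + 1 \<le> 2 * k\<close> fingers. Branching
  members at most double this, pivots double it again, and the bounds contribute a factor 3:
  altogether \<open>2 * 2 * 2 * 3 = 24\<close>.\<close>

lemma card_marked:
  assumes st: "serving k \<phi> S p pr" and k: "1 \<le> k"
  shows "card (marked S p) \<le> 24 * k"
proof -
  let ?G = "fingers k \<phi>"
  have hand: "hand S p pr" and GS: "?G \<subseteq> S" and br: "\<And>s. s \<in> S - ?G \<Longrightarrow> branches S s"
    using st unfolding serving_def by auto
  have SN: "S \<subseteq> N" using S_N[OF hand] .
  have fS: "finite S" using SN finite_subset by blast
  have fG: "finite ?G" unfolding fingers_def by simp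
  have "card ?G \<le> Suc (card (\<phi> ` {..<k}))" unfolding fingers_def by (rule card_insert_le_m1) auto
  also have "\<dots> \<le> Suc k" using card_image_le[of "{..<k}" \<phi>] by simp
  finally have cG: "card ?G \<le> 2 * k" using k by simp
  have "card (S - ?G) \<le> card ?G"
    using SN br branches_fingers[OF br SN] by (intro card_branching[OF fG]) auto
  moreover have "card S \<le> card ?G + card (S - ?G)"
    using card_Un_le[of ?G "S - ?G"] GS by (simp add: Un_absorb1)
  ultimately have cS: "card S \<le> 4 * k" using cG by simp
  have "card (pivots S p) \<le> card {s\<in>S. tendon S s \<noteq> {}}" unfolding pivots_def by (intro card_image_le) (use fS in simp)
  also have "\<dots> \<le> card S" using fS by (intro card_mono) auto
  finally have "card (S \<union> pivots S p) \<le> 8 * k" using card_Un_le[of S "pivots S p"] cS by simp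
  moreover have "finite (S \<union> pivots S p)" using fS unfolding pivots_def by simp
  ultimately show ?thesis using card_spread_le[of "S \<union> pivots S p"] unfolding marked_def by linarith
qed

text \<open>Any finger positions can be the start: the fingers are closed under branching and every
  pivot is a middle key. Each tendon then has imbalance at most 1, so the potential is at most the
  number of keys.\<close>

lemma ex_serving:
  assumes "\<phi> ` {..<k} \<subseteq> N"
  shows "\<exists>S p pr. serving k \<phi> S p pr \<and> potential S p \<le> n"
proof -
  define G where "G = fingers k \<phi>"
  define S where "S = G \<union> {a\<in>N. branches G a}"
  have GN: "G \<subseteq> N" using assms root unfolding G_def fingers_def by auto
  have SN: "S \<subseteq> N" using GN unfolding S_def by blast
  have br: "branches S s" if "s \<in> S - G" for s
    using that unfolding S_def branches_def by blast
  have cl: "branch_closed S"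
    unfolding branch_closed_def
  proof (intro conjI ballI impI SN)
    show "root \<in> S" unfolding S_def G_def fingers_def by blast
    fix a assume "a \<in> N" "(\<exists>s\<in>S. lo a < s \<and> s < a) \<and> (\<exists>s\<in>S. a < s \<and> s < hi a)"
    then show "a \<in> S" using branches_fingers[OF br SN, where s = a] unfolding S_def branches_def by blast
  qed
  have "\<forall>s. \<exists>q. (tendon S s \<noteq> {} \<longrightarrow> q \<in> tendon S s) \<and> imbalance (tendon S s) q \<le> 1"
    using ex_middle[OF chain_tendon] by (metis imbalance_empty zero_le)
  then obtain p where p: "\<And>s. tendon S s \<noteq> {} \<Longrightarrow> p s \<in> tendon S s"
    "\<And>s. imbalance (tendon S s) (p s) \<le> 1" by metis
  let ?M = "marked S p"
  define own where "own x = (SOME s. s \<in> S \<and> x \<in> tendon S s)" for x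
  have own: "own x = s" if "s \<in> S" "x \<in> tendon S s" for s x
    using someI[of "\<lambda>s. s \<in> S \<and> x \<in> tendon S s" s] tendon_disjoint[OF cl] that unfolding own_def by blast
  \<comment> \<open>Three layers: fresh keys by decreasing depth up to \<open>n\<close>, unmarked
    covered keys by distance from their pivot, marked keys on top. Each truncated difference is at
    most \<open>n\<close>, so the middle layer ends at \<open>3 * n + 1\<close> or below.\<close>
  define pr where "pr x = (if x \<in> ?M then 3 * n + 3
    else if x \<in> cover S then n + 1 + (dep x - dep (p (own x))) + (dep (p (own x)) - dep x)
    else n - dep x)" for x
  have prM: "pr x = 3 * n + 3" if "x \<in> ?M" for x using that by (simp add: pr_def)
  have prH: "n < pr x" if "x \<in> cover S" for x using that by (auto simp: pr_def)
  have prn: "pr x < 3 * n + 3" if "x \<notin> ?M" for x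
    using that dep_le[of x] dep_le[of "p (own x)"] by (auto simp: pr_def)
  have Mc: "?M \<subseteq> cover S"
  proof -
    have "pivots S p \<subseteq> cover S" using p(1) tendon_cover unfolding pivots_def by blast
    then show ?thesis unfolding marked_def using spread_cover[of "S \<union> pivots S p"] subset_cover[OF cl] by simp
  qed
  have fresh: "pr c < pr a" if c: "c \<in> N" "c \<notin> cover S" and a: "anc a c" "a \<noteq> c" for a c
  proof -
    have pc: "pr c = n - dep c" using c Mc by (auto simp: pr_def)
    show ?thesis
    proof (cases "a \<in> cover S")
      case True
      then show ?thesis using prH[OF True] pc by simp
    next
      case False
      then have "pr a = n - dep a" using Mc by (auto simp: pr_def)
      then show ?thesis using pc dep_less[OF a] dep_le[of c] by simp
    qed
  qed
  have prT: "pr x = n + 1 + (dep x - dep (p s)) + (dep (p s) - dep x)"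
    if "s \<in> S" "x \<in> tendon S s" "x \<notin> ?M" for s x
    using that own[of s x] tendon_cover[of s S] by (auto simp: pr_def)
  have hand: "hand S p pr"
    unfolding hand_def
  proof (intro conjI ballI)
    show "branch_closed S" using cl .
  next
    fix s assume "s \<in> S"
    show "tendon S s \<noteq> {} \<longrightarrow> p s \<in> tendon S s" using p(1) by blast
  next
    fix x y assume "x \<in> N - ?M" "y \<in> ?M"
    then show "pr x < pr y" using prM prn by simp
  next
    fix c assume c: "c \<in> N - cover S"
    have "lo c \<noteq> c" "hi c \<noteq> c" using bounds[of c] c by auto
    then show "lo c \<noteq> 0 \<longrightarrow> pr c < pr (lo c)" "hi c \<noteq> n + 1 \<longrightarrow> pr c < pr (hi c)"
      using fresh[of c "lo c"] fresh[of c "hi c"] anc_lo[of c] anc_hi[of c] lo_N[of c] hi_N[of c] c by blast+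
  next
    fix s x y assume s: "s \<in> S" and x: "x \<in> tendon S s - ?M" and y: "y \<in> tendon S s - ?M"
    have "dep (p s) \<le> dep x" if "anc (p s) x" using dep_less[OF that] by (cases "p s = x") auto
    moreover have "dep y \<le> dep (p s)" if "anc y (p s)" using dep_less[OF that] by (cases "p s = y") auto
    moreover have "dep x < dep y" if "anc x y" "x \<noteq> y" using dep_less that by blast
    moreover have "pr x = n + 1 + (dep x - dep (p s)) + (dep (p s) - dep x)"
      "pr y = n + 1 + (dep y - dep (p s)) + (dep (p s) - dep y)" using prT[OF s] x y by blast+
    ultimately show "x \<noteq> y \<longrightarrow> anc x y \<longrightarrow> (x < s \<longleftrightarrow> y < s) \<longrightarrow>
        (anc (p s) x \<longrightarrow> pr x < pr y) \<and> (anc y (p s) \<longrightarrow> pr y < pr x)" by fastforce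
  qed
  have "potential S p \<le> (\<Sum>s\<in>S. 1)" unfolding potential_def using p(2) by (intro sum_mono) simp
  also have "\<dots> \<le> card N" using SN card_mono[of N S] by simp
  finally have "potential S p \<le> n" by simp
  moreover have "serving k \<phi> S p pr"
    unfolding serving_def using hand br unfolding G_def[symmetric] S_def by blast
  ultimately show ?thesis by blast
qed

end

section \<open>Datatype search trees as interval trees, and distances as walks\<close>

section \<open>Finger strategies in a static tree\<close>

text \<open>The argument \<open>L\<close> is the bound inherited from the surrounding tree, namely
  the last key at which the search turned right. Keeping it general makes induction over subtrees
  possible; the whole tree uses the sentinel \<open>0\<close>.\<close>

fun left_bound :: "nat tree \<Rightarrow> nat \<Rightarrow> nat \<Rightarrow> nat" where
  "left_bound Leaf L x = L"
| "left_bound (Node l a r) L x =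
     (if x = a then L else if x < a then left_bound l L x else left_bound r a x)"

fun right_bound :: "nat tree \<Rightarrow> nat \<Rightarrow> nat \<Rightarrow> nat" where
  "right_bound Leaf H x = H"
| "right_bound (Node l a r) H x =
     (if x = a then H else if x < a then right_bound l a x else right_bound r H x)"

definition tree_adj :: "nat tree \<Rightarrow> nat \<Rightarrow> nat \<Rightarrow> nat \<Rightarrow> nat \<Rightarrow> bool" where
  "tree_adj t L H x y \<longleftrightarrow> x \<in> set_tree t \<and> y \<in> set_tree t \<and>
     (tree_child (left_bound t L) (right_bound t H) x y \<or> tree_child (left_bound t L) (right_bound t H) y x)"

lemma left_bound_bounds:
  "bst t \<Longrightarrow> v \<in> set_tree t \<Longrightarrow> \<forall>x\<in>set_tree t. L < x \<Longrightarrow> L \<le> left_bound t L v \<and> left_bound t L v < v"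
proof (induction t arbitrary: L)
  case (Node l a r)
  consider "v = a" | "v \<in> set_tree l" "v < a" | "v \<in> set_tree r" "a < v" using Node.prems by auto
  then show ?case
  proof cases
    case 3
    then have "a \<le> left_bound r a v \<and> left_bound r a v < v" using Node by auto
    then show ?thesis using 3 Node.prems(3) by auto
  qed (use Node in auto)
qed simp

lemma right_bound_bounds:
  "bst t \<Longrightarrow> v \<in> set_tree t \<Longrightarrow> \<forall>x\<in>set_tree t. x < H \<Longrightarrow> v < right_bound t H v \<and> right_bound t H v \<le> H"
proof (induction t arbitrary: H)
  case (Node l a r)
  consider "v = a" | "v \<in> set_tree l" "v < a" | "v \<in> set_tree r" "a < v" using Node.prems by auto
  then show ?case
  proof cases
    case 2
    then have "v < right_bound l a v \<and> right_bound l a v \<le> a" using Node by auto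
    then show ?thesis using 2 Node.prems(3) by auto
  qed (use Node in auto)
qed simp

lemma left_bound_in: "left_bound t L v \<in> insert L (set_tree t)"
proof (induction t arbitrary: L)
  case (Node l a r)
  show ?case using Node(1)[of L] Node(2)[of a] by auto
qed simp

lemma right_bound_in: "right_bound t H v \<in> insert H (set_tree t)"
proof (induction t arbitrary: H)
  case (Node l a r)
  show ?case using Node(1)[of a] Node(2)[of H] by auto
qed simp

lemma bounds_left_nested:
  assumes "bst t" "\<forall>x\<in>set_tree t. L < x \<and> x < H" "v \<in> set_tree t" "w \<in> set_tree t" "left_bound t L v < w" "w < v"
  shows "left_bound t L v \<le> left_bound t L w \<and> right_bound t H w \<le> v"
  using assms
proof (induction t arbitrary: L H)
  case (Node l a r)
  consider "v = a" | "v \<in> set_tree l" "v < a" | "v \<in> set_tree r" "a < v" using Node.prems by auto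
  then show ?case
  proof cases
    case 1
    then have "w \<in> set_tree l" using Node.prems by auto
    then show ?thesis using 1 Node.prems left_bound_bounds[of l w L] right_bound_bounds[of l w a] by auto
  next
    case 2
    then have "w < a" using Node.prems(6) by simp
    moreover from this have "w \<in> set_tree l" using Node.prems(1,4) by fastforce
    ultimately show ?thesis using 2 Node.prems Node.IH(1)[of L a] by auto
  next
    case 3
    then have "a \<le> left_bound r a v" using Node.prems left_bound_bounds[of r v a] by auto
    then have "w \<in> set_tree r" "a < w" using 3 Node.prems by auto
    then show ?thesis using 3 Node.prems Node.IH(2)[of a H] by auto
  qed
qed simp

lemma bounds_right_nested:
  assumes "bst t" "\<forall>x\<in>set_tree t. L < x \<and> x < H" "v \<in> set_tree t" "w \<in> set_tree t" "v < w" "w < right_bound t H v"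
  shows "v \<le> left_bound t L w \<and> right_bound t H w \<le> right_bound t H v"
  using assms
proof (induction t arbitrary: L H)
  case (Node l a r)
  consider "v = a" | "v \<in> set_tree l" "v < a" | "v \<in> set_tree r" "a < v" using Node.prems by auto
  then show ?case
  proof cases
    case 1
    then have "w \<in> set_tree r" using Node.prems by auto
    then show ?thesis using 1 Node.prems left_bound_bounds[of r w a] right_bound_bounds[of r w H] by auto
  next
    case 2
    then have "right_bound l a v \<le> a" using Node.prems right_bound_bounds[of l v a] by auto
    then have "w \<in> set_tree l" "w < a" using 2 Node.prems by auto
    then show ?thesis using 2 Node.prems Node.IH(1)[of L a] by auto
  next
    case 3
    then have "a < w" using Node.prems(5) by simp
    moreover from this have "w \<in> set_tree r" using Node.prems(1,4) by fastforce
    ultimately show ?thesis using 3 Node.prems Node.IH(2)[of a H] by auto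
  qed
qed simp

lemma left_bound_spans:
  assumes "bst t" "\<forall>x\<in>set_tree t. L < x \<and> x < H" "v \<in> set_tree t" "left_bound t L v \<noteq> L"
  shows "v < right_bound t H (left_bound t L v)"
  using assms
proof (induction t arbitrary: L H)
  case (Node l a r)
  consider "v = a" | "v \<in> set_tree l" "v < a" | "v \<in> set_tree r" "a < v" using Node.prems by auto
  then show ?case
  proof cases
    case 1
    then show ?thesis using Node.prems by simp
  next
    case 2
    then have "left_bound l L v \<in> set_tree l" using left_bound_in[of l L v] Node.prems by auto
    then show ?thesis using 2 Node.prems Node.IH(1)[of L a] by auto
  next
    case 3
    show ?thesis
    proof (cases "left_bound r a v = a")
      case False
      then have "left_bound r a v \<in> set_tree r" using left_bound_in[of r a v] by auto
      then show ?thesis using 3 False Node.prems Node.IH(2)[of a H] by auto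
    qed (use 3 Node.prems in auto)
  qed
qed simp

lemma right_bound_spans:
  assumes "bst t" "\<forall>x\<in>set_tree t. L < x \<and> x < H" "v \<in> set_tree t" "right_bound t H v \<noteq> H"
  shows "left_bound t L (right_bound t H v) < v"
  using assms
proof (induction t arbitrary: L H)
  case (Node l a r)
  consider "v = a" | "v \<in> set_tree l" "v < a" | "v \<in> set_tree r" "a < v" using Node.prems by auto
  then show ?case
  proof cases
    case 1
    then show ?thesis using Node.prems by simp
  next
    case 3
    then have "right_bound r H v \<in> set_tree r" using right_bound_in[of r H v] Node.prems by auto
    then show ?thesis using 3 Node.prems Node.IH(2)[of a H] by auto
  next
    case 2
    show ?thesis
    proof (cases "right_bound l a v = a")
      case False
      then have "right_bound l a v \<in> set_tree l" using right_bound_in[of l a v] by auto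
      then show ?thesis using 2 False Node.prems Node.IH(1)[of L a] by auto
    qed (use 2 Node.prems in auto)
  qed
qed simp

lemma bounds_value: "t \<noteq> Leaf \<Longrightarrow> left_bound t L (value t) = L \<and> right_bound t H (value t) = H"
  by (cases t) auto

lemma tree_child_left:
  assumes "bst (Node l a r)" "x \<in> set_tree l" "y \<in> set_tree l"
  shows "tree_child (left_bound (Node l a r) L) (right_bound (Node l a r) H) x y =
    tree_child (left_bound l L) (right_bound l a) x y"
proof -
  have "x < a" "y < a" using assms by auto
  then show ?thesis unfolding tree_child_def by simp
qed

lemma tree_child_right:
  assumes "bst (Node l a r)" "x \<in> set_tree r" "y \<in> set_tree r"
  shows "tree_child (left_bound (Node l a r) L) (right_bound (Node l a r) H) x y =
    tree_child (left_bound r a) (right_bound r H) x y"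
proof -
  have "a < x" "a < y" using assms by auto
  then show ?thesis unfolding tree_child_def by simp
qed

lemma tree_child_value_left:
  assumes "bst (Node l a r)" "\<forall>x\<in>set_tree (Node l a r). L < x \<and> x < H" "l \<noteq> Leaf"
  shows "tree_child (left_bound (Node l a r) L) (right_bound (Node l a r) H) a (value l)"
proof -
  have v: "value l \<in> set_tree l" using value_in_set_tree[OF assms(3)] .
  then have "value l < a" "L < value l" using assms by auto
  then show ?thesis using bounds_value[OF assms(3)] unfolding tree_child_def by simp
qed

lemma tree_child_value_right:
  assumes "bst (Node l a r)" "\<forall>x\<in>set_tree (Node l a r). L < x \<and> x < H" "r \<noteq> Leaf"
  shows "tree_child (left_bound (Node l a r) L) (right_bound (Node l a r) H) a (value r)"
proof -
  have v: "value r \<in> set_tree r" using value_in_set_tree[OF assms(3)] .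
  then have "a < value r" "value r < H" using assms by auto
  then show ?thesis using bounds_value[OF assms(3)] unfolding tree_child_def by simp
qed

lemma ex_tree_parent:
  assumes "bst t" "\<forall>x\<in>set_tree t. L < x \<and> x < H" "c \<in> set_tree t" "c \<noteq> value t"
  shows "\<exists>v\<in>set_tree t. tree_child (left_bound t L) (right_bound t H) v c"
  using assms
proof (induction t arbitrary: L H)
  case (Node l a r)
  consider "c \<in> set_tree l" | "c \<in> set_tree r" using Node.prems by auto
  then show ?case
  proof cases
    case 1
    then have "l \<noteq> Leaf" by auto
    show ?thesis
    proof (cases "c = value l")
      case True
      then show ?thesis using tree_child_value_left[OF Node.prems(1,2) \<open>l \<noteq> Leaf\<close>] 1
        by (intro bexI[of _ a]) (auto simp del: left_bound.simps right_bound.simps)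
    next
      case False
      then obtain v where "v \<in> set_tree l" "tree_child (left_bound l L) (right_bound l a) v c"
        using Node.IH(1)[of L a] Node.prems 1 by auto
      then show ?thesis using tree_child_left[OF Node.prems(1) _ 1, of v L H]
        by (intro bexI[of _ v]) (auto simp del: left_bound.simps right_bound.simps)
    qed
  next
    case 2
    then have "r \<noteq> Leaf" by auto
    show ?thesis
    proof (cases "c = value r")
      case True
      then show ?thesis using tree_child_value_right[OF Node.prems(1,2) \<open>r \<noteq> Leaf\<close>] 2
        by (intro bexI[of _ a]) (auto simp del: left_bound.simps right_bound.simps)
    next
      case False
      then obtain v where "v \<in> set_tree r" "tree_child (left_bound r a) (right_bound r H) v c"
        using Node.IH(2)[of a H] Node.prems 2 by auto
      then show ?thesis using tree_child_right[OF Node.prems(1) _ 2, of v L H]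
        by (intro bexI[of _ v]) (auto simp del: left_bound.simps right_bound.simps)
    qed
  qed
qed simp

lemma tree_adj_left: "bst (Node l a r) \<Longrightarrow> tree_adj l L a x y \<Longrightarrow> tree_adj (Node l a r) L H x y"
  unfolding tree_adj_def using tree_child_left[of l a r x y L H] tree_child_left[of l a r y x L H] by auto

lemma tree_adj_right: "bst (Node l a r) \<Longrightarrow> tree_adj r a H x y \<Longrightarrow> tree_adj (Node l a r) L H x y"
  unfolding tree_adj_def using tree_child_right[of l a r x y L H] tree_child_right[of l a r y x L H] by auto

lemma tree_adj_sym: "tree_adj t L H x y \<Longrightarrow> tree_adj t L H y x"
  unfolding tree_adj_def by blast

lemma tree_adj_walk_sym: "(tree_adj t L H ^^ d) x y \<Longrightarrow> (tree_adj t L H ^^ d) y x"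
proof (induction d arbitrary: y)
  case (Suc d)
  then obtain z where "(tree_adj t L H ^^ d) x z" "tree_adj t L H z y" by auto
  then show ?case using Suc.IH tree_adj_sym by (intro relpowp_Suc_I2) blast+
qed simp

lemma tree_walk_depth:
  assumes "bst t" "\<forall>x\<in>set_tree t. L < x \<and> x < H" "x \<in> set_tree t"
  shows "(tree_adj t L H ^^ tdepth t x) (value t) x"
  using assms
proof (induction t arbitrary: L H)
  case (Node l a r)
  let ?t = "Node l a r"
  consider "x = a" | "x \<in> set_tree l" "x \<noteq> a" | "x \<in> set_tree r" "x \<notin> set_tree l" "x \<noteq> a"
    using Node.prems by auto
  then show ?case
  proof cases
    case 2
    then have "(tree_adj l L a ^^ tdepth l x) (value l) x" using Node by auto
    then have "(tree_adj ?t L H ^^ tdepth l x) (value l) x"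
      using relpowp_mono[of "tree_adj l L a" "tree_adj ?t L H"] tree_adj_left[OF Node.prems(1)] by blast
    moreover have "l \<noteq> Leaf" using 2 by auto
    then have "tree_adj ?t L H a (value l)"
      using tree_child_value_left[OF Node.prems(1,2)] value_in_set_tree[of l] unfolding tree_adj_def by auto
    ultimately show ?thesis using 2 relpowp_Suc_I2[of "tree_adj ?t L H" a "value l"] by auto
  next
    case 3
    then have "(tree_adj r a H ^^ tdepth r x) (value r) x" using Node by auto
    then have "(tree_adj ?t L H ^^ tdepth r x) (value r) x"
      using relpowp_mono[of "tree_adj r a H" "tree_adj ?t L H"] tree_adj_right[OF Node.prems(1)] by blast
    moreover have "r \<noteq> Leaf" using 3 by auto
    then have "tree_adj ?t L H a (value r)"
      using tree_child_value_right[OF Node.prems(1,2)] value_in_set_tree[of r] unfolding tree_adj_def by auto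
    ultimately show ?thesis using 3 relpowp_Suc_I2[of "tree_adj ?t L H" a "value r"] by auto
  qed simp
qed simp

text \<open>If no child subtree contains both keys, the path goes through the root, and the two
  depths add up just as in \<open>tdist\<close>. Otherwise a walk in the child subtree is also a
  walk in the whole tree.\<close>

lemma tree_walk:
  assumes "bst t" "\<forall>x\<in>set_tree t. L < x \<and> x < H" "x \<in> set_tree t" "y \<in> set_tree t"
  shows "(tree_adj t L H ^^ tdist t x y) x y"
  using assms
proof (induction t arbitrary: L H)
  case (Node l a r)
  let ?t = "Node l a r"
  consider "x \<in> set_tree l" "y \<in> set_tree l"
    | "\<not> (x \<in> set_tree l \<and> y \<in> set_tree l)" "x \<in> set_tree r" "y \<in> set_tree r"
    | "\<not> (x \<in> set_tree l \<and> y \<in> set_tree l)" "\<not> (x \<in> set_tree r \<and> y \<in> set_tree r)" by blast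
  then show ?case
  proof cases
    case 1
    then have "(tree_adj l L a ^^ tdist l x y) x y" using Node by auto
    then show ?thesis
      using relpowp_mono[of "tree_adj l L a" "tree_adj ?t L H"] tree_adj_left[OF Node.prems(1)] 1 by auto
  next
    case 2
    then have "(tree_adj r a H ^^ tdist r x y) x y" using Node by auto
    then show ?thesis
      using relpowp_mono[of "tree_adj r a H" "tree_adj ?t L H"] tree_adj_right[OF Node.prems(1)] 2 by auto
  next
    case 3
    have "(tree_adj ?t L H ^^ tdepth ?t x) x a"
      using tree_adj_walk_sym[OF tree_walk_depth[OF Node.prems(1-3)]] unfolding tree.sel .
    moreover have "(tree_adj ?t L H ^^ tdepth ?t y) a y"
      using tree_walk_depth[OF Node.prems(1,2,4)] unfolding tree.sel .
    moreover have "tdist ?t x y = tdepth ?t x + tdepth ?t y"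
      unfolding tdist.simps if_not_P[OF 3(1)] if_not_P[OF 3(2)] ..
    ultimately show ?thesis unfolding relpowp_add by (simp only: relpowp_add) blast
  qed
qed simp

lemma interval_tree_bst:
  assumes T: "bst T" "set_tree T = {1..n}" and n: "1 \<le> n"
  shows "interval_tree n (value T) (left_bound T 0) (right_bound T (n + 1))"
proof -
  have TL: "T \<noteq> Leaf" using T n by auto
  have LH: "\<forall>x\<in>set_tree T. 0 < x \<and> x < n + 1" using T by auto
  show ?thesis
  proof
    show "value T \<in> {1..n}" using value_in_set_tree[OF TL] T by simp
    show "left_bound T 0 (value T) = 0" "right_bound T (n + 1) (value T) = n + 1" using bounds_value[OF TL] by auto
    show "left_bound T 0 v < v \<and> v < right_bound T (n + 1) v \<and> right_bound T (n + 1) v \<le> n + 1"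
      if "v \<in> {1..n}" for v
      using left_bound_bounds[OF T(1)] right_bound_bounds[OF T(1)] that LH T(2) by auto
  qed (use bounds_left_nested[OF T(1) LH] bounds_right_nested[OF T(1) LH] left_bound_spans[OF T(1) LH]
      right_bound_spans[OF T(1) LH] ex_tree_parent[OF T(1) LH] T(2) in auto)
qed

section \<open>From a finger strategy to the cost of a dynamic tree\<close>

text \<open>All finger positions at time \<open>t\<close>, as a function that one access updates at
  one point; \<open>finger_pos\<close> is its value at the finger about to move.\<close>

definition finger_state :: "nat list \<Rightarrow> (nat \<Rightarrow> nat) \<Rightarrow> (nat \<Rightarrow> nat) \<Rightarrow> nat \<Rightarrow> nat \<Rightarrow> nat" where
  "finger_state X ell f t j = (if \<exists>s<t. f s = j then X ! (GREATEST s. s < t \<and> f s = j) else ell j)"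

lemma finger_state_0: "finger_state X ell f 0 = ell"
  by (auto simp: finger_state_def)

lemma finger_state_Suc: "finger_state X ell f (Suc t) = (finger_state X ell f t)(f t := X ! t)"
proof
  fix j
  show "finger_state X ell f (Suc t) j = ((finger_state X ell f t)(f t := X ! t)) j"
  proof (cases "j = f t")
    case True
    have "(GREATEST s. s < Suc t \<and> f s = f t) = t" by (rule Greatest_equality) auto
    then show ?thesis using True by (auto simp: finger_state_def)
  next
    case False
    then have e: "s < Suc t \<and> f s = j \<longleftrightarrow> s < t \<and> f s = j" for s using less_Suc_eq by auto
    show ?thesis unfolding finger_state_def e using False by simp
  qed
qed

text \<open>The constant is \<open>16 * (8 + 24) + 16 + 16\<close>. Here 8 comes from moving
  fingers, 24 from the marked set, and the last two terms from the initial potential and the last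
  batch. These two are bounded by \<open>n\<close>, which is at most the number of accesses and so
  at most the finger cost. The term \<open>h\<close> is the depth bound, paid once per
  access.\<close>

lemma OPT_le_finger_cost:
  assumes n: "1 \<le> n" "n \<le> length X" and k: "1 \<le> k" "k < 2 ^ h"
    and X: "set X \<subseteq> {1..n}" and T: "bst T" "set_tree T = {1..n}"
    and ell: "\<forall>j<k. ell j \<in> {1..n}" and f: "\<forall>t<length X. f t < k"
  shows "OPT n X \<le> (544 + h) * finger_cost T X ell f"
proof -
  interpret interval_tree n "value T" "left_bound T 0" "right_bound T (n + 1)"
    using interval_tree_bst[OF T n(1)] .
  let ?\<phi> = "finger_state X ell f" and ?m = "length X"
  have \<phi>: "?\<phi> i j \<in> N" if "i \<le> ?m" "j < k" for i j
    using that
  proof (induction i)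
    case 0
    then show ?case using ell finger_state_0 by simp
  next
    case (Suc i)
    then have "X ! i \<in> N" using X nth_mem by (meson Suc_le_eq subsetD)
    then show ?case using Suc by (simp add: finger_state_Suc)
  qed
  define w where "w i = 1 + tdist T (X ! i) (finger_pos X ell f i)" for i
  have W: "(\<Sum>i=0..<?m. w i) = finger_cost T X ell f"
    unfolding finger_cost_def w_def by (simp add: lessThan_atLeast0)
  have walk: "(adjacent ^^ tdist T (X ! i) (finger_pos X ell f i)) (?\<phi> i (f i)) (X ! i)" if i: "i < ?m" for i
  proof -
    have pos: "finger_pos X ell f i = ?\<phi> i (f i)" by (simp add: finger_pos_def finger_state_def)
    have "tree_adj T 0 (n + 1) = adjacent"
      unfolding tree_adj_def adjacent_def T(2) by (intro ext) blast
    moreover have "X ! i \<in> set_tree T" using X i T(2) nth_mem by blast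
    moreover have "?\<phi> i (f i) \<in> set_tree T" using \<phi>[of i "f i"] i f T(2) by simp
    moreover have "\<forall>x\<in>set_tree T. 0 < x \<and> x < n + 1" using T(2) by simp
    ultimately show ?thesis
      using tree_walk[OF T(1), of 0 "n + 1" "X ! i" "?\<phi> i (f i)"] tree_adj_walk_sym unfolding pos by metis
  qed
  \<comment> \<open>Dependent choice produces infinite sequences, so both conditions are made
    vacuous beyond the end of \<open>X\<close>.\<close>
  define P where "P i s = (i \<le> ?m \<longrightarrow> (case s of (S, p, pr) \<Rightarrow> serving k (?\<phi> i) S p pr))" for i s
  define R where "R i s s' = (i < ?m \<longrightarrow> (case s of (S, p, pr) \<Rightarrow> case s' of (S', p', pr') \<Rightarrow>
    \<exists>Q. X ! i \<in> Q \<and> advance N 8 pr (marked S p) (potential S p) Q (w i) pr' (marked S' p') (potential S' p')))"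
    for i s s'
  have "?\<phi> 0 ` {..<k} \<subseteq> N" using ell by (auto simp: finger_state_0)
  then obtain S0 p0 pr0 where s0: "serving k (?\<phi> 0) S0 p0 pr0" "potential S0 p0 \<le> n"
    using ex_serving by blast
  have step: "\<exists>s'. P (Suc i) s' \<and> R i s s'" if "P i s" for i s
  proof (cases "i < ?m")
    case True
    obtain S p pr where s: "s = (S, p, pr)" by (cases s)
    have sv: "serving k (?\<phi> i) S p pr" using that True s by (simp add: P_def)
    obtain Q S' p' pr' where "serving k ((?\<phi> i)(f i := X ! i)) S' p' pr'" "X ! i \<in> Q"
      "advance N 8 pr (marked S p) (potential S p) Q (w i) pr' (marked S' p') (potential S' p')"
      using access_finger[where \<phi> = "?\<phi> i" and f = "f i", OF sv _ walk[OF True]] f True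
      unfolding w_def by blast
    then show ?thesis unfolding P_def R_def s by (intro exI[of _ "(S', p', pr')"]) (auto simp: finger_state_Suc)
  qed (auto simp: P_def R_def)
  have P0: "P 0 (S0, p0, pr0)" using s0 by (simp add: P_def)
  obtain s where s: "s 0 = (S0, p0, pr0)" "\<And>i. P i (s i)" "\<And>i. R i (s i) (s (Suc i))"
  proof -
    have "\<exists>s. (\<forall>i. (if i = 0 then s i = (S0, p0, pr0) else True) \<and> P i (s i)) \<and> (\<forall>i. R i (s i) (s (Suc i)))"
      using dependent_nat_choice[of "\<lambda>i x. (if i = 0 then x = (S0, p0, pr0) else True) \<and> P i x" R] P0 step
      by (metis nat.distinct(1))
    then show thesis using that by metis
  qed
  define S where "S i = fst (s i)" for i
  define p where "p i = fst (snd (s i))" for i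
  define pr where "pr i = snd (snd (s i))" for i
  have sv: "serving k (?\<phi> i) (S i) (p i) (pr i)" if "i \<le> ?m" for i
    using s(2)[of i] that unfolding P_def S_def p_def pr_def by (simp add: case_prod_unfold)
  have "\<forall>i. \<exists>Q. i < ?m \<longrightarrow> X ! i \<in> Q \<and> advance N 8 (pr i) (marked (S i) (p i)) (potential (S i) (p i)) Q (w i)
      (pr (Suc i)) (marked (S (Suc i)) (p (Suc i))) (potential (S (Suc i)) (p (Suc i)))"
    using s(3) unfolding R_def S_def p_def pr_def by (simp add: case_prod_unfold)
  then obtain Q where Q: "\<And>i. i < ?m \<Longrightarrow> X ! i \<in> Q i"
    "\<And>i. i < ?m \<Longrightarrow> advance N 8 (pr i) (marked (S i) (p i)) (potential (S i) (p i)) (Q i) (w i)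
      (pr (Suc i)) (marked (S (Suc i)) (p (Suc i))) (potential (S (Suc i)) (p (Suc i)))" by metis
  \<comment> \<open>The initial tree is free, so the treap for the initial priorities costs
    nothing.\<close>
  obtain t where t: "bst t" "set_tree t = N" "heap (pr 0) t" using ex_treap[of N] by blast
  have tL: "t \<noteq> Leaf" using t(2) n by auto
  have "\<exists>d v. serves t (drop 0 X) d v \<and>
    d \<le> 0 + 16 * (8 + 24) * (\<Sum>j=0..<?m. w j) + 16 * potential (S 0) (p 0) + 16 * card N + h * (?m - 0)"
    by (rule serves_advances[where M = "\<lambda>i. marked (S i) (p i)" and k = k, OF _ _ Q(2,1) _ _ k
      reshape_refl[OF tL] t])
     (use card_marked[OF sv _] k(1) in \<open>auto simp: w_def\<close>)
  then obtain d v where d: "serves t X d v"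
    "d \<le> 16 * (8 + 24) * (\<Sum>j=0..<?m. w j) + 16 * potential (S 0) (p 0) + 16 * card N + h * ?m" by auto
  have "?m = (\<Sum>i=0..<?m. 1)" by simp
  also have "\<dots> \<le> (\<Sum>i=0..<?m. w i)" unfolding w_def by (intro sum_mono) simp
  finally have m: "?m \<le> finger_cost T X ell f" using W by simp
  have "potential (S 0) (p 0) \<le> n" using s0(2) s(1) by (simp add: S_def p_def)
  then have "d \<le> 512 * finger_cost T X ell f + 16 * ?m + 16 * ?m + h * ?m"
    using d(2) n(2) unfolding W by simp
  also have "\<dots> \<le> (544 + h) * finger_cost T X ell f"
    using m mult_le_mono2[OF m, of h] unfolding add_mult_distrib by linarith
  finally show ?thesis using OPT_le[OF d(1) t(1,2)] by simp
qed

text \<open>Both minima range over nonempty sets of natural numbers and are attained. For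
  nonemptiness, one finger placed at key 1 may serve all accesses.\<close>

lemma ex_optimal_fingers:
  assumes "1 \<le> n" "1 \<le> k"
  shows "\<exists>T ell f. bst T \<and> set_tree T = {1..n} \<and> (\<forall>j<k. ell j \<in> {1..n}) \<and> (\<forall>t<length X. f t < k) \<and>
    Fk k n X = finger_cost T X ell f"
proof -
  obtain u where "bst u" "set_tree u = {1..n}" using ex_treap[of "{1..n}" "\<lambda>_. 0"] by blast
  then have "{FkT k n T X |T. bst T \<and> set_tree T = {1..n}} \<noteq> {}" by blast
  from Inf_nat_def1[OF this] obtain T where T: "bst T" "set_tree T = {1..n}" "Fk k n X = FkT k n T X"
    unfolding Fk_def by blast
  have "finger_cost T X (\<lambda>_. 1) (\<lambda>_. 0) \<in> {finger_cost T X ell f | ell f.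
      (\<forall>j<k. ell j \<in> {1..n}) \<and> (\<forall>t<length X. f t < k)}" using assms by fastforce
  then have "{finger_cost T X ell f | ell f. (\<forall>j<k. ell j \<in> {1..n}) \<and> (\<forall>t<length X. f t < k)} \<noteq> {}" by blast
  from Inf_nat_def1[OF this] show ?thesis unfolding T(3) FkT_def using T(1,2) by blast
qed

lemma OPT_Nil: "OPT n [] = 0"
proof -
  obtain u where "bst u" "set_tree u = {1..n}" using ex_treap[of "{1..n}" "\<lambda>_. 0"] by blast
  then have "OPT n [] \<le> 0" using OPT_le[OF serves_Nil] by blast
  then show ?thesis by simp
qed

text \<open>Rounding up strictly beyond the logarithm costs at most 1, which the second copy of
  \<open>lg\<close> absorbs because \<open>lg\<close> is at least 1.\<close>

lemma ex_log_bound: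
  assumes "1 \<le> k"
  shows "\<exists>h. k < 2 ^ h \<and> real h \<le> 2 * lg (real k)"
proof -
  define h where "h = Suc (nat \<lfloor>log 2 (real k)\<rfloor>)"
  have l0: "0 \<le> log 2 (real k)" using assms by simp
  have "log 2 (real k) < real h" unfolding h_def using l0 by linarith
  then have "real k < 2 powr real h" using assms by (simp add: log_less_iff)
  then have "real k < 2 ^ h" by (simp add: powr_realpow)
  then have "k < 2 ^ h" by (metis of_nat_less_iff of_nat_numeral of_nat_power)
  moreover have "log 2 (real k) \<le> lg (real k)" unfolding lg_def using assms by (intro log_le_cancel_iff[THEN iffD2]) auto
  moreover have "1 \<le> lg (real k)" unfolding lg_def by simp
  moreover have "real h \<le> log 2 (real k) + 1" unfolding h_def using l0 by linarith
  ultimately show ?thesis by (intro exI[of _ h]) linarith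
qed

theorem theorem2:
  "\<exists>c::real. c > 0 \<and>
     (\<forall>k::nat. \<forall>n m::nat. \<forall>X::nat list.
        k \<ge> 1 \<longrightarrow> n \<le> m \<longrightarrow> length X = m \<longrightarrow> set X \<subseteq> {1..n} \<longrightarrow>
        real (OPT n X) \<le> c * lg (real k) * real (Fk k n X))"
proof -
  have "real (OPT n X) \<le> 546 * lg (real k) * real (Fk k n X)"
    if k: "k \<ge> 1" and n: "n \<le> length X" and X: "set X \<subseteq> {1..n}" for k n :: nat and X
  proof (cases "n = 0")
    case True
    \<comment> \<open>There is no root when \<open>n = 0\<close>, but then there is nothing to
      access either.\<close>
    then have "X = []" using X by simp
    moreover have "0 \<le> lg (real k)" unfolding lg_def by simp
    ultimately show ?thesis by (simp add: OPT_Nil)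
  next
    case False
    then have n1: "1 \<le> n" by simp
    obtain h where h: "k < 2 ^ h" "real h \<le> 2 * lg (real k)" using ex_log_bound[OF k] by blast
    obtain T ell f where T: "bst T" "set_tree T = {1..n}" "\<forall>j<k. ell j \<in> {1..n}" "\<forall>t<length X. f t < k"
      and F: "Fk k n X = finger_cost T X ell f" using ex_optimal_fingers[OF n1 k] by blast
    have "OPT n X \<le> (544 + h) * Fk k n X"
      unfolding F using OPT_le_finger_cost[OF n1 n k h(1) X T] .
    then have "real (OPT n X) \<le> real ((544 + h) * Fk k n X)" by (rule of_nat_mono)
    also have "\<dots> = (544 + real h) * real (Fk k n X)" by simp
    \<comment> \<open>The constant is \<open>544 + 2\<close>: 544 is at most
      \<open>544 * lg k\<close>, and \<open>h\<close> is at most \<open>2 * lg k\<close>.\<close>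
    also have "\<dots> \<le> (546 * lg (real k)) * real (Fk k n X)"
    proof (rule mult_right_mono)
      have "1 \<le> lg (real k)" unfolding lg_def by simp
      then show "544 + real h \<le> 546 * lg (real k)" using h(2) by linarith
    qed simp
    finally show ?thesis .
  qed
  then show ?thesis by (intro exI[of _ 546]) auto
qed

end
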